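(* Let $N\ge 1$, $s\in(0,1)$, $p>2$, $0<C_o\le C_1$, let $E\subset\mathbb R^N$ be open and $T>0$, and let $u$ be a continuous (in $E_T:=E\times(0,T]$) local weak solution in $E_T$ to the $(s,p)$-parabolic equation $\partial_t u+\mathscr L u=0$ (see context). Assume that $u\ge 0$ a.e. in $\mathbb R^N\times(0,T)$ and let $(x_o,t_o)\in E\times(0,T)$. If $u(x_o,t_o)>0$, then $u>0$ in $E\times[t_o,T)$. Alternatively, if $u(x_o,t_o)=0$, then $u=0$ a.e. in $\mathbb R^N\times(0,t_o]$.
   Context: Notation: $\Phi_p(\xi):=|\xi|^{p-2}\xi$ for $\xi\in\mathbb R$; $E_T:=E\times(0,T]$ with $E\subset\mathbb R^N$ open (not assumed connected) and $T>0$. Equation: $\partial_t u+\mathscr L u=0$ weakly in $E_T$, where $$\mathscr L u(x,t)=\mathrm{p.v.}\int_{\mathbb R^N}\mathsf K(x,y,t)\,|u(x,t)-u(y,t)|^{p-2}(u(x,t)-u(y,t))\,dy$$ and $\mathsf K:\mathbb R^N\times\mathbb R^N\times(0,T]\to[0,\infty)$ is measurable and satisfies, uniformly in $t$, $$\frac{C_o}{|x-y|^{N+sp}}\le \mathsf K(x,y,t)=\mathsf K(y,x,t)\le\frac{C_1}{|x-y|^{N+sp}}\quad\text{for a.e. }x,y\in\mathbb R^N.$$ Local weak sub(super)-solution: a measurable function $u:\mathbb R^N\times(0,T]\to\mathbb R$ with $u\in C_{\rm loc}(0,T;L^2_{\rm loc}(E))\cap L^p_{\rm loc}(0,T;W^{s,p}_{\rm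 loc}(E))$ such that for every $[t_1,t_2]\subset(0,T]$, $$\int_{t_1}^{t_2}\int_{\mathbb R^N}\frac{|u(x,t)|^{p-1}}{1+|x|^{N+sp}}\,dx\,dt<\infty$$ and $$\int_E\varphi u\,dx\Big|_{t_1}^{t_2}-\int_{t_1}^{t_2}\int_E\partial_t\varphi\,u\,dx\,dt+\int_{t_1}^{t_2}\mathscr E(u(\cdot,t),\varphi(\cdot,t))\,dt\le(\ge)\,0$$ for all nonnegative $\varphi\in W^{1,2}_{\rm loc}(0,T;L^2(E))\cap L^p_{\rm loc}(0,T;W^{s,p}_o(E))$, where $$\mathscr E(u(\cdot,t),\varphi(\cdot,t)):=\int_{\mathbb R^N}\int_{\mathbb R^N}\mathsf K(x,y,t)\,\Phi_p(u(x,t)-u(y,t))\,(\varphi(x,t)-\varphi(y,t))\,dy\,dx.$$ Here $W^{s,p}_o(E)$ denotes the functions of $W^{s,p}(\mathbb R^N)$ vanishing a.e. outside $E$; the subscript "loc" refers to compact subsets of $E$ in space and to compact subintervals of $(0,T]$ in time. A local weak solution is a function that is both a local weak sub-solution and a local weak super-solution. No initial or boundary data are prescribed. *)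

theory Defs
  imports "HOL-Analysis.Analysis"
begin

text \<open>
  Conventions: the space is an arbitrary Euclidean space of dimension \<open>N = DIM('a) \<ge> 1\<close>; functions
  of space and time are curried, \<open>u x t\<close>; measurable means Lebesgue measurable and every integral
  is taken with respect to Lebesgue measure. Local in time refers to the compact subintervals
  \<open>{t1..t2}\<close> of the half-open interval \<open>{0<..T}\<close>. Values of \<open>u\<close> and \<open>K\<close> at times outside
  \<open>{0<..T}\<close> play no role.
\<close>

definition Phi :: "real \<Rightarrow> real \<Rightarrow> real" where
  "Phi p \<xi> = \<bar>\<xi>\<bar> powr (p - 2) * \<xi>"


subsection \<open>Kernels\<close>

definition admissible_kernel ::
  "real \<Rightarrow> real \<Rightarrow> real \<Rightarrow> real \<Rightarrow> real \<Rightarrow> ('a::euclidean_space \<Rightarrow> 'a \<Rightarrow> real \<Rightarrow> real) \<Rightarrow> bool" where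
  "admissible_kernel s p Co C1 T K \<longleftrightarrow>
     (\<lambda>(x, y, t). K x y t) \<in> borel_measurable (lebesgue_on (UNIV \<times> UNIV \<times> {0<..T})) \<and>
     (\<forall>x y. \<forall>t\<in>{0<..T}. 0 \<le> K x y t) \<and>
     (\<forall>t\<in>{0<..T}. AE (x, y) in lebesgue.
        Co / norm (x - y) powr (real DIM('a) + s * p) \<le> K x y t \<and>
        K x y t = K y x t \<and>
        K x y t \<le> C1 / norm (x - y) powr (real DIM('a) + s * p))"


subsection \<open>Function spaces\<close>

definition in_L2 :: "'a::euclidean_space set \<Rightarrow> ('a \<Rightarrow> real) \<Rightarrow> bool" where
  "in_L2 A v \<longleftrightarrow> v \<in> borel_measurable (lebesgue_on A) \<and>
     (\<integral>\<^sup>+x\<in>A. ennreal ((v x)\<^sup>2) \<partial>lebesgue) < \<infinity>"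

text \<open>The \<open>p\<close>-th power of the norm of \<open>W\<^sup>s\<^sup>,\<^sup>p(A)\<close>; the second summand is the Gagliardo seminorm.\<close>

definition Wsp_norm_pow :: "real \<Rightarrow> real \<Rightarrow> 'a::euclidean_space set \<Rightarrow> ('a \<Rightarrow> real) \<Rightarrow> ennreal" where
  "Wsp_norm_pow s p A v =
     (\<integral>\<^sup>+x\<in>A. ennreal (\<bar>v x\<bar> powr p) \<partial>lebesgue) +
     (\<integral>\<^sup>+x\<in>A. (\<integral>\<^sup>+y\<in>A. ennreal (\<bar>v x - v y\<bar> powr p / norm (x - y) powr (real DIM('a) + s * p))
        \<partial>lebesgue) \<partial>lebesgue)"

definition in_Wsp :: "real \<Rightarrow> real \<Rightarrow> 'a::euclidean_space set \<Rightarrow> ('a \<Rightarrow> real) \<Rightarrow> bool" where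
  "in_Wsp s p A v \<longleftrightarrow> v \<in> borel_measurable (lebesgue_on A) \<and> Wsp_norm_pow s p A v < \<infinity>"

definition in_Wsp_o :: "real \<Rightarrow> real \<Rightarrow> 'a::euclidean_space set \<Rightarrow> ('a \<Rightarrow> real) \<Rightarrow> bool" where
  "in_Wsp_o s p E v \<longleftrightarrow> in_Wsp s p UNIV v \<and> (AE x in lebesgue. x \<notin> E \<longrightarrow> v x = 0)"

text \<open>\<open>C\<^sub>l\<^sub>o\<^sub>c(0,T; L\<^sup>2(A))\<close>\<close>

definition Cloc_L2 :: "real \<Rightarrow> 'a::euclidean_space set \<Rightarrow> ('a \<Rightarrow> real \<Rightarrow> real) \<Rightarrow> bool" where
  "Cloc_L2 T A v \<longleftrightarrow>
     (\<forall>t\<in>{0<..T}. in_L2 A (\<lambda>x. v x t) \<and>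
        ((\<lambda>\<tau>. \<integral>\<^sup>+x\<in>A. ennreal ((v x \<tau> - v x t)\<^sup>2) \<partial>lebesgue) \<longlongrightarrow> 0) (at t within {0<..T}))"

text \<open>\<open>L\<^sup>p\<^sub>l\<^sub>o\<^sub>c(0,T; W\<^sup>s\<^sup>,\<^sup>p(A))\<close>, for a jointly measurable \<open>v\<close>\<close>

definition Lploc_Wsp ::
  "real \<Rightarrow> real \<Rightarrow> real \<Rightarrow> 'a::euclidean_space set \<Rightarrow> ('a \<Rightarrow> real \<Rightarrow> real) \<Rightarrow> bool" where
  "Lploc_Wsp s p T A v \<longleftrightarrow>
     (AE t in lebesgue_on {0<..T}. in_Wsp s p A (\<lambda>x. v x t)) \<and>
     (\<forall>t1 t2. 0 < t1 \<and> t1 < t2 \<and> t2 \<le> T \<longrightarrow>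
        (\<integral>\<^sup>+t\<in>{t1..t2}. Wsp_norm_pow s p A (\<lambda>x. v x t) \<partial>lebesgue) < \<infinity>)"

definition time_test_function :: "real \<Rightarrow> (real \<Rightarrow> real) \<Rightarrow> bool" where
  "time_test_function T \<eta> \<longleftrightarrow>
     (\<forall>k. (deriv ^^ k) \<eta> differentiable_on UNIV) \<and>
     compact (closure {t. \<eta> t \<noteq> 0}) \<and> closure {t. \<eta> t \<noteq> 0} \<subseteq> {0<..<T}"

text \<open>
  \<open>\<phi> \<in> W\<^sup>1\<^sup>,\<^sup>2\<^sub>l\<^sub>o\<^sub>c(0,T; L\<^sup>2(E))\<close> with weak time derivative \<open>\<psi>\<close>. The identity in \<open>L\<^sup>2(E)\<close> that defines the
  weak derivative of an \<open>L\<^sup>2(E)\<close>-valued map is spelled out pointwise a.e. in \<open>E\<close>. Elements of this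
  space have a representative that is continuous in time with values in \<open>L\<^sup>2(E)\<close>; \<open>\<phi>\<close> is required
  to be that representative, so that \<open>\<phi>(\<cdot>,t)\<close> is meaningful for every \<open>t\<close>.
\<close>

definition W12loc_L2 ::
  "real \<Rightarrow> 'a::euclidean_space set \<Rightarrow> ('a \<Rightarrow> real \<Rightarrow> real) \<Rightarrow> ('a \<Rightarrow> real \<Rightarrow> real) \<Rightarrow> bool" where
  "W12loc_L2 T E \<phi> \<psi> \<longleftrightarrow>
     (\<lambda>(x, t). \<phi> x t) \<in> borel_measurable (lebesgue_on (E \<times> {0<..T})) \<and>
     (\<lambda>(x, t). \<psi> x t) \<in> borel_measurable (lebesgue_on (E \<times> {0<..T})) \<and>
     Cloc_L2 T E \<phi> \<and>
     (\<forall>t1 t2. 0 < t1 \<and> t1 < t2 \<and> t2 \<le> T \<longrightarrow>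
        (\<integral>\<^sup>+t\<in>{t1..t2}. (\<integral>\<^sup>+x\<in>E. ennreal ((\<phi> x t)\<^sup>2) \<partial>lebesgue) \<partial>lebesgue) < \<infinity> \<and>
        (\<integral>\<^sup>+t\<in>{t1..t2}. (\<integral>\<^sup>+x\<in>E. ennreal ((\<psi> x t)\<^sup>2) \<partial>lebesgue) \<partial>lebesgue) < \<infinity>) \<and>
     (\<forall>\<eta>. time_test_function T \<eta> \<longrightarrow>
        (AE x in lebesgue_on E.
           (LINT t:{0<..<T}|lebesgue. deriv \<eta> t * \<phi> x t) =
           - (LINT t:{0<..<T}|lebesgue. \<eta> t * \<psi> x t)))"


subsection \<open>Weak solutions\<close>

definition energy_form ::
  "real \<Rightarrow> ('a::euclidean_space \<Rightarrow> 'a \<Rightarrow> real) \<Rightarrow> ('a \<Rightarrow> real) \<Rightarrow> ('a \<Rightarrow> real) \<Rightarrow> real" where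
  "energy_form p k v w =
     (LINT x|lebesgue. LINT y|lebesgue. k x y * Phi p (v x - v y) * (w x - w y))"

text \<open>In the next two definitions \<open>\<psi>\<close> stands for the weak time derivative of \<open>\<phi>\<close>.\<close>

definition weak_form ::
  "real \<Rightarrow> ('a::euclidean_space \<Rightarrow> 'a \<Rightarrow> real \<Rightarrow> real) \<Rightarrow> 'a set \<Rightarrow> ('a \<Rightarrow> real \<Rightarrow> real) \<Rightarrow>
   ('a \<Rightarrow> real \<Rightarrow> real) \<Rightarrow> ('a \<Rightarrow> real \<Rightarrow> real) \<Rightarrow> real \<Rightarrow> real \<Rightarrow> real" where
  "weak_form p K E u \<phi> \<psi> t1 t2 =
     ((LINT x:E|lebesgue. \<phi> x t2 * u x t2) - (LINT x:E|lebesgue. \<phi> x t1 * u x t1))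
     - (LINT t:{t1..t2}|lebesgue. LINT x:E|lebesgue. \<psi> x t * u x t)
     + (LINT t:{t1..t2}|lebesgue. energy_form p (\<lambda>x y. K x y t) (\<lambda>x. u x t) (\<lambda>x. \<phi> x t))"

text \<open>
  Absolute convergence of the integrals in \<open>weak_form\<close>. It always holds for test functions
  supported in a compact subset of \<open>E\<close>, but may fail near the boundary of \<open>E\<close> or at infinity,
  because \<open>u\<close> has only local integrability in \<open>E\<close>. Without this side condition the weak inequality
  would have to hold for the value 0 that the Bochner integral assigns to divergent integrals.
\<close>

definition weak_form_converges ::
  "real \<Rightarrow> ('a::euclidean_space \<Rightarrow> 'a \<Rightarrow> real \<Rightarrow> real) \<Rightarrow> 'a set \<Rightarrow> ('a \<Rightarrow> real \<Rightarrow> real) \<Rightarrow>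
   ('a \<Rightarrow> real \<Rightarrow> real) \<Rightarrow> ('a \<Rightarrow> real \<Rightarrow> real) \<Rightarrow> real \<Rightarrow> real \<Rightarrow> bool" where
  "weak_form_converges p K E u \<phi> \<psi> t1 t2 \<longleftrightarrow>
     set_integrable lebesgue E (\<lambda>x. \<phi> x t1 * u x t1) \<and>
     set_integrable lebesgue E (\<lambda>x. \<phi> x t2 * u x t2) \<and>
     set_integrable lebesgue (E \<times> {t1..t2}) (\<lambda>(x, t). \<psi> x t * u x t) \<and>
     set_integrable lebesgue (UNIV \<times> UNIV \<times> {t1..t2})
       (\<lambda>(x, y, t). K x y t * Phi p (u x t - u y t) * (\<phi> x t - \<phi> y t))"

definition test_function ::
  "real \<Rightarrow> real \<Rightarrow> 'a::euclidean_space set \<Rightarrow> real \<Rightarrow>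
   ('a \<Rightarrow> real \<Rightarrow> real) \<Rightarrow> ('a \<Rightarrow> real \<Rightarrow> real) \<Rightarrow> bool" where
  "test_function s p E T \<phi> \<psi> \<longleftrightarrow>
     (\<lambda>(x, t). \<phi> x t) \<in> borel_measurable (lebesgue_on (UNIV \<times> {0<..T})) \<and>
     (\<forall>x. \<forall>t\<in>{0<..T}. 0 \<le> \<phi> x t) \<and>
     W12loc_L2 T E \<phi> \<psi> \<and>
     Lploc_Wsp s p T UNIV \<phi> \<and>
     (AE t in lebesgue_on {0<..T}. in_Wsp_o s p E (\<lambda>x. \<phi> x t))"

text \<open>The requirements common to sub- and super-solutions; the last conjunct is the tail condition.\<close>

definition solution_class ::
  "real \<Rightarrow> real \<Rightarrow> 'a::euclidean_space set \<Rightarrow> real \<Rightarrow> ('a \<Rightarrow> real \<Rightarrow> real) \<Rightarrow> bool" where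
  "solution_class s p E T u \<longleftrightarrow>
     (\<lambda>(x, t). u x t) \<in> borel_measurable (lebesgue_on (UNIV \<times> {0<..T})) \<and>
     (\<forall>C. compact C \<and> C \<subseteq> E \<longrightarrow> Cloc_L2 T C u \<and> Lploc_Wsp s p T C u) \<and>
     (\<forall>t1 t2. 0 < t1 \<and> t1 < t2 \<and> t2 \<le> T \<longrightarrow>
        (\<integral>\<^sup>+t\<in>{t1..t2}.
           (\<integral>\<^sup>+x. ennreal (\<bar>u x t\<bar> powr (p - 1) / (1 + norm x powr (real DIM('a) + s * p)))
             \<partial>lebesgue) \<partial>lebesgue) < \<infinity>)"

definition local_weak_subsolution ::
  "real \<Rightarrow> real \<Rightarrow> ('a::euclidean_space \<Rightarrow> 'a \<Rightarrow> real \<Rightarrow> real) \<Rightarrow> 'a set \<Rightarrow> real \<Rightarrow>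
   ('a \<Rightarrow> real \<Rightarrow> real) \<Rightarrow> bool" where
  "local_weak_subsolution s p K E T u \<longleftrightarrow>
     solution_class s p E T u \<and>
     (\<forall>t1 t2 \<phi> \<psi>. 0 < t1 \<and> t1 < t2 \<and> t2 \<le> T \<and> test_function s p E T \<phi> \<psi> \<and>
        weak_form_converges p K E u \<phi> \<psi> t1 t2 \<longrightarrow> weak_form p K E u \<phi> \<psi> t1 t2 \<le> 0)"

definition local_weak_supersolution ::
  "real \<Rightarrow> real \<Rightarrow> ('a::euclidean_space \<Rightarrow> 'a \<Rightarrow> real \<Rightarrow> real) \<Rightarrow> 'a set \<Rightarrow> real \<Rightarrow>
   ('a \<Rightarrow> real \<Rightarrow> real) \<Rightarrow> bool" where
  "local_weak_supersolution s p K E T u \<longleftrightarrow>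
     solution_class s p E T u \<and>
     (\<forall>t1 t2 \<phi> \<psi>. 0 < t1 \<and> t1 < t2 \<and> t2 \<le> T \<and> test_function s p E T \<phi> \<psi> \<and>
        weak_form_converges p K E u \<phi> \<psi> t1 t2 \<longrightarrow> weak_form p K E u \<phi> \<psi> t1 t2 \<ge> 0)"

definition local_weak_solution ::
  "real \<Rightarrow> real \<Rightarrow> ('a::euclidean_space \<Rightarrow> 'a \<Rightarrow> real \<Rightarrow> real) \<Rightarrow> 'a set \<Rightarrow> real \<Rightarrow>
   ('a \<Rightarrow> real \<Rightarrow> real) \<Rightarrow> bool" where
  "local_weak_solution s p K E T u \<longleftrightarrow>
     local_weak_subsolution s p K E T u \<and> local_weak_supersolution s p K E T u"

end

theory Submission
  imports Defs
begin

text \<open>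
  Everything follows from one assertion: if \<open>u\<close> vanishes at a point \<open>(x0, t0)\<close> of \<open>E \<times> (0, T)\<close>, then
  \<open>u = 0\<close> a.e. in \<open>\<real>\<^sup>N \<times> (0, t0]\<close>. This is the second alternative. It implies the first: a zero at a
  point \<open>(x, t)\<close> with \<open>t \<ge> to\<close> makes \<open>u\<close> vanish a.e. up to time \<open>t\<close>, hence, by continuity, at
  \<open>(xo, to)\<close>.

  The reason for the assertion is the nonlocality of the operator. Let \<open>S\<close> be a bounded set and \<open>l > 0\<close>,
  and suppose that \<open>u \<ge> l\<close> on a part of \<open>S \<times> (a, t0)\<close> that has positive measure. A point \<open>y \<in> S\<close> with
  \<open>u(y, t) \<ge> l\<close> pushes \<open>u\<close> upwards at every point near \<open>x0\<close> where \<open>u\<close> is small, at a rate that is bounded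
  from below, however far \<open>y\<close> is from \<open>x0\<close>. So \<open>u\<close> should stay above a fixed fraction of
  \<open>h(t) (1 - \<bar>x - x0\<bar> / r)\<close>, where \<open>h(a) = 0\<close> and \<open>h' = \<epsilon> \<bar>{y \<in> S. u(y, t) \<ge> l}\<bar>\<close> for a small
  \<open>\<epsilon>\<close>; in particular \<open>u(x0, t0) > 0\<close>. The function \<open>h\<close> never decreases, hence what is gained while
  \<open>u\<close> is large somewhere in \<open>S\<close> is kept afterwards.

  The kernel is only measurable, so that the operator cannot be evaluated on this barrier pointwise when
  \<open>s\<close> is close to 1. The comparison is therefore made by energies. For a level \<open>\<kappa> \<in> [0, 1/2]\<close> let
  \<open>w = (h (tent - \<kappa>) - u)\<^sub>+\<close> with the tent function \<open>tent = (1 - \<bar>x - x0\<bar> / r)\<^sub>+\<close>. Testing the equation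
  with \<open>w\<close> gives
  \<open>\<integral> w(b)\<^sup>2 / 2 + c \<integral>\<^sub>a\<^sup>b [w]\<^sup>p dt \<le> C \<integral>\<^sub>a\<^sup>b h\<^sup>p \<bar>{w > 0}\<bar> dt\<close> (lemma \<open>energy_inequality\<close>), where \<open>[w]\<close> is the
  Gagliardo seminorm; the growth of \<open>h\<close> is paid for by the interaction with \<open>S\<close>
  (lemma \<open>flux_gap_bound\<close>). The seminorm controls \<open>\<bar>{w > 0}\<bar>\<close> at the next level by an elementary
  isoperimetric argument (lemma \<open>superlevel_measure_le_gagliardo\<close>), and De Giorgi's iteration over
  \<open>\<kappa>\<^sub>j = (1 - 2\<^sup>-\<^sup>j) / 2\<close> yields \<open>u \<ge> h (tent - 1/2)\<close>, provided that the time interval is short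
  (lemma \<open>barrier_lower_bound\<close>). Since \<open>p > 2\<close> and \<open>h \<le> 1\<close>, the admissible length depends only on the
  ball and on the data \<open>N, s, p, Co, C1\<close>, not on \<open>S\<close> and \<open>l\<close>.

  Consequently a zero at \<open>(x0, t0)\<close> forces \<open>u = 0\<close> a.e. during a time span of fixed length before \<open>t0\<close>.
  By continuity \<open>u(x0, \<cdot>)\<close> vanishes during this span as well, and the argument is repeated from an
  earlier time until time 0 is reached (theorem \<open>vanishing_backwards\<close>).

  In time the solution is merely continuous. The equation is therefore tested with functions that do
  not depend on time: \<open>w(\<cdot>, t')\<close> is used on the whole interval \<open>[t, t']\<close>, and the convexity of the
  square gives an estimate for the increment of \<open>\<integral> w\<^sup>2 / 2\<close> in which \<open>u\<close> is taken at the running time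
  and \<open>w\<close> at the final time. Averaging over short intervals brings the two times together
  (lemma \<open>diagonal_limit\<close>).
\<close>

section \<open>The nonlinearity\<close>

lemma abs_Phi: "\<bar>Phi p d\<bar> = \<bar>d\<bar> powr (p - 1)"
proof (cases "d = 0")
  case False
  have "\<bar>Phi p d\<bar> = \<bar>d\<bar> powr (p - 2) * \<bar>d\<bar> powr 1"
    using False by (simp add: Phi_def abs_mult)
  also have "\<dots> = \<bar>d\<bar> powr (p - 1)" by (subst powr_add[symmetric]) simp
  finally show ?thesis .
qed (simp add: Phi_def)

lemma Phi_nonneg: "0 \<le> d \<Longrightarrow> Phi p d = d powr (p - 1)"
  using abs_Phi[of p d] by (simp add: Phi_def abs_mult)

lemma Phi_minus: "Phi p (- d) = - Phi p d"
  by (simp add: Phi_def)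

lemma Phi_mono:
  assumes "1 \<le> p" "a \<le> b" shows "Phi p a \<le> Phi p b"
proof -
  have n: "Phi p a = - ((- a) powr (p - 1))" if "a \<le> 0" for a
    using Phi_nonneg[of "- a" p] Phi_minus[of p a] that by simp
  consider "0 \<le> a" | "a \<le> 0" "0 \<le> b" | "b \<le> 0" using assms by linarith
  then show ?thesis
  proof cases
    case 1 then show ?thesis using assms by (simp add: Phi_nonneg powr_mono2)
  next
    case 2 then show ?thesis by (simp add: Phi_nonneg n) (smt (verit) powr_ge_zero)
  next
    case 3 then show ?thesis using assms by (simp add: n powr_mono2)
  qed
qed

lemma borel_measurable_Phi [measurable]: "Phi p \<in> borel_measurable borel"
  unfolding Phi_def by measurable

lemma abs_powr_times:
  fixes b :: real shows "\<bar>b\<bar> powr (p - 1) * \<bar>b\<bar> = \<bar>b\<bar> powr p"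
proof (cases "b = 0")
  case False
  have "\<bar>b\<bar> powr (p - 1) * \<bar>b\<bar> = \<bar>b\<bar> powr (p - 1) * \<bar>b\<bar> powr 1" by simp
  then show ?thesis by (subst (asm) powr_add[symmetric]) simp
qed simp

definition young_const :: "real \<Rightarrow> real" where "young_const p = 2 * 3 powr (p - 1) + 2"

lemma young_const_pos: "0 < young_const p"
  unfolding young_const_def by (smt (verit) powr_ge_zero)

text \<open>
  With \<open>d = u(x) - u(y)\<close>, \<open>a\<close> the increment of a barrier and \<open>b\<close> that of the gap between barrier and
  solution, this replaces all local energy estimates. If \<open>\<bar>a\<bar> \<le> \<bar>b\<bar> / 2\<close>, then \<open>a - b\<close> and \<open>b\<close> have
  opposite signs and \<open>\<bar>a - b\<bar> \<ge> \<bar>b\<bar> / 2\<close>, which produces the coercive term; otherwise \<open>b\<close> is dominated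
  by \<open>a\<close>.
\<close>
lemma Phi_difference_coercive:
  assumes p: "1 \<le> p" and db: "d * b \<le> (a - b) * b"
  shows "Phi p d * b \<le> young_const p * \<bar>a\<bar> powr p - 2 powr (1 - p) * \<bar>b\<bar> powr p"
proof -
  have 1: "Phi p d * b \<le> Phi p (a - b) * b"
  proof -
    consider "b = 0" | "b > 0" "d \<le> a - b" | "b < 0" "a - b \<le> d"
      using db by (smt (verit) mult_less_cancel_right)
    then show ?thesis
      by cases (use Phi_mono[OF p] in \<open>auto intro: mult_right_mono mult_right_mono_neg\<close>)
  qed
  show ?thesis
  proof (cases "\<bar>a\<bar> \<le> \<bar>b\<bar> / 2")
    case True
    have "\<bar>b\<bar> / 2 \<le> \<bar>a - b\<bar>" using True by linarith
    then have "(\<bar>b\<bar> / 2) powr (p - 1) \<le> \<bar>a - b\<bar> powr (p - 1)" using p by (intro powr_mono2) auto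
    then have "(\<bar>b\<bar> / 2) powr (p - 1) * \<bar>b\<bar> \<le> \<bar>Phi p (a - b)\<bar> * \<bar>b\<bar>"
      by (intro mult_right_mono) (auto simp: abs_Phi)
    also have "\<dots> = - (Phi p (a - b) * b)"
    proof -
      have "Phi p (a - b) * b \<le> 0"
      proof (cases "b \<ge> 0")
        case True2: True
        then have "Phi p (a - b) \<le> Phi p 0" using True p by (intro Phi_mono) linarith+
        then show ?thesis using True2 by (simp add: Phi_def[of p 0] mult_nonpos_nonneg)
      next
        case False
        then have "Phi p 0 \<le> Phi p (a - b)" using True p by (intro Phi_mono) linarith+
        then show ?thesis using False by (simp add: Phi_def[of p 0] mult_nonneg_nonpos)
      qed
      then show ?thesis by (simp add: abs_mult[symmetric])
    qed
    finally have "Phi p (a - b) * b \<le> - ((\<bar>b\<bar> / 2) powr (p - 1) * \<bar>b\<bar>)" by simp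
    also have "(\<bar>b\<bar> / 2) powr (p - 1) * \<bar>b\<bar> = 2 powr (1 - p) * (\<bar>b\<bar> powr (p - 1) * \<bar>b\<bar>)"
      by (simp add: powr_divide powr_diff)
    also have "\<dots> = 2 powr (1 - p) * \<bar>b\<bar> powr p" by (simp only: abs_powr_times)
    finally have "Phi p (a - b) * b \<le> - (2 powr (1 - p) * \<bar>b\<bar> powr p)" .
    moreover have "0 \<le> young_const p * \<bar>a\<bar> powr p" using young_const_pos[of p] by simp
    ultimately show ?thesis using 1 by linarith
  next
    case False
    have "Phi p (a - b) * b \<le> \<bar>a - b\<bar> powr (p - 1) * \<bar>b\<bar>"
      by (metis abs_Phi abs_ge_self abs_mult)
    also have "\<dots> \<le> (3 * \<bar>a\<bar>) powr (p - 1) * (2 * \<bar>a\<bar>)"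
      using False p by (intro mult_mono powr_mono2) auto
    also have "\<dots> = 2 * 3 powr (p - 1) * (\<bar>a\<bar> powr (p - 1) * \<bar>a\<bar>)" by (simp add: powr_mult)
    also have "\<dots> = 2 * 3 powr (p - 1) * \<bar>a\<bar> powr p" by (simp only: abs_powr_times)
    finally have A: "Phi p (a - b) * b \<le> 2 * 3 powr (p - 1) * \<bar>a\<bar> powr p" .
    have "2 powr (1 - p) * \<bar>b\<bar> powr p \<le> 2 powr (1 - p) * (2 * \<bar>a\<bar>) powr p"
      using False p by (intro mult_left_mono powr_mono2) auto
    also have "\<dots> = (2 powr (1 - p) * 2 powr p) * \<bar>a\<bar> powr p" by (simp add: powr_mult)
    also have "\<dots> = 2 * \<bar>a\<bar> powr p" by (subst powr_add[symmetric]) simp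
    finally show ?thesis using A 1 by (simp add: young_const_def algebra_simps)
  qed
qed

text \<open>
  Truncation is monotone and does not increase differences. This verifies the hypothesis of
  \<open>Phi_difference_coercive\<close> for truncated gaps, for all pairs of points at once.
\<close>
lemma positive_part_difference:
  fixes z z' :: real
  shows "(max 0 z - max 0 z') * (max 0 z - max 0 z') \<le> (z - z') * (max 0 z - max 0 z')"
  by (smt (verit) max_def mult_le_cancel_right mult_right_mono mult_eq_0_iff mult_le_cancel_left)

text \<open>
  A crude form of Young's inequality.
\<close>
lemma powr_product_le:
  fixes a b :: real assumes "1 \<le> p"
  shows "\<bar>a\<bar> powr (p - 1) * \<bar>b\<bar> \<le> \<bar>a\<bar> powr p + \<bar>b\<bar> powr p"
proof -
  let ?m = "max \<bar>a\<bar> \<bar>b\<bar>"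
  have "\<bar>a\<bar> powr (p - 1) * \<bar>b\<bar> \<le> \<bar>?m\<bar> powr (p - 1) * \<bar>?m\<bar>"
    using assms by (intro mult_mono powr_mono2) auto
  also have "\<dots> = ?m powr p" by (subst abs_powr_times) auto
  also have "\<dots> \<le> \<bar>a\<bar> powr p + \<bar>b\<bar> powr p" by (auto simp: max_def)
  finally show ?thesis .
qed

lemma powr_add_le:
  fixes a b :: real assumes "0 \<le> p" "0 \<le> a" "0 \<le> b"
  shows "(a + b) powr p \<le> 2 powr p * (a powr p + b powr p)"
proof -
  have "(a + b) powr p \<le> (2 * max a b) powr p" using assms by (intro powr_mono2) auto
  also have "\<dots> = 2 powr p * max a b powr p" using assms by (simp add: powr_mult)
  also have "\<dots> \<le> 2 powr p * (a powr p + b powr p)" by (intro mult_left_mono) (auto simp: max_def)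
  finally show ?thesis .
qed

section \<open>Singular kernels and an isoperimetric inequality\<close>

lemma dyadic_exponent:
  fixes x :: real assumes "1 \<le> x" shows "\<exists>k. 2 ^ k \<le> x \<and> x < 2 ^ (k + 1)"
proof -
  obtain k where k: "2 ^ k \<le> nat \<lfloor>x\<rfloor>" "nat \<lfloor>x\<rfloor> < 2 ^ (k + 1)"
    using ex_power_ivl1[of 2 "nat \<lfloor>x\<rfloor>"] assms by (auto simp: le_nat_iff)
  have "real (2 ^ k) \<le> real (nat \<lfloor>x\<rfloor>)" using k(1) by (rule of_nat_mono)
  also have "\<dots> \<le> x" using assms by simp
  finally have "real (2 ^ k) \<le> x" .
  moreover have "x < real (2 ^ (k + 1))"
  proof -
    have "nat \<lfloor>x\<rfloor> + 1 \<le> 2 ^ (k + 1)" using k(2) by linarith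
    then have "real (nat \<lfloor>x\<rfloor> + 1) \<le> real (2 ^ (k + 1))" by (rule of_nat_mono)
    then show ?thesis using assms by simp linarith
  qed
  ultimately show ?thesis by auto
qed

text \<open>
  Integrals of power weights are estimated by covering the domain with balls of geometrically
  growing or shrinking radii, on each of which the weight is bounded; this treats the singularity at
  the origin and the tail at infinity alike.
\<close>
lemma nn_integral_dyadic_finite:
  fixes f :: "'a::euclidean_space \<Rightarrow> real"
  assumes q: "0 \<le> q" "q < 1"
    and c: "\<And>k. 0 \<le> c k" and R: "\<And>k. 0 \<le> R k"
    and geo: "\<And>k. c k * R k ^ DIM('a) \<le> C * q ^ k"
    and cover: "\<And>z. z \<in> A \<Longrightarrow> \<exists>k. norm z < R k \<and> f z \<le> c k"
  shows "(\<integral>\<^sup>+z\<in>A. ennreal (f z) \<partial>lborel) < \<infinity>"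
proof -
  let ?\<omega> = "unit_ball_vol (real DIM('a))"
  have C: "0 \<le> C" using geo[of 0] c[of 0] R[of 0] by (auto intro: order_trans[rotated])
  have "(\<integral>\<^sup>+z\<in>A. ennreal (f z) \<partial>lborel) \<le>
      (\<integral>\<^sup>+z. (\<Sum>k. ennreal (c k) * indicator (ball 0 (R k)) z) \<partial>(lborel :: 'a measure))"
  proof (intro nn_integral_mono)
    fix z :: 'a
    show "ennreal (f z) * indicator A z \<le> (\<Sum>k. ennreal (c k) * indicator (ball 0 (R k)) z)"
    proof (cases "z \<in> A")
      case True
      then obtain k where k: "norm z < R k" "f z \<le> c k" using cover by blast
      have "ennreal (f z) \<le> ennreal (c k) * indicator (ball 0 (R k)) z"
        using k by (simp add: ennreal_leI)
      also have "\<dots> \<le> (\<Sum>k. ennreal (c k) * indicator (ball 0 (R k)) z)"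
      proof -
        define F where "F = (\<lambda>k. ennreal (c k) * indicator (ball 0 (R k)) z)"
        have "sum F {k} \<le> suminf F" by (rule sum_le_suminf) auto
        then show ?thesis by (simp add: F_def del: sum_mult_indicator)
      qed
      finally show ?thesis using True by simp
    qed simp
  qed
  also have "\<dots> = (\<Sum>k. ennreal (c k) * emeasure lborel (ball 0 (R k) :: 'a set))"
  proof -
    have [measurable]: "ball (0::'a) (R k) \<in> sets borel" for k by simp
    show ?thesis by (subst nn_integral_suminf) (measurable, simp add: nn_integral_cmult_indicator)
  qed
  also have "\<dots> = (\<Sum>k. ennreal (c k * (?\<omega> * R k ^ DIM('a))))"
    using R c by (simp add: emeasure_ball ennreal_mult)
  also have "\<dots> \<le> (\<Sum>k. ennreal (?\<omega> * C * q ^ k))"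
    by (intro suminf_le ennreal_leI) (use geo in \<open>auto simp: mult.assoc mult.left_commute intro: mult_left_mono\<close>)
  also have "\<dots> = ennreal (\<Sum>k. ?\<omega> * C * q ^ k)"
    using q C by (intro suminf_ennreal2) (auto intro!: summable_mult summable_geometric)
  also have "\<dots> < \<infinity>" by simp
  finally show ?thesis .
qed

lemma nn_integral_norm_powr_far_finite:
  assumes r: "0 < r" and \<alpha>: "real DIM('a::euclidean_space) < \<alpha>"
  shows "(\<integral>\<^sup>+z\<in>{z::'a. r \<le> norm z}. ennreal (norm z powr - \<alpha>) \<partial>lborel) < \<infinity>"
proof (rule nn_integral_dyadic_finite)
  let ?N = "DIM('a)"
  show "0 \<le> (2::real) powr (?N - \<alpha>)" by simp
  show "(2::real) powr (?N - \<alpha>) < 1" using \<alpha> by (simp add: powr_less_one)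
  show "0 \<le> (2 ^ k * r) powr - \<alpha>" "0 \<le> 2 ^ (k + 1) * r" for k using r by auto
  show "(2 ^ k * r) powr - \<alpha> * (2 ^ (k + 1) * r) ^ ?N
      \<le> (r powr - \<alpha> * (2 * r) ^ ?N) * (2 powr (?N - \<alpha>)) ^ k" for k
  proof -
    have "(2 powr (?N - \<alpha>)) ^ k = (2 ^ k) powr - \<alpha> * (2 ^ k :: real) ^ ?N"
      by (simp add: powr_realpow[symmetric] powr_powr powr_add[symmetric] algebra_simps)
    then show ?thesis using r by (simp add: powr_mult power_mult_distrib)
  qed
  fix z :: 'a assume "z \<in> {z. r \<le> norm z}"
  then have z: "1 \<le> norm z / r" using r by simp
  obtain k where k: "2 ^ k \<le> norm z / r" "norm z / r < 2 ^ (k + 1)" using dyadic_exponent[OF z] by blast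
  have "norm z powr - \<alpha> \<le> (2 ^ k * r) powr - \<alpha>"
    using k r \<alpha> by (intro powr_mono2') (auto simp: field_simps intro: order_trans[rotated])
  then show "\<exists>k. norm z < 2 ^ (k + 1) * r \<and> norm z powr - \<alpha> \<le> (2 ^ k * r) powr - \<alpha>"
    using k r by (intro exI[of _ k]) (auto simp: field_simps)
qed

lemma nn_integral_norm_powr_near_finite:
  assumes r: "0 < r" and \<beta>: "0 \<le> \<beta>" "\<beta> < real DIM('a::euclidean_space)"
  shows "(\<integral>\<^sup>+z\<in>{z::'a. norm z < r}. ennreal (norm z powr - \<beta>) \<partial>lborel) < \<infinity>"
proof -
  let ?N = "DIM('a)"
  show ?thesis
  proof (rule nn_integral_dyadic_finite)
    show "0 \<le> (2::real) powr (\<beta> - ?N)" by simp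
    show "(2::real) powr (\<beta> - ?N) < 1" using \<beta> by (simp add: powr_less_one)
    show "0 \<le> (r / 2 ^ (k + 1)) powr - \<beta>" "0 \<le> 2 * r / 2 ^ k" for k using r by auto
    show "(r / 2 ^ (k + 1)) powr - \<beta> * (2 * r / 2 ^ k) ^ ?N
        \<le> ((r / 2) powr - \<beta> * (2 * r) ^ ?N) * (2 powr (\<beta> - ?N)) ^ k" for k
    proof -
      have "(1 / 2 ^ k :: real) = 2 powr - real k" by (simp add: powr_minus powr_realpow inverse_eq_divide)
      then have "(2 powr (\<beta> - ?N)) ^ k = (1 / 2 ^ k) powr - \<beta> * (1 / 2 ^ k :: real) ^ ?N"
        by (simp add: powr_realpow[symmetric] powr_powr powr_add[symmetric] algebra_simps)
      moreover have "r / 2 ^ (k + 1) = (r / 2) * (1 / 2 ^ k)" "2 * r / 2 ^ k = (2 * r) * (1 / 2 ^ k)"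
        by simp_all
      ultimately show ?thesis using r by (simp only: powr_mult power_mult_distrib) (simp add: mult_ac)
    qed
    fix z :: 'a assume z: "z \<in> {z. norm z < r}"
    show "\<exists>k. norm z < 2 * r / 2 ^ k \<and> norm z powr - \<beta> \<le> (r / 2 ^ (k + 1)) powr - \<beta>"
    proof (cases "z = 0")
      case True then show ?thesis using r by (intro exI[of _ 0]) auto
    next
      case False
      then have "1 \<le> r / norm z" using z by simp
      then obtain k where k: "2 ^ k \<le> r / norm z" "r / norm z < 2 ^ (k + 1)" using dyadic_exponent by blast
      have "norm z \<le> r / 2 ^ k" using k(1) False by (simp add: field_simps)
      also have "\<dots> < 2 * r / 2 ^ k" using r by (simp add: field_simps)
      finally have 1: "norm z < 2 * r / 2 ^ k" .
      have "r / 2 ^ (k + 1) \<le> norm z" using k(2) False by (simp add: field_simps)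
      then have "norm z powr - \<beta> \<le> (r / 2 ^ (k + 1)) powr - \<beta>" using r \<beta> by (intro powr_mono2') auto
      with 1 show ?thesis by blast
    qed
  qed
qed

text \<open>
  The density \<open>min(1, \<bar>z\<bar> / r)\<^sup>p \<bar>z\<bar>\<^sup>-\<^sup>\<alpha>\<close> bounds the Gagliardo integrand of a function with
  oscillation and Lipschitz constant at most 1 and \<open>1 / r\<close>.
\<close>
definition truncated_kernel :: "real \<Rightarrow> real \<Rightarrow> real \<Rightarrow> 'a::euclidean_space \<Rightarrow> real" where
  "truncated_kernel p \<alpha> r z = min 1 (norm z / r) powr p / norm z powr \<alpha>"

lemma borel_measurable_truncated_kernel [measurable]:
  "truncated_kernel p \<alpha> r \<in> borel_measurable borel"
  unfolding truncated_kernel_def by measurable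

lemma truncated_kernel_nonneg: "0 \<le> truncated_kernel p \<alpha> r z"
  by (simp add: truncated_kernel_def)

lemma truncated_kernel_minus: "truncated_kernel p \<alpha> r (x - y) = truncated_kernel p \<alpha> r (y - x)"
  by (simp add: truncated_kernel_def norm_minus_commute)

text \<open>
  The exponent at the origin is \<open>p - \<alpha> > - N\<close>. It may be positive, in which case \<open>\<beta> = 0\<close> is used.
\<close>
lemma integrable_truncated_kernel:
  assumes r: "0 < r" and \<alpha>: "real DIM('a::euclidean_space) < \<alpha>" "\<alpha> < real DIM('a) + p" and p: "0 < p"
  shows "integrable lborel (truncated_kernel p \<alpha> r :: 'a \<Rightarrow> real)"
proof -
  define \<beta> where "\<beta> = max 0 (\<alpha> - p)"
  have \<beta>: "0 \<le> \<beta>" "\<beta> < real DIM('a)" using \<alpha> by (auto simp: \<beta>_def)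
  define D where "D = r powr (\<beta> - \<alpha>)"
  have near: "truncated_kernel p \<alpha> r z \<le> D * norm z powr - \<beta>" if "norm z < r" for z :: 'a
  proof (cases "z = 0")
    case False
    have "truncated_kernel p \<alpha> r z = (norm z / r) powr p / norm z powr \<alpha>"
      using that r by (simp add: truncated_kernel_def min_def)
    also have "\<dots> = (norm z / r) powr (p - \<alpha> + \<beta>) * ((norm z / r) powr (\<alpha> - \<beta>) / norm z powr \<alpha>)"
      by (simp add: powr_add[symmetric])
    also have "\<dots> \<le> 1 * ((norm z / r) powr (\<alpha> - \<beta>) / norm z powr \<alpha>)"
      using that r by (intro mult_right_mono powr_le1) (auto simp: \<beta>_def)
    also have "\<dots> = D * norm z powr - \<beta>"
      using False r by (simp add: D_def powr_divide powr_diff powr_minus field_simps)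
    finally show ?thesis .
  qed (simp add: truncated_kernel_def D_def)
  have far: "truncated_kernel p \<alpha> r z \<le> norm z powr - \<alpha>" if "r \<le> norm z" for z :: 'a
    using that r by (simp add: truncated_kernel_def powr_minus_divide)
  have "(\<integral>\<^sup>+z. ennreal (truncated_kernel p \<alpha> r z) \<partial>(lborel :: 'a measure)) \<le>
      (\<integral>\<^sup>+z. ennreal D * (ennreal (norm z powr - \<beta>) * indicator {z::'a. norm z < r} z)
        + ennreal (norm z powr - \<alpha>) * indicator {z::'a. r \<le> norm z} z \<partial>lborel)"
  proof (intro nn_integral_mono)
    fix z :: 'a
    show "ennreal (truncated_kernel p \<alpha> r z) \<le> ennreal D * (ennreal (norm z powr - \<beta>) * indicator {z::'a. norm z < r} z)
        + ennreal (norm z powr - \<alpha>) * indicator {z::'a. r \<le> norm z} z"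
      using near[of z] far[of z] by (cases "norm z < r") (auto simp: D_def ennreal_mult[symmetric] intro: ennreal_leI)
  qed
  also have "\<dots> < \<infinity>"
    using nn_integral_norm_powr_near_finite[OF r \<beta>] nn_integral_norm_powr_far_finite[OF r \<alpha>(1)]
    by (subst nn_integral_add) (auto simp: nn_integral_cmult ennreal_mult_less_top)
  finally show ?thesis
    by (intro integrableI_nonneg) (auto simp: truncated_kernel_nonneg)
qed

text \<open>
  The set \<open>{w > 0}\<close> of measure \<open>m\<close> cannot fill a ball of measure \<open>2 m\<close>. So around every point with
  \<open>w \<ge> l\<close> there is a set of measure \<open>m\<close>, at distance at most \<open>c m powr (1 / N)\<close>, on which \<open>w\<close> vanishes, and
  these pairs alone contribute the left-hand side. The small factor \<open>m powr (\<alpha> / N - 1)\<close> is the gain of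
  integrability that Sobolev's embedding would give.
\<close>
lemma superlevel_measure_le_gagliardo:
  fixes w :: "'a::euclidean_space \<Rightarrow> real"
  assumes [measurable]: "w \<in> borel_measurable borel" and w: "\<And>x. 0 \<le> w x"
    and A: "emeasure lborel {x. 0 < w x} = ennreal m" "0 \<le> m"
    and "0 < l" "0 \<le> \<alpha>" "0 \<le> p"
  shows "ennreal (l powr p) * emeasure lborel {x. l \<le> w x} \<le>
    ennreal ((2 / unit_ball_vol (real DIM('a))) powr (\<alpha> / DIM('a)) * m powr (\<alpha> / DIM('a) - 1)) *
    (\<integral>\<^sup>+x. (\<integral>\<^sup>+y. ennreal (\<bar>w x - w y\<bar> powr p / norm (x - y) powr \<alpha>) \<partial>lborel) \<partial>lborel)"
proof (cases "m = 0")
  case True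
  have "emeasure lborel {x. l \<le> w x} \<le> emeasure lborel {x. 0 < w x}"
    using \<open>0 < l\<close> by (intro emeasure_mono) auto
  then show ?thesis using A True by simp
next
  case False
  then have m: "0 < m" using A by simp
  let ?N = "DIM('a)" let ?\<omega> = "unit_ball_vol (real DIM('a))"
  let ?G = "(\<integral>\<^sup>+x. (\<integral>\<^sup>+y. ennreal (\<bar>w x - w y\<bar> powr p / norm (x - y) powr \<alpha>) \<partial>lborel) \<partial>lborel)"
  have \<omega>: "0 < ?\<omega>" by simp
  then have \<omega>': "?\<omega> \<noteq> 0" by linarith
  define R where "R = (2 * m / ?\<omega>) powr (1 / ?N)"
  have R: "0 < R" using m \<omega> \<omega>' by (simp add: R_def)
  have RN: "?\<omega> * R ^ ?N = 2 * m"
  proof -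
    have "R ^ ?N = R powr real ?N" using R by (simp add: powr_realpow)
    also have "\<dots> = 2 * m / ?\<omega>" using m \<omega> \<omega>' by (simp add: R_def powr_powr)
    finally show ?thesis using nonzero_mult_div_cancel_left[OF \<omega>', of "2 * m"]
      by (simp only: times_divide_eq_right)
  qed
  \<comment> \<open>A ball of measure \<open>2 m\<close> around any point meets the complement of \<open>{w > 0}\<close> in measure at least \<open>m\<close>.\<close>
  have hole: "ennreal m \<le> emeasure lborel (ball x R - {x. 0 < w x})" for x
  proof -
    have "ennreal (2 * m) = emeasure lborel (ball x R)" using R RN by (simp add: emeasure_ball)
    also have "\<dots> \<le> emeasure lborel ((ball x R - {x. 0 < w x}) \<union> {x. 0 < w x})"
      by (intro emeasure_mono) auto
    also have "\<dots> \<le> emeasure lborel (ball x R - {x. 0 < w x}) + emeasure lborel {x. 0 < w x}"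
      by (intro emeasure_subadditive) auto
    finally have "ennreal m + ennreal m \<le> ennreal m + emeasure lborel (ball x R - {x. 0 < w x})"
      using A m by (simp add: ennreal_plus[symmetric] add.commute del: ennreal_plus)
    then show ?thesis by (simp add: ennreal_add_left_cancel_le)
  qed
  have inner: "ennreal (l powr p / R powr \<alpha>) * ennreal m * indicator {x. l \<le> w x} x \<le>
      (\<integral>\<^sup>+y. ennreal (\<bar>w x - w y\<bar> powr p / norm (x - y) powr \<alpha>) \<partial>lborel)" for x
  proof (cases "l \<le> w x")
    case True
    have "ennreal (l powr p / R powr \<alpha>) * ennreal m \<le>
        ennreal (l powr p / R powr \<alpha>) * emeasure lborel (ball x R - {x. 0 < w x})"
      by (intro mult_left_mono hole) auto
    also have "\<dots> = (\<integral>\<^sup>+y. ennreal (l powr p / R powr \<alpha>) * indicator (ball x R - {x. 0 < w x}) y \<partial>lborel)"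
      by (subst nn_integral_cmult_indicator) auto
    also have "\<dots> \<le> (\<integral>\<^sup>+y. ennreal (\<bar>w x - w y\<bar> powr p / norm (x - y) powr \<alpha>) \<partial>lborel)"
    proof (intro nn_integral_mono)
      fix y
      show "ennreal (l powr p / R powr \<alpha>) * indicator (ball x R - {x. 0 < w x}) y \<le>
        ennreal (\<bar>w x - w y\<bar> powr p / norm (x - y) powr \<alpha>)"
      proof (cases "y \<in> ball x R - {x. 0 < w x}")
        case y: True
        then have wy: "w y = 0" using w[of y] by auto
        then have xy: "x \<noteq> y" using True \<open>0 < l\<close> by auto
        have "l powr p / R powr \<alpha> \<le> \<bar>w x - w y\<bar> powr p / norm (x - y) powr \<alpha>"
          using y wy xy True assms by (intro frac_le powr_mono2) (auto simp: dist_norm)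
        then show ?thesis using y by (simp add: ennreal_leI)
      qed simp
    qed
    finally show ?thesis using True by simp
  qed simp
  have "ennreal (l powr p / R powr \<alpha>) * ennreal m * emeasure lborel {x. l \<le> w x}
      = (\<integral>\<^sup>+x. ennreal (l powr p / R powr \<alpha>) * ennreal m * indicator {x. l \<le> w x} x \<partial>lborel)"
    by (subst nn_integral_cmult_indicator) auto
  also have "\<dots> \<le> ?G" by (intro nn_integral_mono inner)
  finally have G: "ennreal (l powr p / R powr \<alpha>) * ennreal m * emeasure lborel {x. l \<le> w x} \<le> ?G" .
  have "R powr \<alpha> = (2 / ?\<omega> * m) powr (\<alpha> / ?N)" by (simp only: R_def powr_powr) simp
  also have "\<dots> = (2 / ?\<omega>) powr (\<alpha> / ?N) * m powr (\<alpha> / ?N)" using m \<omega> by (intro powr_mult)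
  finally have Ra: "R powr \<alpha> / m = (2 / ?\<omega>) powr (\<alpha> / ?N) * m powr (\<alpha> / ?N - 1)"
    using m by (simp add: powr_diff)
  have "ennreal (l powr p) = ennreal (R powr \<alpha> / m) * (ennreal (l powr p / R powr \<alpha>) * ennreal m)"
    using R m by (simp add: ennreal_mult[symmetric])
  then have "ennreal (l powr p) * emeasure lborel {x. l \<le> w x} =
      ennreal (R powr \<alpha> / m) * (ennreal (l powr p / R powr \<alpha>) * ennreal m * emeasure lborel {x. l \<le> w x})"
    by (simp only: mult.assoc)
  also have "\<dots> \<le> ennreal (R powr \<alpha> / m) * ?G" by (intro mult_left_mono G) simp
  finally show ?thesis by (simp only: Ra)
qed

section \<open>Test functions that follow the solution in time\<close>

text \<open>
  Lets the measurability prover treat Borel functions on a product space as functions of their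
  components.
\<close>
lemma sets_borel_prod_cong [measurable_cong]:
  "sets (borel :: ('a::second_countable_topology \<times> 'b::second_countable_topology) measure) = sets (borel \<Otimes>\<^sub>M borel)"
  by (subst borel_prod) (rule refl)

text \<open>
  Dominated convergence with dominating functions that depend on \<open>n\<close> and whose integrals converge.
  The truncation of \<open>f n\<close> to \<open>[- H, H]\<close> converges by dominated convergence, and the truncated
  part is at most \<open>(G n - H)\<^sub>+\<close>, whose integral tends to 0.
\<close>
lemma integral_dominated_convergence_moving:
  fixes f :: "nat \<Rightarrow> 'a \<Rightarrow> real"
  assumes [measurable]: "\<And>n. f n \<in> borel_measurable M" "F \<in> borel_measurable M"
    and G: "\<And>n. integrable M (G n)" "integrable M H"
    and le: "\<And>n x. x \<in> space M \<Longrightarrow> \<bar>f n x\<bar> \<le> G n x"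
    and fF: "AE x in M. (\<lambda>n. f n x) \<longlonglongrightarrow> F x"
    and GH: "AE x in M. (\<lambda>n. G n x) \<longlonglongrightarrow> H x"
    and iGH: "(\<lambda>n. integral\<^sup>L M (G n)) \<longlonglongrightarrow> integral\<^sup>L M H"
  shows "integrable M F \<and> (\<lambda>n. integral\<^sup>L M (f n)) \<longlonglongrightarrow> integral\<^sup>L M F"
proof -
  note [measurable] = borel_measurable_integrable[OF G(1)] borel_measurable_integrable[OF G(2)]
  have fint: "integrable M (f n)" for n
    by (rule Bochner_Integration.integrable_bound[OF G(1)[of n]]) (use le[of _ n] in \<open>force intro!: AE_I2\<close>)+
  have FH: "AE x in M. \<bar>F x\<bar> \<le> H x"
    using fF GH AE_space
  proof eventually_elim
    case (elim x)
    then show ?case using le by (intro LIMSEQ_le[OF tendsto_rabs]) auto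
  qed
  then have F: "integrable M F"
    by (intro Bochner_Integration.integrable_bound[OF G(2)]) auto
  define h where "h n x = max (- H x) (min (f n x) (H x))" for n x
  have [measurable]: "h n \<in> borel_measurable M" for n unfolding h_def by measurable
  have hint: "integrable M (h n)" for n
    by (rule Bochner_Integration.integrable_bound[OF G(2)]) (use FH in \<open>auto simp: h_def\<close>)
  have h: "(\<lambda>n. integral\<^sup>L M (h n)) \<longlonglongrightarrow> integral\<^sup>L M F"
  proof (rule integral_dominated_convergence[where w = H])
    show "AE x in M. (\<lambda>n. h n x) \<longlonglongrightarrow> F x"
      using fF FH
    proof eventually_elim
      case (elim x)
      then have "(\<lambda>n. h n x) \<longlonglongrightarrow> max (- H x) (min (F x) (H x))"
        unfolding h_def by (intro tendsto_intros)
      then show ?case using elim by (simp add: max_def min_def split: if_splits)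
    qed
    show "AE x in M. norm (h n x) \<le> H x" for n
      using FH by (auto simp: h_def)
  qed (use G in auto)
  have lack: "(\<lambda>n. \<integral>x. max 0 (H x - G n x) \<partial>M) \<longlonglongrightarrow> (\<integral>x. 0 \<partial>M)"
  proof (rule integral_dominated_convergence[where w = H])
    show "AE x in M. (\<lambda>n. max 0 (H x - G n x)) \<longlonglongrightarrow> 0"
      using GH
    proof eventually_elim
      case (elim x)
      then have "(\<lambda>n. max 0 (H x - G n x)) \<longlonglongrightarrow> max 0 (H x - H x)" by (intro tendsto_intros)
      then show ?case by simp
    qed
    show "AE x in M. norm (max 0 (H x - G n x)) \<le> H x" for n
      using FH AE_space by eventually_elim (use le[of _ n] in force)
  qed (use G in auto)
  have excess: "(\<lambda>n. \<integral>x. max 0 (G n x - H x) \<partial>M) \<longlonglongrightarrow> 0"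
  proof -
    have "(\<integral>x. max 0 (G n x - H x) \<partial>M) = (\<integral>x. (G n x - H x) + max 0 (H x - G n x) \<partial>M)" for n
      by (intro Bochner_Integration.integral_cong) auto
    also have "\<dots> n = integral\<^sup>L M (G n) - integral\<^sup>L M H + (\<integral>x. max 0 (H x - G n x) \<partial>M)" for n
      using G by (subst Bochner_Integration.integral_add) (auto intro: integrable_max)
    finally show ?thesis
      using tendsto_add[OF tendsto_diff[OF iGH tendsto_const[of "integral\<^sup>L M H"]] lack] by simp
  qed
  have "(\<lambda>n. integral\<^sup>L M (f n) - integral\<^sup>L M (h n)) \<longlonglongrightarrow> 0"
  proof (rule Lim_null_comparison[OF _ excess], intro always_eventually allI)
    fix n
    have "norm (integral\<^sup>L M (f n) - integral\<^sup>L M (h n)) = \<bar>\<integral>x. f n x - h n x \<partial>M\<bar>"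
      using fint hint by simp
    also have "\<dots> \<le> (\<integral>x. \<bar>f n x - h n x\<bar> \<partial>M)" by (rule integral_abs_bound)
    also have "\<dots> \<le> (\<integral>x. max 0 (G n x - H x) \<partial>M)"
    proof (rule integral_mono_AE)
      show "AE x in M. \<bar>f n x - h n x\<bar> \<le> max 0 (G n x - H x)"
        using FH AE_space
      proof eventually_elim
        case (elim x)
        with le[of x n] show ?case by (auto simp: h_def max_def min_def abs_if split: if_splits)
      qed
    qed (use fint hint G in \<open>auto intro: integrable_max\<close>)
    finally show "norm (integral\<^sup>L M (f n) - integral\<^sup>L M (h n)) \<le> (\<integral>x. max 0 (G n x - H x) \<partial>M)" .
  qed
  from tendsto_add[OF this h] F show ?thesis by simp
qed

lemma nn_integral_lborel_triple:
  fixes f :: "('a::euclidean_space \<times> 'b::euclidean_space) \<times> real \<Rightarrow> ennreal"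
  assumes [measurable]: "f \<in> borel_measurable borel"
  shows "integral\<^sup>N lborel f = (\<integral>\<^sup>+t. \<integral>\<^sup>+x. \<integral>\<^sup>+y. f ((x, y), t) \<partial>lborel \<partial>lborel \<partial>lborel)"
    and "integral\<^sup>N lborel f = (\<integral>\<^sup>+t. \<integral>\<^sup>+y. \<integral>\<^sup>+x. f ((x, y), t) \<partial>lborel \<partial>lborel \<partial>lborel)"
proof -
  have "integral\<^sup>N lborel f = (\<integral>\<^sup>+t. \<integral>\<^sup>+z. f (z, t) \<partial>lborel \<partial>lborel)"
    by (subst lborel_prod[symmetric], subst lborel_pair.nn_integral_snd[symmetric]) simp_all
  moreover have "(\<integral>\<^sup>+z. f (z, t) \<partial>lborel) = (\<integral>\<^sup>+x. \<integral>\<^sup>+y. f ((x, y), t) \<partial>lborel \<partial>lborel)"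
    "(\<integral>\<^sup>+z. f (z, t) \<partial>lborel) = (\<integral>\<^sup>+y. \<integral>\<^sup>+x. f ((x, y), t) \<partial>lborel \<partial>lborel)" for t
    by (subst lborel_prod[symmetric], subst lborel.nn_integral_fst[symmetric] lborel_pair.nn_integral_snd[symmetric]; simp)+
  ultimately show "integral\<^sup>N lborel f = (\<integral>\<^sup>+t. \<integral>\<^sup>+x. \<integral>\<^sup>+y. f ((x, y), t) \<partial>lborel \<partial>lborel \<partial>lborel)"
    "integral\<^sup>N lborel f = (\<integral>\<^sup>+t. \<integral>\<^sup>+y. \<integral>\<^sup>+x. f ((x, y), t) \<partial>lborel \<partial>lborel \<partial>lborel)" by simp_all
qed

lemma AE_lborel_snd_neq: "AE x in (lborel :: ('z::euclidean_space \<times> real) measure). snd x \<noteq> a"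
proof (rule AE_I')
  have "emeasure lborel ((UNIV :: 'z set) \<times> {a}) = 0"
    unfolding lborel_prod[symmetric] by (subst lborel.emeasure_pair_measure_Times) auto
  then show "(UNIV :: 'z set) \<times> {a} \<in> null_sets lborel"
    by (auto simp: null_sets_def intro!: borel_closed closed_Times)
qed auto

lemma AE_lborel_shift:
  fixes c :: "'a::euclidean_space"
  assumes "AE x in lborel. P x" shows "AE x in lborel. P (x + c)"
proof -
  obtain N where N: "N \<in> null_sets lborel" "{x. \<not> P x} \<subseteq> N"
    using assms by (auto elim!: AE_E3 simp: eventually_ae_filter)
  have "AE x in distr lborel borel ((+) c). x \<notin> N"
    using N(1) by (simp add: lborel_distr_plus AE_not_in)
  then have "AE x in lborel. c + x \<notin> N"
    using N(1) by (subst (asm) AE_distr_iff) (auto simp: null_sets_def)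
  then show ?thesis by (rule AE_mp) (use N(2) in \<open>auto simp: add.commute\<close>)
qed

lemma integral_lborel_shift:
  fixes f :: "'a::euclidean_space \<Rightarrow> real"
  assumes [measurable]: "f \<in> borel_measurable borel"
  shows "(\<integral>x. f (x + c) \<partial>lborel) = (\<integral>x. f x \<partial>lborel)"
    and "integrable lborel (\<lambda>x. f (x + c)) \<longleftrightarrow> integrable lborel f"
proof -
  have "(\<integral>x. f x \<partial>lborel) = (\<integral>x. f x \<partial>distr lborel borel ((+) c))" by (simp add: lborel_distr_plus)
  also have "\<dots> = (\<integral>x. f (c + x) \<partial>lborel)" by (subst integral_distr) auto
  finally show "(\<integral>x. f (x + c) \<partial>lborel) = (\<integral>x. f x \<partial>lborel)" by (simp add: add.commute)
  have "integrable lborel f \<longleftrightarrow> integrable (distr lborel borel ((+) c)) f" by (simp add: lborel_distr_plus)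
  also have "\<dots> \<longleftrightarrow> integrable lborel (\<lambda>x. f (c + x))" by (subst integrable_distr_eq) auto
  finally show "integrable lborel (\<lambda>x. f (x + c)) \<longleftrightarrow> integrable lborel f" by (simp add: add.commute)
qed

text \<open>
  The two ends of the telescoping average of \<open>W (t + s) - W t\<close> are difference quotients of the
  primitive of \<open>W\<close>.
\<close>
lemma integral_window_average_tendsto:
  fixes W :: "real \<Rightarrow> real"
  assumes abc: "a < b" "b < c" and W: "continuous_on {a..c} W"
    and s: "\<And>n. 0 < s n" "\<And>n. s n \<le> c - b" "s \<longlonglongrightarrow> 0"
  shows "(\<lambda>n. (LINT t:{a..b}|lborel. W (t + s n) - W t) / s n) \<longlonglongrightarrow> W b - W a"
proof -
  define P where "P = (\<lambda>x. integral {a..x} W)"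
  have P: "(P has_real_derivative W x) (at x within {a..c})" if "x \<in> {a..c}" for x
    using integral_has_real_derivative[OF W that] by (simp add: P_def)
  have iW: "W integrable_on {x..y}" if "a \<le> x" "y \<le> c" for x y
    using W that by (intro integrable_continuous_interval continuous_on_subset[OF W]) auto
  have sub: "integral {x..y} W = P y - P x" if "a \<le> x" "x \<le> y" "y \<le> c" for x y
    using Henstock_Kurzweil_Integration.integral_combine[OF that(1,2) iW[of a y]] that by (simp add: P_def)
  have eq: "(LINT t:{a..b}|lborel. W (t + s n) - W t) = (P (b + s n) - P b) - (P (a + s n) - P a)" for n
  proof -
    have c1: "continuous_on {a..b} (\<lambda>t. W (t + s n) - W t)"
      using s(1)[of n] s(2)[of n] abc
      by (intro continuous_intros continuous_on_compose2[OF W] continuous_on_subset[OF W]) auto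
    have "(LINT t:{a..b}|lborel. W (t + s n) - W t) = integral {a..b} (\<lambda>t. W (t + s n) - W t)"
      using c1 by (intro set_borel_integral_eq_integral borel_integrable_atLeastAtMost') auto
    also have "\<dots> = integral {a..b} (\<lambda>t. W (t + s n)) - integral {a..b} W"
      using s(1)[of n] s(2)[of n] abc
      by (intro Henstock_Kurzweil_Integration.integral_diff integrable_continuous_interval
          continuous_on_compose2[OF W] continuous_on_subset[OF W] continuous_intros) auto
    also have "integral {a..b} (\<lambda>t. W (t + s n)) = integral {a + s n..b + s n} W"
      using integral_shift_Icc_real[of a b W "s n"] by (simp add: comp_def add.commute)
    finally show ?thesis
      using sub[of "a + s n" "b + s n"] sub[of a b] s(1)[of n] s(2)[of n] abc by simp
  qed
  have der: "(\<lambda>n. (P (x + s n) - P x) / s n) \<longlonglongrightarrow> W x" if "a \<le> x" "x \<le> b" for x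
  proof -
    have "((\<lambda>y. (P y - P x) / (y - x)) \<longlongrightarrow> W x) (at x within {a..c})"
      using P[of x] that abc by (simp add: has_field_derivative_iff)
    moreover have "filterlim (\<lambda>n. x + s n) (at x within {a..c}) sequentially"
    proof -
      have "(\<lambda>n. x + s n) \<longlonglongrightarrow> x" using tendsto_add[OF tendsto_const s(3), of x] by simp
      moreover have "x + s n \<in> {a..c} \<and> x + s n \<noteq> x" for n using s(1)[of n] s(2)[of n] that abc by auto
      ultimately show ?thesis unfolding filterlim_at by auto
    qed
    ultimately show ?thesis by (auto dest: filterlim_compose)
  qed
  have "(\<lambda>n. (P (b + s n) - P b) / s n - (P (a + s n) - P a) / s n) \<longlonglongrightarrow> W b - W a"
    using der[of b] der[of a] abc by (intro tendsto_diff) auto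
  then show ?thesis by (simp add: eq diff_divide_distrib)
qed


text \<open>
  Here \<open>W t = \<integral> w(\<cdot>, t)\<^sup>2 / 2\<close>, and \<open>q (z, \<tau>) t'\<close> is the integrand of the weak formulation with the
  solution at time \<open>\<tau>\<close> and the test function at time \<open>t'\<close>. The hypothesis \<open>step\<close> has the test function
  frozen at the end of the interval; the conclusion has \<open>t' = \<tau>\<close>. Nothing is assumed about the
  dependence of \<open>q\<close> on \<open>\<tau>\<close> beyond measurability, so only \<open>t'\<close> may be shifted.

  Integrate the hypothesis for the intervals \<open>[t, t + \<sigma>]\<close> over \<open>t \<in> [a, b]\<close> and write
  \<open>\<tau> = t + \<theta>\<close>. After an exchange of integrals the right-hand side is an integral over
  \<open>\<theta> \<in> [0, \<sigma>]\<close>, and some \<open>\<theta>\<close> is at least as good as the average, up to an error \<open>\<sigma>\<close>. For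
  \<open>\<sigma> \<rightarrow> 0\<close> the integrands at this \<open>\<theta>\<close> converge pointwise to the diagonal. Their majorants
  \<open>g1 + g2\<close>, the second one shifted in time, do not have a common bound, but their integrals
  converge because translations preserve Lebesgue measure.
\<close>
lemma diagonal_limit:
  fixes q :: "'z::euclidean_space \<times> real \<Rightarrow> real \<Rightarrow> real"
    and g1 g2 :: "'z \<times> real \<Rightarrow> real" and W :: "real \<Rightarrow> real"
  assumes abc: "a < b" "b < c"
    and q: "(\<lambda>(x, t). q x t) \<in> borel_measurable (borel \<Otimes>\<^sub>M borel)"
    and g: "set_integrable lborel (UNIV \<times> {a..c}) g1" "set_integrable lborel (UNIV \<times> {a..c}) g2"
    and gm: "g1 \<in> borel_measurable borel" "g2 \<in> borel_measurable borel"
    and W: "continuous_on {a..c} W"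
    and qc: "\<And>x. snd x \<in> {a..c} \<Longrightarrow> continuous_on {a..c} (q x)"
    and g2c: "\<And>z. continuous_on {a..c} (\<lambda>t. g2 (z, t))"
    and bound: "\<And>x t. snd x \<in> {a..c} \<Longrightarrow> t \<in> {a..c} \<Longrightarrow> \<bar>q x t\<bar> \<le> g1 x + g2 (fst x, t)"
    and step: "AE t' in lborel. \<forall>t. a \<le> t \<and> t < t' \<and> t' \<le> c \<longrightarrow>
      W t' - W t \<le> (LINT x:UNIV \<times> {t..t'}|lborel. q x t')"
  shows "set_integrable lborel (UNIV \<times> {a..b}) (\<lambda>x. q x (snd x))"
    and "W b - W a \<le> (LINT x:UNIV \<times> {a..b}|lborel. q x (snd x))"
proof -
  note gm[measurable]
  note qm[measurable (raw)] = measurable_Pair_compose_split[OF q]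
  define G1 where "G1 x = indicator {a..c} (snd x) * \<bar>g1 x\<bar>" for x :: "'z \<times> real"
  define G2 where "G2 x = indicator {a..c} (snd x) * \<bar>g2 x\<bar>" for x :: "'z \<times> real"
  have [measurable]: "G1 \<in> borel_measurable borel" "G2 \<in> borel_measurable borel"
    unfolding G1_def G2_def by measurable
  have iG: "integrable lborel G1" "integrable lborel G2"
    using g[THEN set_integrable_abs] unfolding set_integrable_def G1_def G2_def
    by (auto simp: indicator_times cong: Bochner_Integration.integrable_cong)
  have Gnn: "0 \<le> G1 x" "0 \<le> G2 x" for x by (auto simp: G1_def G2_def)
  have qG: "\<bar>q x t\<bar> \<le> G1 x + G2 (fst x, t)" if "snd x \<in> {a..c}" "t \<in> {a..c}" for x t
    using bound[OF that] that by (auto simp: G1_def G2_def)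
  define f where "f \<sigma> \<theta> x = indicator {a..b} (snd x - \<theta>) * q x (snd x - \<theta> + \<sigma>)"
    for \<sigma> \<theta> and x :: "'z \<times> real"
  have [measurable]: "f \<sigma> \<theta> \<in> borel_measurable borel" for \<sigma> \<theta> unfolding f_def by measurable
  have key: "\<exists>\<theta>\<in>{0..\<sigma>}. (LINT t:{a..b}|lborel. W (t + \<sigma>) - W t) / \<sigma> - \<sigma> \<le> integral\<^sup>L lborel (f \<sigma> \<theta>)"
    if \<sigma>: "0 < \<sigma>" "\<sigma> \<le> c - b" for \<sigma>
  proof -
    \<comment> \<open>\<open>H\<close> and \<open>H'\<close> are the same integrand, with \<open>t\<close> and with \<open>\<theta> = \<tau> - t\<close> as the free variable.\<close>
    define H where "H x t = indicator {a..b} t * indicator {0..\<sigma>} (snd x - t) * q x (t + \<sigma>)"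
      for x :: "'z \<times> real" and t
    define H' where "H' x \<theta> = indicator {0..\<sigma>} \<theta> * f \<sigma> \<theta> x" for x :: "'z \<times> real" and \<theta>
    have [measurable]: "(\<lambda>(x, t). H x t) \<in> borel_measurable (borel \<Otimes>\<^sub>M borel)"
      unfolding H_def by measurable
    have [measurable]: "(\<lambda>(x, t). H' x t) \<in> borel_measurable (borel \<Otimes>\<^sub>M borel)"
      unfolding H'_def f_def by measurable
    have HH': "H' x \<theta> = H x (snd x + (- 1) * \<theta>)" for x \<theta> by (simp add: H_def H'_def f_def)
    have swap: "(\<integral>\<^sup>+t. ennreal \<bar>H x t\<bar> \<partial>lborel) = (\<integral>\<^sup>+t. ennreal \<bar>H' x t\<bar> \<partial>lborel)" for x
      unfolding HH' by (subst nn_integral_real_affine[where c = "-1" and t = "snd x"]) (auto simp: mult.commute)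
    have "(\<integral>\<^sup>+\<tau>. ennreal \<bar>H (z, \<tau>) t\<bar> \<partial>lborel) \<le>
        indicator {a..b} t * (\<integral>\<^sup>+\<tau>. ennreal (G1 (z, \<tau>)) \<partial>lborel) + ennreal \<sigma> * ennreal (G2 (z, t + \<sigma>))" for z t
    proof -
      have "ennreal \<bar>H (z, \<tau>) t\<bar> \<le> indicator {a..b} t * ennreal (G1 (z, \<tau>)) + ennreal (G2 (z, t + \<sigma>)) * indicator {t..t + \<sigma>} \<tau>" for \<tau>
        using qG[of "(z, \<tau>)" "t + \<sigma>"] \<sigma> abc Gnn
        by (auto simp: H_def indicator_def ennreal_plus[symmetric] simp del: ennreal_plus intro!: ennreal_leI)
      then have "(\<integral>\<^sup>+\<tau>. ennreal \<bar>H (z, \<tau>) t\<bar> \<partial>lborel) \<le>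
          (\<integral>\<^sup>+\<tau>. indicator {a..b} t * ennreal (G1 (z, \<tau>)) + ennreal (G2 (z, t + \<sigma>)) * indicator {t..t + \<sigma>} \<tau> \<partial>lborel)"
        by (rule nn_integral_mono)
      also have "\<dots> = indicator {a..b} t * (\<integral>\<^sup>+\<tau>. ennreal (G1 (z, \<tau>)) \<partial>lborel) + ennreal \<sigma> * ennreal (G2 (z, t + \<sigma>))"
        using \<sigma> by (subst nn_integral_add) (simp_all add: nn_integral_cmult nn_integral_cmult_indicator mult.commute[of "ennreal \<sigma>"])
      finally show ?thesis .
    qed
    then have "(\<integral>\<^sup>+y. ennreal \<bar>case_prod H y\<bar> \<partial>lborel) \<le>
        (\<integral>\<^sup>+t. \<integral>\<^sup>+z. indicator {a..b} t * (\<integral>\<^sup>+\<tau>. ennreal (G1 (z, \<tau>)) \<partial>lborel) + ennreal \<sigma> * ennreal (G2 (z, t + \<sigma>)) \<partial>lborel \<partial>lborel)"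
      by (subst nn_integral_lborel_triple(1)) (simp_all add: split_beta' nn_integral_mono)
    also have "\<dots> = ennreal (b - a) * (\<integral>\<^sup>+z. \<integral>\<^sup>+\<tau>. ennreal (G1 (z, \<tau>)) \<partial>lborel \<partial>lborel) +
        ennreal \<sigma> * (\<integral>\<^sup>+t. \<integral>\<^sup>+z. ennreal (G2 (z, t + \<sigma>)) \<partial>lborel \<partial>lborel)"
      using abc by (simp add: nn_integral_add nn_integral_cmult nn_integral_multc)
    also have "(\<integral>\<^sup>+z. \<integral>\<^sup>+\<tau>. ennreal (G1 (z, \<tau>)) \<partial>lborel \<partial>lborel) = (\<integral>\<^sup>+x. ennreal (G1 x) \<partial>lborel)"
      by (subst lborel_prod[symmetric], subst lborel.nn_integral_fst[symmetric]) simp_all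
    also have "(\<integral>\<^sup>+t. \<integral>\<^sup>+z. ennreal (G2 (z, t + \<sigma>)) \<partial>lborel \<partial>lborel) = (\<integral>\<^sup>+t. \<integral>\<^sup>+z. ennreal (G2 (z, t)) \<partial>lborel \<partial>lborel)"
      by (subst nn_integral_real_affine[where c = 1 and t = \<sigma>, of "\<lambda>t. \<integral>\<^sup>+z. ennreal (G2 (z, t)) \<partial>(lborel :: 'z measure)"])
        (simp_all add: add.commute)
    also have "\<dots> = (\<integral>\<^sup>+x. ennreal (G2 x) \<partial>lborel)"
      by (subst lborel_prod[symmetric], subst lborel_pair.nn_integral_snd[symmetric]) simp_all
    also have "ennreal (b - a) * (\<integral>\<^sup>+x. ennreal (G1 x) \<partial>lborel) + ennreal \<sigma> * (\<integral>\<^sup>+x. ennreal (G2 x) \<partial>lborel) < \<infinity>"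
      using iG Gnn by (simp add: nn_integral_eq_integral ennreal_mult_less_top)
    finally have Hfin: "(\<integral>\<^sup>+y. ennreal \<bar>case_prod H y\<bar> \<partial>(lborel \<Otimes>\<^sub>M lborel)) < \<infinity>" by (simp only: lborel_prod)
    then have iH: "integrable (lborel \<Otimes>\<^sub>M lborel) (\<lambda>(x, t). H x t)"
      by (intro integrableI_bounded) auto
    have "(\<integral>\<^sup>+y. ennreal \<bar>case_prod H' y\<bar> \<partial>(lborel \<Otimes>\<^sub>M lborel)) = (\<integral>\<^sup>+y. ennreal \<bar>case_prod H y\<bar> \<partial>(lborel \<Otimes>\<^sub>M lborel))"
      using swap by (subst (1 2) lborel.nn_integral_fst[symmetric]) (auto simp: split_beta')
    then have iH': "integrable (lborel \<Otimes>\<^sub>M lborel) (\<lambda>(x, t). H' x t)"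
      using Hfin by (intro integrableI_bounded) auto
    have sH: "(\<integral>t. H x t \<partial>lborel) = (\<integral>t. H' x t \<partial>lborel)" for x
      unfolding HH' using lborel_integral_real_affine[of "-1" "H x" "snd x"] by simp
    have cW: "continuous_on {a..b} (\<lambda>t. W (t + \<sigma>) - W t)"
      using \<sigma> abc by (intro continuous_intros continuous_on_compose2[OF W] continuous_on_subset[OF W]) auto
    have "(LINT t:{a..b}|lborel. W (t + \<sigma>) - W t) \<le> (\<integral>t. (\<integral>x. H x t \<partial>lborel) \<partial>lborel)"
      unfolding set_lebesgue_integral_def
    proof (rule integral_mono_AE)
      show "integrable lborel (\<lambda>t. indicator {a..b} t *\<^sub>R (W (t + \<sigma>) - W t))"
        using borel_integrable_atLeastAtMost'[OF cW] by (simp add: set_integrable_def)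
      show "integrable lborel (\<lambda>t. \<integral>x. H x t \<partial>lborel)" by (rule lborel_pair.integrable_snd[OF iH])
      show "AE t in lborel. indicator {a..b} t *\<^sub>R (W (t + \<sigma>) - W t) \<le> (\<integral>x. H x t \<partial>lborel)"
        using AE_lborel_shift[OF step, of \<sigma>]
      proof eventually_elim
        case (elim t)
        show ?case
        proof (cases "t \<in> {a..b}")
          case True
          then have "W (t + \<sigma>) - W t \<le> (LINT x:UNIV \<times> {t..t + \<sigma>}|lborel. q x (t + \<sigma>))"
            using elim \<sigma> by auto
          also have "\<dots> = (\<integral>x. H x t \<partial>lborel)"
            using True unfolding set_lebesgue_integral_def H_def
            by (intro Bochner_Integration.integral_cong) (auto simp: indicator_def)
          finally show ?thesis using True by simp
        qed (simp add: H_def)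
      qed
    qed
    also have "\<dots> = (\<integral>x. (\<integral>t. H x t \<partial>lborel) \<partial>lborel)" by (rule lborel_pair.Fubini_integral[OF iH])
    also have "\<dots> = (\<integral>x. (\<integral>t. H' x t \<partial>lborel) \<partial>lborel)" by (simp only: sH)
    also have "\<dots> = (\<integral>t. (\<integral>x. H' x t \<partial>lborel) \<partial>lborel)" by (rule lborel_pair.Fubini_integral[OF iH', symmetric])
    finally have L: "(LINT t:{a..b}|lborel. W (t + \<sigma>) - W t) \<le> (\<integral>t. (\<integral>x. H' x t \<partial>lborel) \<partial>lborel)" .
    \<comment> \<open>The integral over \<open>[0, \<sigma>]\<close> is at least the left-hand side, so the integrand cannot be too small everywhere.\<close>
    show ?thesis
    proof (rule ccontr)
      let ?L = "(LINT t:{a..b}|lborel. W (t + \<sigma>) - W t)"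
      assume "\<not> ?thesis"
      then have lt: "integral\<^sup>L lborel (f \<sigma> \<theta>) \<le> ?L / \<sigma> - \<sigma>" if "\<theta> \<in> {0..\<sigma>}" for \<theta>
        using that by (auto simp: not_le intro: less_imp_le)
      have "(\<integral>t. (\<integral>x. H' x t \<partial>lborel) \<partial>lborel) \<le> (\<integral>t. indicator {0..\<sigma>} t * (?L / \<sigma> - \<sigma>) \<partial>lborel)"
      proof (rule integral_mono_AE)
        show "integrable lborel (\<lambda>t. \<integral>x. H' x t \<partial>lborel)" by (rule lborel_pair.integrable_snd[OF iH'])
        show "integrable lborel (\<lambda>t. indicator {0..\<sigma>} t * (?L / \<sigma> - \<sigma>))"
          using \<sigma> by (intro integrable_mult_left integrable_real_indicator) (simp_all add: less_top[symmetric])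
        show "AE t in lborel. (\<integral>x. H' x t \<partial>lborel) \<le> indicator {0..\<sigma>} t * (?L / \<sigma> - \<sigma>)"
          using lt by (intro AE_I2) (auto simp: H'_def indicator_def)
      qed
      also have "\<dots> = \<sigma> * (?L / \<sigma> - \<sigma>)" using \<sigma> by simp
      also have "\<dots> < ?L" using \<sigma> by (simp add: algebra_simps)
      finally show False using L by simp
    qed
  qed
  define s where "s n = (c - b) / Suc n" for n
  have s: "0 < s n" "s n \<le> c - b" for n
    using abc by (auto simp: s_def divide_simps mult_le_cancel_left1)
  have s0: "s \<longlonglongrightarrow> 0"
    unfolding s_def divide_inverse using tendsto_mult[OF tendsto_const LIMSEQ_inverse_real_of_nat, of "c - b"] by simp
  have "\<forall>n. \<exists>\<theta>. \<theta> \<in> {0..s n} \<and>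
      (LINT t:{a..b}|lborel. W (t + s n) - W t) / s n - s n \<le> integral\<^sup>L lborel (f (s n) \<theta>)"
    using key[OF s] unfolding Bex_def by blast
  then obtain \<theta> where \<theta>: "\<And>n. \<theta> n \<in> {0..s n}"
    "\<And>n. (LINT t:{a..b}|lborel. W (t + s n) - W t) / s n - s n \<le> integral\<^sup>L lborel (f (s n) (\<theta> n))"
    unfolding choice_iff by blast
  have \<theta>0: "\<theta> \<longlonglongrightarrow> 0"
    by (rule tendsto_sandwich[OF _ _ tendsto_const s0]) (use \<theta>(1) in auto)
  define G where "G n x = indicator {a..b} (snd x - \<theta> n) * G1 x
      + indicator {a..b} (snd x - \<theta> n) * G2 (fst x, snd x - \<theta> n + s n)" for n and x :: "'z \<times> real"
  define GL where "GL x = indicator {a..b} (snd x) * G1 x + indicator {a..b} (snd x) * G2 x" for x :: "'z \<times> real"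
  define fL where "fL x = indicator {a..b} (snd x) * q x (snd x)" for x :: "'z \<times> real"
  have [measurable]: "fL \<in> borel_measurable borel" unfolding fL_def by measurable
  have ind: "AE x in (lborel :: ('z \<times> real) measure).
      (snd x \<in> {a<..<b} \<longrightarrow> (\<forall>\<^sub>F n in sequentially. snd x - \<theta> n \<in> {a..b} \<and> snd x - s n \<in> {a..b}))
      \<and> (snd x \<notin> {a<..<b} \<longrightarrow> snd x \<notin> {a..b} \<and> (\<forall>\<^sub>F n in sequentially. snd x - \<theta> n \<notin> {a..b} \<and> snd x - s n \<notin> {a..b}))"
    using AE_lborel_snd_neq[of a] AE_lborel_snd_neq[of b]
  proof eventually_elim
    case (elim x)
    have l: "(\<lambda>n. snd x - \<theta> n) \<longlonglongrightarrow> snd x" "(\<lambda>n. snd x - s n) \<longlonglongrightarrow> snd x"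
      using tendsto_diff[OF tendsto_const \<theta>0, of "snd x"] tendsto_diff[OF tendsto_const s0, of "snd x"] by auto
    have ev: "\<forall>\<^sub>F n in sequentially. snd x - \<theta> n \<in> S \<and> snd x - s n \<in> S" if "open S" "snd x \<in> S" for S
      using topological_tendstoD[OF l(1) that] topological_tendstoD[OF l(2) that] by eventually_elim simp
    show ?case
    proof (cases "snd x \<in> {a<..<b}")
      case True
      then show ?thesis using ev[of "{a<..<b}"] by (auto elim: eventually_mono)
    next
      case False
      then have "snd x \<in> - {a..b}" using elim by auto
      then show ?thesis using ev[of "- {a..b}"] False by (auto simp: open_Compl elim: eventually_mono)
    qed
  qed
  have ind': "AE x in (lborel :: ('z \<times> real) measure). \<forall>\<^sub>F n in sequentially.
      indicator {a..b} (snd x - \<theta> n) = (indicator {a..b} (snd x) :: real) \<and>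
      indicator {a..b} (snd x - s n) = (indicator {a..b} (snd x) :: real)"
    using ind
  proof eventually_elim
    case (elim x)
    show ?case
    proof (cases "snd x \<in> {a<..<b}")
      case True
      with elim have "\<forall>\<^sub>F n in sequentially. snd x - \<theta> n \<in> {a..b} \<and> snd x - s n \<in> {a..b}" by blast
      then show ?thesis by eventually_elim (use True in simp)
    next
      case False
      with elim have n: "snd x \<notin> {a..b}"
        and "\<forall>\<^sub>F n in sequentially. snd x - \<theta> n \<notin> {a..b} \<and> snd x - s n \<notin> {a..b}" by blast+
      from this(2) show ?thesis by eventually_elim (metis n indicator_simps(2))
    qed
  qed
  have iG1: "integrable lborel (\<lambda>x. indicator {a..b} (snd x - \<theta> n) * G1 x)" for n
    by (rule Bochner_Integration.integrable_bound[OF iG(1)]) (auto simp: indicator_def)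
  have iG2': "integrable lborel (\<lambda>x. indicator {a..b} (snd x - s n) * G2 x)" for n
    by (rule Bochner_Integration.integrable_bound[OF iG(2)]) (auto simp: indicator_def)
  \<comment> \<open>The second majorant is a translate in time of a function whose window \<open>[a + s n, b + s n]\<close> converges.\<close>
  have sh: "indicator {a..b} (snd x - \<theta> n) * G2 (fst x, snd x - \<theta> n + s n)
      = (\<lambda>x. indicator {a..b} (snd x - s n) * G2 x) (x + (0, s n - \<theta> n))" for n x
    by (cases x) (simp add: algebra_simps)
  have iG2: "integrable lborel (\<lambda>x. indicator {a..b} (snd x - \<theta> n) * G2 (fst x, snd x - \<theta> n + s n))"
    and eG2: "(\<integral>x. indicator {a..b} (snd x - \<theta> n) * G2 (fst x, snd x - \<theta> n + s n) \<partial>lborel)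
      = (\<integral>x. indicator {a..b} (snd x - s n) * G2 x \<partial>lborel)" for n
    unfolding sh using iG2'[of n] by (subst integral_lborel_shift; measurable)+
  have iL: "integrable lborel (\<lambda>x. indicator {a..b} (snd x) * G1 x)" "integrable lborel (\<lambda>x. indicator {a..b} (snd x) * G2 x)"
    by (rule Bochner_Integration.integrable_bound[OF iG(1)] Bochner_Integration.integrable_bound[OF iG(2)]; auto simp: indicator_def)+
  have l1: "(\<lambda>n. \<integral>x. indicator {a..b} (snd x - \<theta> n) * G1 x \<partial>lborel) \<longlonglongrightarrow> (\<integral>x. indicator {a..b} (snd x) * G1 x \<partial>lborel)"
  proof (rule integral_dominated_convergence[OF _ _ iG(1)])
    show "AE x in lborel. (\<lambda>n. indicator {a..b} (snd x - \<theta> n) * G1 x) \<longlonglongrightarrow> indicator {a..b} (snd x) * G1 x"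
      using ind' by eventually_elim (intro tendsto_eventually, erule eventually_mono, simp)
  qed (auto simp: indicator_def Gnn)
  have l2: "(\<lambda>n. \<integral>x. indicator {a..b} (snd x - s n) * G2 x \<partial>lborel) \<longlonglongrightarrow> (\<integral>x. indicator {a..b} (snd x) * G2 x \<partial>lborel)"
  proof (rule integral_dominated_convergence[OF _ _ iG(2)])
    show "AE x in lborel. (\<lambda>n. indicator {a..b} (snd x - s n) * G2 x) \<longlonglongrightarrow> indicator {a..b} (snd x) * G2 x"
      using ind' by eventually_elim (intro tendsto_eventually, erule eventually_mono, simp)
  qed (auto simp: indicator_def Gnn)
  have inside: "(\<lambda>n. F (snd x - \<theta> n + s n)) \<longlonglongrightarrow> F (snd x)"
    if F: "continuous_on {a..c} F" and x: "snd x \<in> {a<..<b}" "\<forall>\<^sub>F n in sequentially. snd x - \<theta> n \<in> {a..b} \<and> snd x - s n \<in> {a..b}"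
    for F :: "real \<Rightarrow> real" and x :: "'z \<times> real"
  proof (rule continuous_on_tendsto_compose[OF F])
    show "(\<lambda>n. snd x - \<theta> n + s n) \<longlonglongrightarrow> snd x"
      using tendsto_add[OF tendsto_diff[OF tendsto_const \<theta>0] s0, of "snd x"] by simp
    show "snd x \<in> {a..c}" using x abc by auto
    show "\<forall>\<^sub>F n in sequentially. snd x - \<theta> n + s n \<in> {a..c}"
      using x(2)
    proof eventually_elim
      case (elim n)
      then show ?case using s[of n] by auto
    qed
  qed
  have lim: "integrable lborel fL \<and> (\<lambda>n. integral\<^sup>L lborel (f (s n) (\<theta> n))) \<longlonglongrightarrow> integral\<^sup>L lborel fL"
  proof (rule integral_dominated_convergence_moving[where G = G and H = GL])
    show "integrable lborel (G n)" for n unfolding G_def by (intro Bochner_Integration.integrable_add iG1 iG2)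
    show "integrable lborel GL" unfolding GL_def by (intro Bochner_Integration.integrable_add iL)
    show "\<bar>f (s n) (\<theta> n) x\<bar> \<le> G n x" for n x
    proof (cases "snd x - \<theta> n \<in> {a..b}")
      case True
      then show ?thesis using qG[of x "snd x - \<theta> n + s n"] \<theta>(1)[of n] s[of n] abc by (auto simp: f_def G_def)
    qed (simp add: f_def G_def)
    show "AE x in lborel. (\<lambda>n. f (s n) (\<theta> n) x) \<longlonglongrightarrow> fL x"
      using ind
    proof eventually_elim
      case (elim x)
      show ?case
      proof (cases "snd x \<in> {a<..<b}")
        case True
        then have ev: "\<forall>\<^sub>F n in sequentially. snd x - \<theta> n \<in> {a..b} \<and> snd x - s n \<in> {a..b}" using elim by blast
        have "(\<lambda>n. q x (snd x - \<theta> n + s n)) \<longlonglongrightarrow> q x (snd x)"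
          using True abc by (intro inside[OF qc _ ev]) auto
        moreover have "\<forall>\<^sub>F n in sequentially. q x (snd x - \<theta> n + s n) = f (s n) (\<theta> n) x"
          using ev by eventually_elim (simp add: f_def)
        ultimately have "(\<lambda>n. f (s n) (\<theta> n) x) \<longlonglongrightarrow> q x (snd x)" by (rule Lim_transform_eventually)
        then show ?thesis using True by (simp add: fL_def)
      next
        case False
        then show ?thesis using elim
          by (auto simp: f_def fL_def indicator_def intro!: tendsto_eventually elim!: eventually_mono)
      qed
    qed
    show "AE x in lborel. (\<lambda>n. G n x) \<longlonglongrightarrow> GL x"
      using ind
    proof eventually_elim
      case (elim x)
      show ?case
      proof (cases "snd x \<in> {a<..<b}")
        case True
        then have ev: "\<forall>\<^sub>F n in sequentially. snd x - \<theta> n \<in> {a..b} \<and> snd x - s n \<in> {a..b}" using elim by blast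
        have "(\<lambda>n. G1 x + \<bar>g2 (fst x, snd x - \<theta> n + s n)\<bar>) \<longlonglongrightarrow> G1 x + \<bar>g2 (fst x, snd x)\<bar>"
          using True abc by (intro tendsto_intros inside[OF g2c _ ev]) auto
        moreover have "\<forall>\<^sub>F n in sequentially. G1 x + \<bar>g2 (fst x, snd x - \<theta> n + s n)\<bar> = G n x"
          using ev by eventually_elim (use s \<theta>(1) abc in \<open>auto simp: G_def G2_def indicator_def, (smt (verit) s)+\<close>)
        ultimately have "(\<lambda>n. G n x) \<longlonglongrightarrow> G1 x + \<bar>g2 (fst x, snd x)\<bar>" by (rule Lim_transform_eventually)
        then show ?thesis using True abc by (simp add: GL_def G2_def)
      next
        case False
        then show ?thesis using elim
          by (auto simp: G_def GL_def indicator_def intro!: tendsto_eventually elim!: eventually_mono)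
      qed
    qed
    show "(\<lambda>n. integral\<^sup>L lborel (G n)) \<longlonglongrightarrow> integral\<^sup>L lborel GL"
      unfolding G_def GL_def using tendsto_add[OF l1 l2]
      by (simp add: Bochner_Integration.integral_add iG1 iG2 iL eG2)
  qed measurable
  show "set_integrable lborel (UNIV \<times> {a..b}) (\<lambda>x. q x (snd x))"
    using lim unfolding set_integrable_def fL_def by (auto simp: indicator_times cong: Bochner_Integration.integrable_cong)
  have "(\<lambda>n. (LINT t:{a..b}|lborel. W (t + s n) - W t) / s n - s n) \<longlonglongrightarrow> (W b - W a) - 0"
    by (intro tendsto_diff integral_window_average_tendsto[OF abc W] s s0)
  then have "W b - W a - 0 \<le> integral\<^sup>L lborel fL"
    using lim \<theta>(2) by (intro LIMSEQ_le[OF _ conjunct2[OF lim]]) auto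
  also have "\<dots> = (LINT x:UNIV \<times> {a..b}|lborel. q x (snd x))"
    unfolding set_lebesgue_integral_def fL_def by (intro Bochner_Integration.integral_cong) (auto simp: indicator_times)
  finally show "W b - W a \<le> (LINT x:UNIV \<times> {a..b}|lborel. q x (snd x))" by simp
qed

section \<open>Nonnegative solutions near a ball\<close>

lemma set_integrable_times_indicator:
  fixes f :: "'a::euclidean_space \<times> real \<Rightarrow> real" and B :: "'b::euclidean_space set"
  assumes f: "set_integrable lborel (UNIV \<times> {a..b}) f" and fm[measurable]: "f \<in> borel_measurable borel"
    and B[measurable]: "B \<in> sets borel" and Bfin: "emeasure lborel B < \<infinity>"
  shows "set_integrable lborel (UNIV \<times> {a..b}) (\<lambda>z. indicator B (fst (fst z)) * f (snd (fst z), snd z))"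
    and "set_integrable lborel (UNIV \<times> {a..b}) (\<lambda>z. indicator B (snd (fst z)) * f (fst (fst z), snd z))"
proof -
  have fin: "(\<integral>\<^sup>+t. \<integral>\<^sup>+y. ennreal (indicator {a..b} t * \<bar>f (y, t)\<bar>) \<partial>lborel \<partial>lborel) < \<infinity>"
  proof -
    have "(\<integral>\<^sup>+t. \<integral>\<^sup>+y. ennreal (indicator {a..b} t * \<bar>f (y, t)\<bar>) \<partial>(lborel::'a measure) \<partial>(lborel :: real measure))
        = (\<integral>\<^sup>+x. ennreal (indicator {a..b} (snd x) * \<bar>f x\<bar>) \<partial>lborel)"
      by (subst lborel_prod[symmetric], subst lborel_pair.nn_integral_snd[symmetric]) simp_all
    then show ?thesis using f unfolding set_integrable_def integrable_iff_bounded
      by (simp add: indicator_times abs_mult)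
  qed
  have 0: "(\<integral>\<^sup>+t. \<integral>\<^sup>+x. \<integral>\<^sup>+y. ennreal (indicator {a..b} t * (indicator B x * \<bar>f (y, t)\<bar>)) \<partial>lborel \<partial>lborel \<partial>(lborel :: real measure)) < \<infinity>"
  proof -
    have "(\<integral>\<^sup>+y. ennreal (indicator {a..b} t * (indicator B x * \<bar>f (y, t)\<bar>)) \<partial>lborel) =
        (\<integral>\<^sup>+y. ennreal (indicator {a..b} t * \<bar>f (y, t)\<bar>) \<partial>lborel) * indicator B x" for x t
      by (cases "x \<in> B") auto
    then have "(\<integral>\<^sup>+t. \<integral>\<^sup>+x. \<integral>\<^sup>+y. ennreal (indicator {a..b} t * (indicator B x * \<bar>f (y, t)\<bar>)) \<partial>lborel \<partial>lborel \<partial>(lborel :: real measure))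
        = (\<integral>\<^sup>+t. (\<integral>\<^sup>+y. ennreal (indicator {a..b} t * \<bar>f (y, t)\<bar>) \<partial>lborel) * emeasure lborel B \<partial>(lborel :: real measure))"
      by (simp add: nn_integral_cmult_indicator)
    also have "\<dots> = (\<integral>\<^sup>+t. \<integral>\<^sup>+y. ennreal (indicator {a..b} t * \<bar>f (y, t)\<bar>) \<partial>lborel \<partial>lborel) * emeasure lborel B"
      by (subst nn_integral_multc) auto
    also have "\<dots> < \<infinity>" using fin Bfin by (simp add: ennreal_mult_less_top)
    finally show ?thesis .
  qed
  have "(\<integral>\<^sup>+z. ennreal (indicator {a..b} (snd z) * (indicator B (fst (fst z)) * \<bar>f (snd (fst z), snd z)\<bar>)) \<partial>lborel) < \<infinity>"
    by (subst nn_integral_lborel_triple(1)) (use 0 in simp_all)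
  then show "set_integrable lborel (UNIV \<times> {a..b}) (\<lambda>z. indicator B (fst (fst z)) * f (snd (fst z), snd z))"
    unfolding set_integrable_def integrable_iff_bounded by (simp add: indicator_times abs_mult)
  have "(\<integral>\<^sup>+z. ennreal (indicator {a..b} (snd z) * (indicator B (snd (fst z)) * \<bar>f (fst (fst z), snd z)\<bar>)) \<partial>lborel) < \<infinity>"
    by (subst nn_integral_lborel_triple(2)) (use 0 in simp_all)
  then show "set_integrable lborel (UNIV \<times> {a..b}) (\<lambda>z. indicator B (snd (fst z)) * f (fst (fst z), snd z))"
    unfolding set_integrable_def integrable_iff_bounded by (simp add: indicator_times abs_mult)
qed

lemma nn_integral_translated_kernel:
  fixes k :: "'a::euclidean_space \<Rightarrow> real"
  assumes [measurable]: "k \<in> borel_measurable borel"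
  shows "(\<integral>\<^sup>+x. ennreal (k (x - y)) \<partial>lborel) = (\<integral>\<^sup>+z. ennreal (k z) \<partial>lborel)"
proof -
  have "(\<integral>\<^sup>+z. ennreal (k z) \<partial>lborel) = (\<integral>\<^sup>+z. ennreal (k z) \<partial>distr lborel borel ((+) (- y)))"
    by (simp add: lborel_distr_plus)
  also have "\<dots> = (\<integral>\<^sup>+x. ennreal (k (- y + x)) \<partial>lborel)" by (subst nn_integral_distr) auto
  finally show ?thesis by simp
qed

text \<open>
  The integral of \<open>m(x, t) k(x - y)\<close> over all \<open>(x, y, t)\<close> factorises, because \<open>k\<close> has the same integral
  around every point.
\<close>
lemma integrable_indicator_translated_kernel:
  fixes k :: "'a::euclidean_space \<Rightarrow> real" and m :: "'a \<times> real \<Rightarrow> real"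
  assumes k: "integrable lborel k" "k \<in> borel_measurable borel" "\<And>z. 0 \<le> k z" "\<And>z. k (- z) = k z"
    and m[measurable]: "m \<in> borel_measurable borel" "\<And>x. 0 \<le> m x"
    and fin: "integrable lborel m"
  shows "integrable lborel (\<lambda>z. m (fst (fst z), snd z) * k (fst (fst z) - snd (fst z)))"
    and "integrable lborel (\<lambda>z. m (snd (fst z), snd z) * k (fst (fst z) - snd (fst z)))"
    and "(\<integral>z. m (fst (fst z), snd z) * k (fst (fst z) - snd (fst z)) \<partial>lborel) = integral\<^sup>L lborel m * integral\<^sup>L lborel k"
    and "(\<integral>z. m (snd (fst z), snd z) * k (fst (fst z) - snd (fst z)) \<partial>lborel) = integral\<^sup>L lborel m * integral\<^sup>L lborel k"
proof -
  note k(2)[measurable]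
  have kk: "(\<integral>\<^sup>+z. ennreal (k z) \<partial>lborel) = ennreal (integral\<^sup>L lborel k)"
    using k by (intro nn_integral_eq_integral) auto
  have mm: "(\<integral>\<^sup>+t. \<integral>\<^sup>+x. ennreal (m (x, t)) \<partial>lborel \<partial>lborel) = ennreal (integral\<^sup>L lborel m)"
  proof -
    have "(\<integral>\<^sup>+t. \<integral>\<^sup>+x. ennreal (m (x, t)) \<partial>lborel \<partial>lborel) = (\<integral>\<^sup>+x. ennreal (m x) \<partial>lborel)"
      by (subst lborel_prod[symmetric], subst lborel_pair.nn_integral_snd[symmetric]) simp_all
    also have "\<dots> = ennreal (integral\<^sup>L lborel m)" using m fin by (intro nn_integral_eq_integral) auto
    finally show ?thesis .
  qed
  have sym: "k (x - y) = k (y - x)" for x y using k(4)[of "y - x"] by simp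
  have nn: "(\<integral>\<^sup>+z. ennreal (m (fst (fst z), snd z) * k (fst (fst z) - snd (fst z))) \<partial>lborel) = ennreal (integral\<^sup>L lborel m * integral\<^sup>L lborel k)"
    "(\<integral>\<^sup>+z. ennreal (m (snd (fst z), snd z) * k (fst (fst z) - snd (fst z))) \<partial>lborel) = ennreal (integral\<^sup>L lborel m * integral\<^sup>L lborel k)"
  proof -
    have 1: "(\<integral>\<^sup>+x. ennreal (m (y, t) * k (x - y)) \<partial>lborel) = ennreal (m (y, t)) * ennreal (integral\<^sup>L lborel k)" for y t
      using m k by (simp add: ennreal_mult nn_integral_cmult nn_integral_translated_kernel kk)
    have b1: "(\<integral>\<^sup>+y. ennreal (m (x, t) * k (x - y)) \<partial>lborel) = ennreal (m (x, t)) * ennreal (integral\<^sup>L lborel k)" for x t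
      unfolding sym[of x] by (rule 1)
    have 2: "(\<integral>\<^sup>+t. \<integral>\<^sup>+y. ennreal (m (y, t)) * ennreal (integral\<^sup>L lborel k) \<partial>lborel \<partial>lborel) = ennreal (integral\<^sup>L lborel m * integral\<^sup>L lborel k)"
      using m k by (simp add: nn_integral_multc mm ennreal_mult)
    show "(\<integral>\<^sup>+z. ennreal (m (snd (fst z), snd z) * k (fst (fst z) - snd (fst z))) \<partial>lborel) = ennreal (integral\<^sup>L lborel m * integral\<^sup>L lborel k)"
      by (subst nn_integral_lborel_triple(2)) (simp_all add: 1 2)
    show "(\<integral>\<^sup>+z. ennreal (m (fst (fst z), snd z) * k (fst (fst z) - snd (fst z))) \<partial>lborel) = ennreal (integral\<^sup>L lborel m * integral\<^sup>L lborel k)"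
      by (subst nn_integral_lborel_triple(1)) (simp_all add: b1 2)
  qed
  have mk: "0 \<le> integral\<^sup>L lborel m * integral\<^sup>L lborel k" using m k by (intro mult_nonneg_nonneg integral_nonneg) auto
  show i: "integrable lborel (\<lambda>z. m (fst (fst z), snd z) * k (fst (fst z) - snd (fst z)))"
    "integrable lborel (\<lambda>z. m (snd (fst z), snd z) * k (fst (fst z) - snd (fst z)))"
    using m k nn by (auto intro!: integrableI_nonneg)
  show "(\<integral>z. m (fst (fst z), snd z) * k (fst (fst z) - snd (fst z)) \<partial>lborel) = integral\<^sup>L lborel m * integral\<^sup>L lborel k"
    "(\<integral>z. m (snd (fst z), snd z) * k (fst (fst z) - snd (fst z)) \<partial>lborel) = integral\<^sup>L lborel m * integral\<^sup>L lborel k"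
    using m k nn mk by (auto simp: integral_eq_nn_integral)
qed

text \<open>
  A nonnegative solution near a ball \<open>cball x0 (2 * r)\<close>, in terms of Borel functions and with the
  kernel bounds holding at every point. The kernel is regarded as a function of the pair \<open>(x, y)\<close>, and
  triples of points and times are arranged as \<open>((x, y), t)\<close>.
\<close>
locale fractional_data =
  fixes s p \<alpha> Co C1 T r :: real and x0 :: "'a::euclidean_space"
    and K :: "'a \<times> 'a \<Rightarrow> real \<Rightarrow> real" and u :: "'a \<Rightarrow> real \<Rightarrow> real"
  assumes s: "0 < s" "s < 1" and p: "2 < p" and \<alpha>: "\<alpha> = real DIM('a) + s * p" and Co: "0 < Co" and r: "0 < r"
    and K_measurable: "(\<lambda>(z, t). K z t) \<in> borel_measurable (borel \<Otimes>\<^sub>M borel)"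
    and K_bounds: "\<And>x y t. Co / norm (x - y) powr \<alpha> \<le> K (x, y) t"
      "\<And>x y t. K (x, y) t \<le> C1 / norm (x - y) powr \<alpha>"
    and u_measurable: "(\<lambda>(x, t). u x t) \<in> borel_measurable (borel \<Otimes>\<^sub>M borel)"
    and u_nonneg: "\<And>x t. 0 \<le> u x t"
    and u_continuous: "continuous_on (cball x0 (2 * r) \<times> {0<..<T}) (\<lambda>(x, t). u x t)"
    and u_gagliardo: "\<And>a b. 0 < a \<Longrightarrow> a < b \<Longrightarrow> b < T \<Longrightarrow>
      set_integrable lborel ((cball x0 (2 * r) \<times> cball x0 (2 * r)) \<times> {a..b})
        (\<lambda>((x, y), t). \<bar>u x t - u y t\<bar> powr p / norm (x - y) powr \<alpha>)"
    and u_tail: "\<And>a b. 0 < a \<Longrightarrow> a < b \<Longrightarrow> b < T \<Longrightarrow>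
      set_integrable lborel (UNIV \<times> {a..b})
        (\<lambda>(y, t). u y t powr (p - 1) / (1 + norm y powr \<alpha>))"
begin

abbreviation B :: "'a set" where "B \<equiv> cball x0 r"
abbreviation B2 :: "'a set" where "B2 \<equiv> cball x0 (2 * r)"
abbreviation \<tau> :: "'a \<Rightarrow> real" where "\<tau> \<equiv> truncated_kernel p \<alpha> r"

lemma alpha: "0 < \<alpha>" "real DIM('a) < \<alpha>" "\<alpha> < real DIM('a) + p"
  using s p by (auto simp: \<alpha> add_pos_pos mult_less_cancel_right1)

lemma C1: "0 < C1"
proof -
  obtain b :: 'a where b: "b \<in> Basis" by (meson nonempty_Basis ex_in_conv)
  then have "Co \<le> C1" using K_bounds[of b 0 0] by simp
  then show ?thesis using Co by simp
qed

lemma K_nonneg: "0 \<le> K z t"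
  using K_bounds(1)[of "fst z" "snd z" t] Co by (metis divide_nonneg_nonneg less_imp_le order_trans powr_ge_zero prod.collapse)

lemma integrable_kernel: "integrable lborel \<tau>"
  using integrable_truncated_kernel[OF r alpha(2,3)] p by simp

lemmas [measurable (raw)] =
  measurable_Pair_compose_split[OF K_measurable] measurable_Pair_compose_split[OF u_measurable]

definition flux :: "('a \<Rightarrow> real) \<Rightarrow> ('a \<times> 'a) \<times> real \<Rightarrow> real" where
  "flux \<phi> = (\<lambda>((x, y), t). K (x, y) t * Phi p (u x t - u y t) * (\<phi> x - \<phi> y))"

definition gagliardo :: "('a \<Rightarrow> real) \<Rightarrow> 'a \<times> 'a \<Rightarrow> real" where
  "gagliardo \<phi> = (\<lambda>(x, y). \<bar>\<phi> x - \<phi> y\<bar> powr p / norm (x - y) powr \<alpha>)"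

lemma gagliardo_nonneg: "0 \<le> gagliardo \<phi> z"
  by (simp add: gagliardo_def split: prod.split)

lemma borel_measurable_gagliardo [measurable]:
  assumes [measurable]: "\<phi> \<in> borel_measurable borel" shows "gagliardo \<phi> \<in> borel_measurable borel"
  unfolding gagliardo_def split_beta' by measurable

lemma borel_measurable_flux [measurable]:
  assumes [measurable]: "\<phi> \<in> borel_measurable borel" shows "flux \<phi> \<in> borel_measurable borel"
  unfolding flux_def split_beta' by measurable

lemma u_cont_time:
  assumes "x \<in> B2" "0 < a" "b < T" shows "continuous_on {a..b} (u x)"
  using assms by (intro continuous_on_compose2[OF u_continuous, of "{a..b}" "\<lambda>t. (x, t)", simplified] continuous_intros) auto

lemma u_bounded:
  assumes "0 < a" "b < T" obtains M where "0 \<le> M" "\<And>x t. x \<in> B2 \<Longrightarrow> t \<in> {a..b} \<Longrightarrow> u x t \<le> M"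
proof -
  have "continuous_on (B2 \<times> {a..b}) (\<lambda>(x, t). u x t)"
    using assms by (intro continuous_on_subset[OF u_continuous]) auto
  then have "compact ((\<lambda>(x, t). u x t) ` (B2 \<times> {a..b}))"
    by (rule compact_continuous_image) (intro compact_Times compact_cball compact_Icc)
  then obtain M where "\<And>v. v \<in> (\<lambda>(x, t). u x t) ` (B2 \<times> {a..b}) \<Longrightarrow> norm v \<le> M"
    by (meson compact_imp_bounded bounded_iff)
  then show ?thesis by (intro that[of "max 0 M"]) force+
qed

text \<open>
  For \<open>x \<in> B\<close> and \<open>y \<notin> B2\<close> the distance is at least \<open>r\<close> and at least a fixed multiple of
  \<open>1 + \<bar>y\<bar>\<close>. The first bound is integrable in \<open>y\<close>, the second one is the weight of the tail condition.
\<close>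
lemma far_kernel_bounds:
  assumes "x \<in> B" "y \<notin> B2"
  shows "1 / norm (x - y) powr \<alpha> \<le> \<tau> (x - y)"
    and "1 / norm (x - y) powr \<alpha> \<le> (r powr - \<alpha> + (2 + norm x0 / r) powr \<alpha>) / (1 + norm y powr \<alpha>)"
proof -
  have n: "r \<le> norm (x - y)"
    using assms norm_triangle_ineq[of "x - x0" "y - x"]
    by (simp add: dist_norm norm_minus_commute not_le)
  then show "1 / norm (x - y) powr \<alpha> \<le> \<tau> (x - y)" using r by (simp add: truncated_kernel_def)
  have "norm y \<le> norm (x - y) + norm (x - x0) + norm x0"
    by (smt (verit) norm_minus_commute norm_triangle_sub)
  also have "\<dots> \<le> norm (x - y) + r + norm x0" using assms by (simp add: dist_norm norm_minus_commute)
  also have "\<dots> \<le> (2 + norm x0 / r) * norm (x - y)"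
  proof -
    have "norm x0 \<le> norm x0 / r * norm (x - y)"
      using n r mult_left_mono[of r "norm (x - y)" "norm x0 / r"] by simp
    then show ?thesis using n by (simp add: algebra_simps)
  qed
  finally have "norm y powr \<alpha> \<le> ((2 + norm x0 / r) * norm (x - y)) powr \<alpha>"
    using alpha by (intro powr_mono2) auto
  also have "\<dots> = (2 + norm x0 / r) powr \<alpha> * norm (x - y) powr \<alpha>" using r by (intro powr_mult)
  finally have 1: "norm y powr \<alpha> \<le> (2 + norm x0 / r) powr \<alpha> * norm (x - y) powr \<alpha>" .
  have "1 = r powr - \<alpha> * r powr \<alpha>" using r by (simp add: powr_minus)
  also have "\<dots> \<le> r powr - \<alpha> * norm (x - y) powr \<alpha>" using n r alpha by (intro mult_left_mono powr_mono2) auto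
  finally have "1 + norm y powr \<alpha> \<le> (r powr - \<alpha> + (2 + norm x0 / r) powr \<alpha>) * norm (x - y) powr \<alpha>"
    using 1 by (simp add: algebra_simps)
  moreover have "0 < norm (x - y) powr \<alpha>" "0 < 1 + norm y powr \<alpha>"
    using n r by (auto intro: add_pos_nonneg)
  ultimately show "1 / norm (x - y) powr \<alpha> \<le> (r powr - \<alpha> + (2 + norm x0 / r) powr \<alpha>) / (1 + norm y powr \<alpha>)"
    by (simp add: divide_simps mult.commute)
qed

end

lemma integrable_bounded_support:
  fixes f :: "'a::euclidean_space \<Rightarrow> real"
  assumes "f \<in> borel_measurable borel" "\<And>x. \<bar>f x\<bar> \<le> M" "\<And>x. x \<notin> cball y r \<Longrightarrow> f x = 0"
  shows "integrable lborel f"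
proof (rule Bochner_Integration.integrable_bound)
  show "integrable lborel (\<lambda>x. M * indicator (cball y r) x)"
    using emeasure_lborel_cball_finite[of y r] by (intro integrable_mult_right integrable_real_indicator) auto
  show "AE x in lborel. norm (f x) \<le> norm (M * indicator (cball y r) x)"
  proof (intro AE_I2)
    fix x
    show "norm (f x) \<le> norm (M * indicator (cball y r) x)"
      using assms(2)[of x] assms(3)[of x] by (cases "x \<in> cball y r") auto
  qed
qed (use assms(1) in simp)

lemma integrable_indicator_cylinder:
  fixes x0 :: "'a::euclidean_space" and a b :: real
  shows "integrable lborel (indicator (cball x0 R \<times> {a..b}) :: 'a \<times> real \<Rightarrow> real)"
proof (rule integrable_real_indicator)
  show "cball x0 R \<times> {a..b} \<in> sets lborel" by (auto intro!: borel_closed closed_Times)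
  show "emeasure lborel (cball x0 R \<times> {a..b}) < \<infinity>"
    using emeasure_lborel_cball_finite[of x0 R]
    by (cases "a \<le> b") (auto simp: lborel_prod[symmetric] lborel.emeasure_pair_measure_Times ennreal_mult_less_top)
qed

context fractional_data
begin

lemma truncated_kernel_uminus: "\<tau> (- z) = \<tau> z"
  by (simp add: truncated_kernel_def)

lemma sets_balls [measurable]: "B \<in> sets borel" "B2 \<in> sets borel" "B2 \<times> B2 \<in> sets borel"
  by (auto intro!: borel_closed closed_Times)

lemma integrable_indicator_ball_kernel:
  fixes a b R :: real
  shows "set_integrable lborel (UNIV \<times> {a..b}) (\<lambda>z. indicator (cball x0 R) (fst (fst z)) * \<tau> (fst (fst z) - snd (fst z)))"
    "set_integrable lborel (UNIV \<times> {a..b}) (\<lambda>z. indicator (cball x0 R) (snd (fst z)) * \<tau> (fst (fst z) - snd (fst z)))"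
proof -
  have [measurable]: "cball x0 R \<times> {a..b} \<in> sets borel" by (intro borel_closed closed_Times) auto
  have "integrable lborel (\<lambda>z. indicator (cball x0 R \<times> {a..b}) (fst (fst z), snd z) * \<tau> (fst (fst z) - snd (fst z)))"
    "integrable lborel (\<lambda>z. indicator (cball x0 R \<times> {a..b}) (snd (fst z), snd z) * \<tau> (fst (fst z) - snd (fst z)))"
    by (rule integrable_indicator_translated_kernel[OF integrable_kernel _ _ _ _ _ integrable_indicator_cylinder];
        simp add: truncated_kernel_nonneg truncated_kernel_uminus)+
  then show "set_integrable lborel (UNIV \<times> {a..b}) (\<lambda>z. indicator (cball x0 R) (fst (fst z)) * \<tau> (fst (fst z) - snd (fst z)))"
    "set_integrable lborel (UNIV \<times> {a..b}) (\<lambda>z. indicator (cball x0 R) (snd (fst z)) * \<tau> (fst (fst z) - snd (fst z)))"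
    unfolding set_integrable_def by (simp_all add: indicator_times mult_ac)
qed

text \<open>
  The majorant does not depend on \<open>\<phi>\<close> apart from the Gagliardo integrand of \<open>\<phi>\<close> on \<open>B2 \<times> B2\<close>. There,
  Young's inequality separates \<open>u\<close> from \<open>\<phi>\<close>. A pair with one point outside \<open>B2\<close> matters only if the other
  one belongs to \<open>B\<close>; then \<open>u\<close> is bounded at the point in \<open>B\<close>, and at the far point it is controlled by the
  tail.
\<close>
lemma flux_dominated:
  assumes ab: "0 < a" "a < b" "b < T"
  obtains g where "g \<in> borel_measurable borel" "set_integrable lborel (UNIV \<times> {a..b}) g"
    "\<And>\<phi> z t. (\<And>x. 0 \<le> \<phi> x \<and> \<phi> x \<le> 1) \<Longrightarrow> (\<And>x. x \<notin> B \<Longrightarrow> \<phi> x = 0) \<Longrightarrow> t \<in> {a..b} \<Longrightarrow>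
      \<bar>flux \<phi> (z, t)\<bar> \<le> g (z, t) + C1 * indicator (B2 \<times> B2) z * gagliardo \<phi> z"
proof -
  obtain M where M: "0 \<le> M" "\<And>x t. x \<in> B2 \<Longrightarrow> t \<in> {a..b} \<Longrightarrow> u x t \<le> M"
    using u_bounded[OF ab(1,3)] by blast
  define D where "D = r powr - \<alpha> + (2 + norm x0 / r) powr \<alpha>"
  have D: "0 \<le> D" by (simp add: D_def)
  define U where "U y t = u y t powr (p - 1) / (1 + norm y powr \<alpha>)" for y t
  have [measurable]: "(\<lambda>(y, t). U y t) \<in> borel_measurable (borel \<Otimes>\<^sub>M borel)" unfolding U_def by measurable
  note [measurable (raw)] = measurable_Pair_compose_split[OF this]
  have U0: "0 \<le> U y t" for y t by (auto simp: U_def intro!: divide_nonneg_nonneg add_nonneg_nonneg)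
  define near where "near z = C1 * (indicator B2 (fst (fst z)) * indicator B2 (snd (fst z)) *
    (\<bar>u (fst (fst z)) (snd z) - u (snd (fst z)) (snd z)\<bar> powr p / norm (fst (fst z) - snd (fst z)) powr \<alpha>))" for z
  define far where "far z = C1 * 2 powr (p - 1) *
    (M powr (p - 1) * (indicator B (fst (fst z)) * \<tau> (fst (fst z) - snd (fst z)) + indicator B (snd (fst z)) * \<tau> (fst (fst z) - snd (fst z))) +
     D * (indicator B (fst (fst z)) * U (snd (fst z)) (snd z) + indicator B (snd (fst z)) * U (fst (fst z)) (snd z)))" for z
  have [measurable]: "near \<in> borel_measurable borel"
    unfolding near_def by measurable
  have [measurable]: "far \<in> borel_measurable borel"
    unfolding far_def by measurable
  have near0: "0 \<le> near z" for z using C1 by (simp add: near_def)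
  have far0: "0 \<le> far z" for z
    using C1 D unfolding far_def by (intro mult_nonneg_nonneg add_nonneg_nonneg U0 truncated_kernel_nonneg) auto
  have "set_integrable lborel (UNIV \<times> {a..b}) near"
  proof -
    have "integrable lborel (\<lambda>z. C1 * (indicator ((B2 \<times> B2) \<times> {a..b}) z *\<^sub>R
        (\<bar>u (fst (fst z)) (snd z) - u (snd (fst z)) (snd z)\<bar> powr p / norm (fst (fst z) - snd (fst z)) powr \<alpha>)))"
      using u_gagliardo[OF ab] unfolding set_integrable_def split_beta' by (rule integrable_mult_right)
    then show ?thesis
      unfolding set_integrable_def near_def
      by (rule Bochner_Integration.integrable_cong[THEN iffD1, rotated -1]) (auto simp: indicator_def split: prod.splits)
  qed
  moreover have "set_integrable lborel (UNIV \<times> {a..b}) far"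
  proof -
    have "set_integrable lborel (UNIV \<times> {a..b}) (\<lambda>x. U (fst x) (snd x))"
      using u_tail[OF ab] by (simp add: U_def split_beta')
    then have ii: "set_integrable lborel (UNIV \<times> {a..b}) (\<lambda>z. indicator B (fst (fst z)) * U (snd (fst z)) (snd z))"
      "set_integrable lborel (UNIV \<times> {a..b}) (\<lambda>z. indicator B (snd (fst z)) * U (fst (fst z)) (snd z))"
      using set_integrable_times_indicator[of a b "\<lambda>x. U (fst x) (snd x)" B]
      by (auto simp: emeasure_lborel_cball_finite[unfolded infinity_ennreal_def])
    show ?thesis
      unfolding far_def by (intro set_integral_add set_integrable_mult_right integrable_indicator_ball_kernel ii)
  qed
  ultimately have int: "set_integrable lborel (UNIV \<times> {a..b}) (\<lambda>z. near z + far z)" by (rule set_integral_add)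
  have bound: "\<bar>flux \<phi> (z, t)\<bar> \<le> (near (z, t) + far (z, t)) + C1 * indicator (B2 \<times> B2) z * gagliardo \<phi> z"
    if \<phi>: "\<And>x. 0 \<le> \<phi> x \<and> \<phi> x \<le> 1" "\<And>x. x \<notin> B \<Longrightarrow> \<phi> x = 0" and t: "t \<in> {a..b}" for \<phi> z t
  proof -
    obtain x y where z: "z = (x, y)" by (cases z)
    have K: "\<bar>K (x, y) t\<bar> \<le> C1 / norm (x - y) powr \<alpha>" using K_bounds(2)[of x y t] K_nonneg[of "(x, y)" t] by simp
    have f: "\<bar>flux \<phi> (z, t)\<bar> \<le> C1 / norm (x - y) powr \<alpha> * (\<bar>u x t - u y t\<bar> powr (p - 1) * \<bar>\<phi> x - \<phi> y\<bar>)"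
      using mult_right_mono[OF K, of "\<bar>u x t - u y t\<bar> powr (p - 1) * \<bar>\<phi> x - \<phi> y\<bar>"]
      by (simp add: flux_def z abs_mult abs_Phi mult.assoc)
    have inside: "x \<in> B2" if "x \<in> B" for x using that r by auto
    have gen: "\<bar>u x t - u y t\<bar> powr (p - 1) \<le> 2 powr (p - 1) * (M powr (p - 1) + u y t powr (p - 1))"
      if "x \<in> B" for x y
    proof -
      have "\<bar>u x t - u y t\<bar> powr (p - 1) \<le> (M + u y t) powr (p - 1)"
        using u_nonneg[of x t] u_nonneg[of y t] M(2)[OF inside[OF that] t] p by (intro powr_mono2) auto
      also have "\<dots> \<le> 2 powr (p - 1) * (M powr (p - 1) + u y t powr (p - 1))"
        using M u_nonneg p by (intro powr_add_le) auto
      finally show ?thesis .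
    qed
    have farb: "1 / norm (x - y) powr \<alpha> * \<bar>u x t - u y t\<bar> powr (p - 1) \<le>
        2 powr (p - 1) * (M powr (p - 1) * \<tau> (x - y) + D * U y t)" if "x \<in> B" "y \<notin> B2" for x y
    proof -
      have "1 / norm (x - y) powr \<alpha> * \<bar>u x t - u y t\<bar> powr (p - 1) \<le>
        1 / norm (x - y) powr \<alpha> * (2 powr (p - 1) * (M powr (p - 1) + u y t powr (p - 1)))"
        using gen[OF that(1)] by (intro mult_left_mono) auto
      also have "\<dots> = 2 powr (p - 1) * (M powr (p - 1) * (1 / norm (x - y) powr \<alpha>) + u y t powr (p - 1) * (1 / norm (x - y) powr \<alpha>))"
        by (simp add: algebra_simps)
      also have "\<dots> \<le> 2 powr (p - 1) * (M powr (p - 1) * \<tau> (x - y) + u y t powr (p - 1) * (D / (1 + norm y powr \<alpha>)))"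
        unfolding D_def using far_kernel_bounds[OF that] by (intro mult_left_mono add_mono) auto
      also have "\<dots> = 2 powr (p - 1) * (M powr (p - 1) * \<tau> (x - y) + D * U y t)" by (simp add: U_def)
      finally show ?thesis .
    qed
    have farf: "C1 / norm (x - y) powr \<alpha> * (\<bar>u x t - u y t\<bar> powr (p - 1) * \<bar>\<phi> x - \<phi> y\<bar>) \<le>
        C1 * (2 powr (p - 1) * (M powr (p - 1) * \<tau> (x - y) + D * U y t))" if "x \<in> B" "y \<notin> B2" for x y
    proof -
      have "\<bar>\<phi> x - \<phi> y\<bar> \<le> 1" using \<phi>(1)[of x] \<phi>(1)[of y] by (simp add: abs_if)
      then have "C1 / norm (x - y) powr \<alpha> * (\<bar>u x t - u y t\<bar> powr (p - 1) * \<bar>\<phi> x - \<phi> y\<bar>) \<le>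
        C1 / norm (x - y) powr \<alpha> * (\<bar>u x t - u y t\<bar> powr (p - 1) * 1)"
        using C1 by (intro mult_left_mono) auto
      also have "\<dots> = C1 * (1 / norm (x - y) powr \<alpha> * \<bar>u x t - u y t\<bar> powr (p - 1))" by simp
      also have "\<dots> \<le> C1 * (2 powr (p - 1) * (M powr (p - 1) * \<tau> (x - y) + D * U y t))"
        using farb[OF that] C1 by (intro mult_left_mono) auto
      finally show ?thesis .
    qed
    consider "x \<notin> B \<and> y \<notin> B" | "x \<in> B2 \<and> y \<in> B2" | "x \<in> B \<and> y \<notin> B2" | "y \<in> B \<and> x \<notin> B2"
      using inside by blast
    then show ?thesis
    proof cases
      case 1
      then have "flux \<phi> (z, t) = 0" using \<phi>(2) by (simp add: flux_def z)
      then show ?thesis using near0[of "(z, t)"] far0[of "(z, t)"] C1 by (simp add: gagliardo_nonneg)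
    next
      case 2
      have "\<bar>u x t - u y t\<bar> powr (p - 1) * \<bar>\<phi> x - \<phi> y\<bar> \<le> \<bar>u x t - u y t\<bar> powr p + \<bar>\<phi> x - \<phi> y\<bar> powr p"
        using p by (intro powr_product_le) auto
      then have "C1 / norm (x - y) powr \<alpha> * (\<bar>u x t - u y t\<bar> powr (p - 1) * \<bar>\<phi> x - \<phi> y\<bar>) \<le>
        C1 / norm (x - y) powr \<alpha> * (\<bar>u x t - u y t\<bar> powr p + \<bar>\<phi> x - \<phi> y\<bar> powr p)"
        using C1 by (intro mult_left_mono) auto
      also have "\<dots> = near (z, t) + C1 * indicator (B2 \<times> B2) z * gagliardo \<phi> z"
        using 2 by (simp add: near_def gagliardo_def z algebra_simps add_divide_distrib)
      finally show ?thesis using f far0[of "(z, t)"] by linarith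
    next
      case 3
      have "C1 * (2 powr (p - 1) * (M powr (p - 1) * \<tau> (x - y) + D * U y t)) \<le> far (z, t)"
        using 3 C1 D U0 truncated_kernel_nonneg[of p \<alpha> r "x - y"] unfolding far_def mult.assoc
        by (intro mult_left_mono add_mono) (auto simp: z)
      then show ?thesis using f farf[of x y] 3 near0[of "(z, t)"] C1 gagliardo_nonneg[of \<phi> z]
        by (smt (verit) mult_nonneg_nonneg indicator_pos_le)
    next
      case 4
      have "C1 * (2 powr (p - 1) * (M powr (p - 1) * \<tau> (y - x) + D * U x t)) \<le> far (z, t)"
        using 4 C1 D U0 truncated_kernel_nonneg[of p \<alpha> r "x - y"] unfolding far_def mult.assoc truncated_kernel_minus[of p \<alpha> r y x]
        by (intro mult_left_mono add_mono) (auto simp: z)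
      then show ?thesis
        using f[unfolded norm_minus_commute[of x] abs_minus_commute[of "u x t"] abs_minus_commute[of "\<phi> x"]]
          farf[of y x] 4 near0[of "(z, t)"] C1 gagliardo_nonneg[of \<phi> z]
        by (smt (verit) mult_nonneg_nonneg indicator_pos_le)
    qed
  qed
  show ?thesis
    by (rule that[of "\<lambda>z. near z + far z"]) (use int bound in auto)
qed

lemma gagliardo_far:
  assumes \<phi>: "\<And>x. 0 \<le> \<phi> x \<and> \<phi> x \<le> 1" "\<And>x. x \<notin> B \<Longrightarrow> \<phi> x = 0" and xy: "\<not> (x \<in> B2 \<and> y \<in> B2)"
  shows "gagliardo \<phi> (x, y) \<le> indicator B x * \<tau> (x - y) + indicator B y * \<tau> (x - y)"
proof -
  have *: "gagliardo \<phi> (x, y) \<le> \<tau> (x - y)" if "x \<in> B" "y \<notin> B2" for x y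
  proof -
    have "\<bar>\<phi> x - \<phi> y\<bar> \<le> 1" using \<phi>(1)[of x] \<phi>(1)[of y] by (simp add: abs_if)
    then have "\<bar>\<phi> x - \<phi> y\<bar> powr p \<le> 1 powr p" using p by (intro powr_mono2) auto
    then have "gagliardo \<phi> (x, y) \<le> 1 / norm (x - y) powr \<alpha>"
      by (simp add: gagliardo_def divide_right_mono)
    then show ?thesis using far_kernel_bounds(1)[OF that] by linarith
  qed
  have BB: "B \<subseteq> B2" using r by auto
  consider "x \<notin> B" "y \<notin> B" | "x \<in> B" "y \<notin> B2" | "y \<in> B" "x \<notin> B2" using xy BB by blast
  then show ?thesis
  proof cases
    case 1
    then show ?thesis using p by (simp add: gagliardo_def \<phi>(2))
  next
    case 2
    then show ?thesis using *[OF 2] truncated_kernel_nonneg[of p \<alpha> r "x - y"] by (simp add: indicator_def)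
  next
    case 3
    have "gagliardo \<phi> (x, y) = gagliardo \<phi> (y, x)"
      by (simp add: gagliardo_def abs_minus_commute norm_minus_commute)
    then show ?thesis using *[OF 3] 3 truncated_kernel_nonneg[of p \<alpha> r "x - y"]
      by (simp add: indicator_def truncated_kernel_minus[of p \<alpha> r y x])
  qed
qed

lemma integrable_flux:
  assumes ab: "0 < a" "a < b" "b < T" and [measurable]: "\<phi> \<in> borel_measurable borel"
    and \<phi>: "\<And>x. 0 \<le> \<phi> x \<and> \<phi> x \<le> 1" "\<And>x. x \<notin> B \<Longrightarrow> \<phi> x = 0"
    and g: "set_integrable lborel (B2 \<times> B2) (gagliardo \<phi>)"
  shows "set_integrable lborel (UNIV \<times> {a..b}) (flux \<phi>)"
proof -
  obtain G where [measurable]: "G \<in> borel_measurable borel" and G: "set_integrable lborel (UNIV \<times> {a..b}) G"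
    "\<And>\<phi> z t. (\<And>x. 0 \<le> \<phi> x \<and> \<phi> x \<le> 1) \<Longrightarrow> (\<And>x. x \<notin> B \<Longrightarrow> \<phi> x = 0) \<Longrightarrow> t \<in> {a..b} \<Longrightarrow>
      \<bar>flux \<phi> (z, t)\<bar> \<le> G (z, t) + C1 * indicator (B2 \<times> B2) z * gagliardo \<phi> z"
    using flux_dominated[OF ab] by metis
  have "integrable lborel (\<lambda>z :: ('a \<times> 'a) \<times> real. (C1 * indicator (B2 \<times> B2) (fst z) * gagliardo \<phi> (fst z)) * indicator {a..b} (snd z))"
  proof -
    have g': "(\<integral>\<^sup>+z. ennreal (C1 * indicator (B2 \<times> B2) z * gagliardo \<phi> z) \<partial>lborel) < \<infinity>"
    proof -
      have "integrable lborel (\<lambda>z. C1 * (indicator (B2 \<times> B2) z *\<^sub>R gagliardo \<phi> z))"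
        using g unfolding set_integrable_def by (rule integrable_mult_right)
      then show ?thesis using C1 unfolding integrable_iff_bounded by (simp add: gagliardo_nonneg mult.assoc abs_mult)
    qed
    have "(\<integral>\<^sup>+z. ennreal (C1 * indicator (B2 \<times> B2) (fst z) * gagliardo \<phi> (fst z) * indicator {a..b} (snd z)) \<partial>lborel)
        = (\<integral>\<^sup>+z. \<integral>\<^sup>+t. ennreal (C1 * indicator (B2 \<times> B2) z * gagliardo \<phi> z) * indicator {a..b} t \<partial>(lborel :: real measure) \<partial>lborel)"
      by (subst lborel_prod[symmetric], subst lborel.nn_integral_fst[symmetric])
        (auto intro!: nn_integral_cong simp: indicator_def)
    also have "\<dots> = (\<integral>\<^sup>+z. ennreal (C1 * indicator (B2 \<times> B2) z * gagliardo \<phi> z) \<partial>lborel) * ennreal (b - a)"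
      using ab by (simp add: nn_integral_cmult_indicator nn_integral_multc)
    also have "\<dots> < \<infinity>" using g' by (simp add: ennreal_mult_less_top)
    finally show ?thesis using C1 by (intro integrableI_nonneg) (auto simp: gagliardo_nonneg)
  qed
  then have "integrable lborel (\<lambda>z. indicator (UNIV \<times> {a..b}) z *\<^sub>R G z
      + (C1 * indicator (B2 \<times> B2) (fst z) * gagliardo \<phi> (fst z)) * indicator {a..b} (snd z))"
    using G(1) unfolding set_integrable_def by (rule Bochner_Integration.integrable_add[rotated])
  then show ?thesis
    unfolding set_integrable_def
  proof (rule Bochner_Integration.integrable_bound)
    show "AE z in lborel. norm (indicator (UNIV \<times> {a..b}) z *\<^sub>R flux \<phi> z) \<le> norm (indicator (UNIV \<times> {a..b}) z *\<^sub>R G z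
      + (C1 * indicator (B2 \<times> B2) (fst z) * gagliardo \<phi> (fst z)) * indicator {a..b} (snd z))"
    proof (intro AE_I2)
      fix z :: "('a \<times> 'a) \<times> real"
      show "norm (indicator (UNIV \<times> {a..b}) z *\<^sub>R flux \<phi> z) \<le> norm (indicator (UNIV \<times> {a..b}) z *\<^sub>R G z
        + (C1 * indicator (B2 \<times> B2) (fst z) * gagliardo \<phi> (fst z)) * indicator {a..b} (snd z))"
      proof (cases "snd z \<in> {a..b}")
        case True
        have "\<bar>flux \<phi> (fst z, snd z)\<bar> \<le> G (fst z, snd z) + C1 * indicator (B2 \<times> B2) (fst z) * gagliardo \<phi> (fst z)"
          by (rule G(2)) (use \<phi> True in auto)
        with True show ?thesis by (simp add: indicator_times)
      qed (simp add: indicator_times)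
    qed
  qed measurable
qed

end

section \<open>The rising barrier\<close>

text \<open>
  Test functions that are constant in time suffice, because \<open>diagonal_limit\<close> makes the passage to moving ones.
\<close>
locale fractional_supersolution = fractional_data +
  assumes weak: "\<And>a b \<phi>. 0 < a \<Longrightarrow> a < b \<Longrightarrow> b < T \<Longrightarrow> \<phi> \<in> borel_measurable borel \<Longrightarrow>
      (\<And>x. 0 \<le> \<phi> x \<and> \<phi> x \<le> 1) \<Longrightarrow> (\<And>x. x \<notin> B \<Longrightarrow> \<phi> x = 0) \<Longrightarrow>
      set_integrable lborel (B2 \<times> B2) (gagliardo \<phi>) \<Longrightarrow>
      0 \<le> (LINT x|lborel. \<phi> x * (u x b - u x a)) + (LINT z:UNIV \<times> {a..b}|lborel. flux \<phi> z)"

text \<open>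
  The height \<open>h\<close> of the barrier increases at the rate \<open>\<epsilon> \<bar>{y \<in> S. l \<le> u y t}\<bar>\<close>. The bound on \<open>\<epsilon>\<close> makes
  this rate at most half of what the interaction with \<open>S\<close> contributes to the equation; \<open>h \<le> l / 4\<close> keeps
  the barrier well below the values of \<open>u\<close> on the part of \<open>S\<close> that is used.
\<close>
locale barrier = fractional_supersolution +
  fixes S :: "'a set" and l \<epsilon> \<rho> a c :: real and h :: "real \<Rightarrow> real"
  assumes times: "0 < a" "a < c" "c < T"
    and S: "S \<in> sets borel" "S \<subseteq> cball x0 \<rho>" and l: "0 < l" and \<rho>: "0 < \<rho>"
    and \<epsilon>: "0 < \<epsilon>" "\<epsilon> \<le> (3 * l / 4) powr (p - 1) / 2 * (Co / (\<rho> + r) powr \<alpha>)"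
    and h_cont: "continuous_on UNIV h" and h: "\<And>t. 0 \<le> h t" "\<And>t. h t \<le> l / 4" "\<And>t. h t \<le> 1"
    and h_increment: "\<And>t t'. a \<le> t \<Longrightarrow> t \<le> t' \<Longrightarrow> t' \<le> c \<Longrightarrow>
      h t' - h t = \<epsilon> * (LINT \<tau>:{t..t'}|lborel. measure lborel {y \<in> S. l \<le> u y \<tau>})"
    and h_start: "h a = 0"
begin

definition tent :: "'a \<Rightarrow> real" where "tent x = max 0 (1 - norm (x - x0) / r)"

definition gap :: "real \<Rightarrow> 'a \<Rightarrow> real \<Rightarrow> real" where
  "gap \<kappa> x t = max 0 (h t * (tent x - \<kappa>) - u x t)"

lemma tent_bounds: "0 \<le> tent x" "tent x \<le> 1"
  using r by (auto simp: tent_def)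

lemma tent_outside: "x \<notin> B \<Longrightarrow> tent x = 0"
  using r by (simp add: tent_def dist_norm norm_minus_commute not_le)

lemma tent_lipschitz: "\<bar>tent x - tent y\<bar> \<le> min 1 (norm (x - y) / r)"
proof -
  have "\<bar>tent x - tent y\<bar> \<le> \<bar>norm (y - x0) / r - norm (x - x0) / r\<bar>"
    unfolding tent_def by linarith
  also have "\<dots> = \<bar>norm (y - x0) - norm (x - x0)\<bar> / r"
    using r by (simp add: diff_divide_distrib[symmetric])
  also have "\<dots> \<le> norm (x - y) / r"
    using r norm_triangle_ineq3[of "y - x0" "x - x0"]
    by (intro divide_right_mono) (simp_all add: norm_minus_commute)
  finally show ?thesis using tent_bounds[of x] tent_bounds[of y] by simp
qed

lemma measurable_ingredients [measurable]:
  "h \<in> borel_measurable borel" "tent \<in> borel_measurable borel" "S \<in> sets borel"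
  using h_cont S unfolding tent_def by (auto intro: borel_measurable_continuous_onI)

lemma borel_measurable_gap [measurable]: "(\<lambda>(x, t). gap \<kappa> x t) \<in> borel_measurable (borel \<Otimes>\<^sub>M borel)"
  unfolding gap_def by measurable

lemmas borel_measurable_gap' [measurable (raw)] = measurable_Pair_compose_split[OF borel_measurable_gap]

lemma gap_bounds:
  assumes "0 \<le> \<kappa>" shows "0 \<le> gap \<kappa> x t" "gap \<kappa> x t \<le> h t" "gap \<kappa> x t \<le> 1"
proof -
  show "0 \<le> gap \<kappa> x t" by (simp add: gap_def)
  have "h t * (tent x - \<kappa>) \<le> h t * 1" using assms tent_bounds[of x] h by (intro mult_left_mono) auto
  then show "gap \<kappa> x t \<le> h t" using u_nonneg[of x t] h(1)[of t] by (simp add: gap_def)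
  then show "gap \<kappa> x t \<le> 1" using h(3)[of t] by linarith
qed

lemma gap_outside:
  assumes "0 \<le> \<kappa>" "x \<notin> B" shows "gap \<kappa> x t = 0"
proof -
  have "h t * (tent x - \<kappa>) \<le> 0" using assms h(1)[of t] by (simp add: tent_outside mult_nonneg_nonpos)
  then show ?thesis using u_nonneg[of x t] by (simp add: gap_def)
qed

lemma continuous_gap:
  assumes "0 \<le> \<kappa>" shows "continuous_on {a..c} (gap \<kappa> x)"
proof (cases "x \<in> B")
  case True
  then have "continuous_on {a..c} (u x)" using times r by (intro u_cont_time) auto
  then show ?thesis
    unfolding gap_def[abs_def] by (intro continuous_intros continuous_on_subset[OF h_cont]) auto
qed (simp add: gap_outside[OF assms])

lemma integrable_gap:
  assumes "0 \<le> \<kappa>" shows "integrable lborel (\<lambda>x. gap \<kappa> x t)" "integrable lborel (\<lambda>x. (gap \<kappa> x t)\<^sup>2)"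
  using gap_bounds[OF assms] gap_outside[OF assms]
  by (auto intro!: integrable_bounded_support[where M = 1 and y = x0 and r = r] simp: power_le_one)

lemma positivity_set_bounded:
  assumes "0 \<le> \<kappa>"
  shows "{x. 0 < gap \<kappa> x t} \<subseteq> B" "{x. 0 < gap \<kappa> x t} \<in> sets borel" "emeasure lborel {x. 0 < gap \<kappa> x t} < \<infinity>"
proof -
  show 1: "{x. 0 < gap \<kappa> x t} \<subseteq> B" using gap_outside[OF assms] by force
  show 2: "{x. 0 < gap \<kappa> x t} \<in> sets borel" by measurable
  have "emeasure lborel {x. 0 < gap \<kappa> x t} \<le> emeasure lborel B" using 1 by (intro emeasure_mono) auto
  then show "emeasure lborel {x. 0 < gap \<kappa> x t} < \<infinity>"
    using emeasure_lborel_cball_finite[of x0 r] by (rule le_less_trans)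
qed

text \<open>
  The heart of the argument, a pointwise inequality for pairs \<open>(x, y)\<close>. Pairs outside \<open>{gap > 0}\<close> contribute
  nothing. For the others \<open>Phi_difference_coercive\<close> gives the asserted bound without the term with \<open>\<epsilon>\<close>.
  If \<open>gap > 0\<close> at \<open>x\<close> and \<open>u(y) \<ge> l\<close> with \<open>y \<in> S\<close>, then \<open>u(x) - u(y) \<le> - 3 l / 4\<close>, and one half of the
  resulting negative term absorbs the growth of the barrier, while the other half exceeds the Gagliardo
  term since \<open>gap \<le> l / 4\<close>.
\<close>
lemma flux_gap_bound:
  assumes \<kappa>: "0 \<le> \<kappa>"
  shows "flux (\<lambda>x. gap \<kappa> x t) ((x, y), t) + \<epsilon> * (indicator {y \<in> S. l \<le> u y t} y * gap \<kappa> x t)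
    \<le> C1 * young_const p * (h t powr p * \<tau> (x - y) * (indicator {x. 0 < gap \<kappa> x t} x + indicator {x. 0 < gap \<kappa> x t} y))
      - Co * 2 powr (1 - p) * gagliardo (\<lambda>x. gap \<kappa> x t) (x, y)"
proof -
  define d where "d = u x t - u y t"
  define b where "b = gap \<kappa> x t - gap \<kappa> y t"
  define v where "v = h t * (tent x - \<kappa>) - h t * (tent y - \<kappa>)"
  let ?A = "{x. 0 < gap \<kappa> x t}"
  let ?n = "norm (x - y) powr \<alpha>"
  let ?K = "K (x, y) t"
  have g0: "0 \<le> gap \<kappa> x t" "0 \<le> gap \<kappa> y t" using gap_bounds[OF \<kappa>] by auto
  have b2: "d * b \<le> (v - b) * b"
    using positive_part_difference[of "h t * (tent x - \<kappa>) - u x t" "h t * (tent y - \<kappa>) - u y t"]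
    by (simp add: d_def b_def v_def gap_def algebra_simps)
  have v: "\<bar>v\<bar> powr p \<le> h t powr p * min 1 (norm (x - y) / r) powr p"
  proof -
    have "\<bar>v\<bar> = h t * \<bar>tent x - tent y\<bar>" using h(1)[of t] by (simp add: v_def right_diff_distrib[symmetric] abs_mult)
    also have "\<dots> \<le> h t * min 1 (norm (x - y) / r)" using h(1) by (intro mult_left_mono tent_lipschitz)
    finally have "\<bar>v\<bar> powr p \<le> (h t * min 1 (norm (x - y) / r)) powr p" using p by (intro powr_mono2) auto
    also have "\<dots> = h t powr p * min 1 (norm (x - y) / r) powr p" using h(1)[of t] r by (intro powr_mult)
    finally show ?thesis .
  qed
  have K0: "0 \<le> ?K" by (rule K_nonneg)
  have gain: "Co * 2 powr (1 - p) * gagliardo (\<lambda>x. gap \<kappa> x t) (x, y) \<le> ?K * (2 powr (1 - p) * \<bar>b\<bar> powr p)"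
  proof -
    have "Co / ?n * (2 powr (1 - p) * \<bar>b\<bar> powr p) \<le> ?K * (2 powr (1 - p) * \<bar>b\<bar> powr p)"
      using K_bounds(1)[of x y t] by (intro mult_right_mono) auto
    then show ?thesis by (simp add: gagliardo_def b_def mult_ac)
  qed
  have loss0: "0 \<le> C1 * young_const p * (h t powr p * \<tau> (x - y) * (indicator ?A x + indicator ?A y))"
    using C1 young_const_pos[of p] h(1)[of t] by (intro mult_nonneg_nonneg truncated_kernel_nonneg) auto
  have F: "flux (\<lambda>x. gap \<kappa> x t) ((x, y), t) = ?K * (Phi p d * b)" by (simp add: flux_def d_def b_def)
  \<comment> \<open>The second case consists of the pairs that make the barrier rise.\<close>
  consider "x \<notin> ?A" "y \<notin> ?A" | "x \<in> ?A" "y \<in> S" "l \<le> u y t"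
    | "x \<in> ?A \<or> y \<in> ?A" "\<not> (x \<in> ?A \<and> y \<in> S \<and> l \<le> u y t)" by blast
  then show ?thesis
  proof cases
    case 1
    then have "gap \<kappa> x t = 0" "gap \<kappa> y t = 0" using g0 by auto
    moreover have "gagliardo (\<lambda>x. gap \<kappa> x t) (x, y) = 0" using calculation by (simp add: gagliardo_def)
    ultimately show ?thesis using F by (simp add: b_def)
  next
    case 2
    have "h t * (tent y - \<kappa>) \<le> h t * 1" using \<kappa> tent_bounds[of y] h by (intro mult_left_mono) auto
    then have wy: "gap \<kappa> y t = 0" using 2 h(2)[of t] l by (simp add: gap_def)
    have b: "b = gap \<kappa> x t" "0 < b" using 2 wy by (auto simp: b_def)
    have b_le: "b \<le> l / 4" using b gap_bounds(2)[OF \<kappa>, of x t] h(2)[of t] by linarith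
    have ux: "u x t \<le> l / 4"
    proof -
      have "h t * (tent x - \<kappa>) \<le> h t * 1" using \<kappa> tent_bounds[of x] h by (intro mult_left_mono) auto
      then show ?thesis using 2(1) h(2)[of t] by (simp add: gap_def)
    qed
    have "Phi p d \<le> Phi p (- (3 * l / 4))" using 2 ux p by (intro Phi_mono) (auto simp: d_def)
    also have "\<dots> = - ((3 * l / 4) powr (p - 1))" using l by (simp add: Phi_minus Phi_nonneg)
    finally have "Phi p d * b \<le> - ((3 * l / 4) powr (p - 1)) * b" using b by (intro mult_right_mono) auto
    then have 3: "?K * (Phi p d * b) \<le> ?K * (- ((3 * l / 4) powr (p - 1)) * b)" using K0 by (rule mult_left_mono)
    have xy: "norm (x - y) \<le> \<rho> + r"
    proof -
      have "x \<in> B" using 2(1) gap_outside[OF \<kappa>, of x t] by force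
      moreover have "y \<in> cball x0 \<rho>" using 2 S by auto
      ultimately show ?thesis using dist_triangle2[of x y x0] by (simp add: dist_norm norm_minus_commute)
    qed
    have xny: "x \<noteq> y" using b wy by auto
    have half: "\<epsilon> * b \<le> ?K * ((3 * l / 4) powr (p - 1) / 2 * b)"
    proof -
      have "Co / (\<rho> + r) powr \<alpha> \<le> Co / ?n"
        using xy xny Co alpha by (intro divide_left_mono powr_mono2 mult_pos_pos) auto
      also have "\<dots> \<le> ?K" by (rule K_bounds)
      finally have "(3 * l / 4) powr (p - 1) / 2 * (Co / (\<rho> + r) powr \<alpha>) \<le> (3 * l / 4) powr (p - 1) / 2 * ?K"
        by (intro mult_left_mono) auto
      then have "\<epsilon> \<le> (3 * l / 4) powr (p - 1) / 2 * ?K" using \<epsilon> by linarith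
      then have "\<epsilon> * b \<le> (3 * l / 4) powr (p - 1) / 2 * ?K * b" using b by (intro mult_right_mono) auto
      then show ?thesis by (simp add: mult_ac)
    qed
    have other: "2 powr (1 - p) * \<bar>b\<bar> powr p \<le> (3 * l / 4) powr (p - 1) / 2 * b"
    proof -
      have "2 powr (1 - p) * \<bar>b\<bar> powr p = 2 powr (1 - p) * (\<bar>b\<bar> powr (p - 1) * \<bar>b\<bar>)"
        by (simp only: abs_powr_times)
      also have "\<dots> = (b / 2) powr (p - 1) * b"
        using b by (simp add: powr_divide powr_diff)
      also have "\<dots> \<le> (l / 8) powr (p - 1) * b" using b b_le p by (intro mult_right_mono powr_mono2) auto
      also have "(l / 8) powr (p - 1) = (3 * l / 4) powr (p - 1) / 6 powr (p - 1)"
        using l by (simp add: powr_divide[symmetric])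
      also have "\<dots> \<le> (3 * l / 4) powr (p - 1) / 2"
      proof -
        have "(2::real) \<le> 6 powr 1" by simp
        also have "\<dots> \<le> 6 powr (p - 1)" using p by (intro powr_mono) auto
        finally show ?thesis by (intro divide_left_mono) auto
      qed
      finally show ?thesis using b by (simp add: mult_right_mono)
    qed
    have "?K * (2 powr (1 - p) * \<bar>b\<bar> powr p) \<le> ?K * ((3 * l / 4) powr (p - 1) / 2 * b)"
      using other K0 by (rule mult_left_mono)
    moreover have "?K * (- ((3 * l / 4) powr (p - 1)) * b) =
        - (?K * ((3 * l / 4) powr (p - 1) / 2 * b)) - ?K * ((3 * l / 4) powr (p - 1) / 2 * b)"
      by (simp add: algebra_simps)
    moreover have kick: "indicator {y \<in> S. l \<le> u y t} y * gap \<kappa> x t = b" using 2 b by simp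
    ultimately show ?thesis using 3 half gain loss0 unfolding F kick by linarith
  next
    case 3
    then have kick: "indicator {y \<in> S. l \<le> u y t} y * gap \<kappa> x t = 0"
      using g0 by (auto simp: indicator_def)
    have "?K * (Phi p d * b) \<le> ?K * (young_const p * \<bar>v\<bar> powr p - 2 powr (1 - p) * \<bar>b\<bar> powr p)"
      using K0 b2 p by (intro mult_left_mono Phi_difference_coercive) auto
    also have "\<dots> = ?K * (young_const p * \<bar>v\<bar> powr p) - ?K * (2 powr (1 - p) * \<bar>b\<bar> powr p)"
      by (simp add: algebra_simps)
    also have "?K * (young_const p * \<bar>v\<bar> powr p) \<le>
        C1 / ?n * (young_const p * (h t powr p * min 1 (norm (x - y) / r) powr p))"
      using K_bounds(2)[of x y t] K0 v young_const_pos[of p] C1 by (intro mult_mono) auto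
    also have "\<dots> = C1 * young_const p * (h t powr p * \<tau> (x - y))"
      by (simp add: truncated_kernel_def)
    also have "\<dots> \<le> C1 * young_const p * (h t powr p * \<tau> (x - y) * (indicator ?A x + indicator ?A y))"
    proof -
      have "1 \<le> (indicator ?A x + indicator ?A y :: real)" using 3(1) by (auto simp: indicator_def)
      then have "h t powr p * \<tau> (x - y) * 1 \<le> h t powr p * \<tau> (x - y) * (indicator ?A x + indicator ?A y)"
        by (intro mult_left_mono) (auto simp: truncated_kernel_nonneg)
      then show ?thesis using C1 young_const_pos[of p] by (intro mult_left_mono) auto
    qed
    finally show ?thesis using gain unfolding F kick by linarith
  qed
qed

lemma gagliardo_gap_le:
  assumes "0 \<le> \<kappa>"
  shows "gagliardo (\<lambda>x. gap \<kappa> x t) (x, y) \<le> 2 powr p * (\<tau> (x - y) + gagliardo (\<lambda>x. u x t) (x, y))"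
proof -
  have "\<bar>gap \<kappa> x t - gap \<kappa> y t\<bar> \<le> \<bar>h t * (tent x - tent y)\<bar> + \<bar>u x t - u y t\<bar>"
    by (simp add: gap_def right_diff_distrib)
  also have "\<bar>h t * (tent x - tent y)\<bar> \<le> 1 * min 1 (norm (x - y) / r)"
    unfolding abs_mult using h[of t] tent_lipschitz[of x y] by (intro mult_mono) auto
  finally have "\<bar>gap \<kappa> x t - gap \<kappa> y t\<bar> powr p \<le> (min 1 (norm (x - y) / r) + \<bar>u x t - u y t\<bar>) powr p"
    using p by (intro powr_mono2) auto
  also have "\<dots> \<le> 2 powr p * (min 1 (norm (x - y) / r) powr p + \<bar>u x t - u y t\<bar> powr p)"
    using p r by (intro powr_add_le) auto
  finally have "\<bar>gap \<kappa> x t - gap \<kappa> y t\<bar> powr p / norm (x - y) powr \<alpha> \<le>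
      2 powr p * (min 1 (norm (x - y) / r) powr p + \<bar>u x t - u y t\<bar> powr p) / norm (x - y) powr \<alpha>"
    by (rule divide_right_mono) simp
  then show ?thesis by (simp add: gagliardo_def truncated_kernel_def add_divide_distrib distrib_left)
qed

end

section \<open>The energy inequality\<close>

context fractional_data
begin

text \<open>
  A real-valued indicator of the points of \<open>S\<close> that push the solution upwards.
\<close>
definition kick :: "'a set \<Rightarrow> real \<Rightarrow> 'a \<Rightarrow> real \<Rightarrow> real" where
  "kick S l y t = (if y \<in> S \<and> l \<le> u y t then 1 else 0)"

lemma borel_measurable_kick:
  assumes [measurable]: "S \<in> sets borel"
  shows "(\<lambda>(y, t). kick S l y t) \<in> borel_measurable (borel \<Otimes>\<^sub>M borel)"
  unfolding kick_def by measurable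

lemmas borel_measurable_kick' [measurable (raw)] = measurable_Pair_compose_split[OF borel_measurable_kick]

lemma superlevel_set:
  assumes S: "S \<in> sets borel" "S \<subseteq> cball x0 \<rho>"
  shows "{y \<in> S. l \<le> u y t} \<in> sets borel" "emeasure lborel {y \<in> S. l \<le> u y t} < \<infinity>"
  "measure lborel {y \<in> S. l \<le> u y t} \<le> measure lborel (cball x0 \<rho>)"
proof -
  note S(1)[measurable]
  show 1: "{y \<in> S. l \<le> u y t} \<in> sets borel" by measurable
  have sub: "{y \<in> S. l \<le> u y t} \<subseteq> cball x0 \<rho>" using S by auto
  then have "emeasure lborel {y \<in> S. l \<le> u y t} \<le> emeasure lborel (cball x0 \<rho>)" by (intro emeasure_mono) auto
  then show "emeasure lborel {y \<in> S. l \<le> u y t} < \<infinity>"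
    using emeasure_lborel_cball_finite[of x0 \<rho>] by (rule le_less_trans)
  show "measure lborel {y \<in> S. l \<le> u y t} \<le> measure lborel (cball x0 \<rho>)"
    using sub 1 emeasure_lborel_cball_finite[of x0 \<rho>] by (intro measure_mono_fmeasurable) (auto simp: fmeasurable_def)
qed

lemma nn_integral_kick_general:
  assumes S: "S \<in> sets borel" "S \<subseteq> cball x0 \<rho>"
  shows "(\<integral>\<^sup>+y. ennreal (kick S l y t) \<partial>lborel) = ennreal (measure lborel {y \<in> S. l \<le> u y t})"
proof -
  have "(\<integral>\<^sup>+y. ennreal (kick S l y t) \<partial>lborel) = (\<integral>\<^sup>+y. indicator {y \<in> S. l \<le> u y t} y \<partial>lborel)"
    by (intro nn_integral_cong) (auto simp: kick_def indicator_def)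
  also have "\<dots> = emeasure lborel {y \<in> S. l \<le> u y t}" using superlevel_set(1)[OF S] by simp
  finally show ?thesis using superlevel_set(2)[OF S, of l t] by (simp add: emeasure_eq_ennreal_measure)
qed

lemma borel_measurable_superlevel_measure:
  assumes S: "S \<in> sets borel" "S \<subseteq> cball x0 \<rho>"
  shows "(\<lambda>t. measure lborel {y \<in> S. l \<le> u y t}) \<in> borel_measurable borel"
proof -
  note S(1)[measurable]
  have "(\<lambda>t. measure lborel {y \<in> S. l \<le> u y t}) = (\<lambda>t. enn2real (\<integral>\<^sup>+y. ennreal (kick S l y t) \<partial>lborel))"
    by (simp add: nn_integral_kick_general[OF S])
  then show ?thesis by simp
qed

end

context barrier
begin

definition gap_measure :: "real \<Rightarrow> real \<Rightarrow> real" where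
  "gap_measure \<kappa> t = measure lborel {x. 0 < gap \<kappa> x t}"

definition gap_energy :: "real \<Rightarrow> real \<Rightarrow> real" where
  "gap_energy \<kappa> t = (LINT x|lborel. (gap \<kappa> x t)\<^sup>2) / 2"

text \<open>
  The part of the majorant of the flux that depends on the test function.
\<close>
definition near_gap :: "real \<Rightarrow> ('a \<times> 'a) \<times> real \<Rightarrow> real" where
  "near_gap \<kappa> z = C1 * indicator (B2 \<times> B2) (fst z) * gagliardo (\<lambda>x. gap \<kappa> x (snd z)) (fst z)"

text \<open>
  The integrand \<open>q\<close> of \<open>diagonal_limit\<close>: the flux tested with the gap at time \<open>t\<close>, and the growth
  of the barrier, written as an integral over the same pairs of points.
\<close>
definition rate :: "real \<Rightarrow> ('a \<times> 'a) \<times> real \<Rightarrow> real \<Rightarrow> real" where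
  "rate \<kappa> z t = flux (\<lambda>x. gap \<kappa> x t) z + \<epsilon> * (kick S l (snd (fst z)) (snd z) * gap \<kappa> (fst (fst z)) t)"

lemma borel_measurable_near_gap [measurable]: "near_gap \<kappa> \<in> borel_measurable borel"
  unfolding near_gap_def gagliardo_def split_beta' by measurable

lemma borel_measurable_gagliardo_gap [measurable]:
  "(\<lambda>z. gagliardo (\<lambda>x. gap \<kappa> x (snd z)) (fst z)) \<in> borel_measurable borel"
  unfolding gagliardo_def split_beta' by measurable

lemma borel_measurable_rate: "(\<lambda>(z, t). rate \<kappa> z t) \<in> borel_measurable (borel \<Otimes>\<^sub>M borel)"
  unfolding rate_def flux_def split_beta' by measurable

lemmas kick_set = superlevel_set[OF S] and nn_integral_kick = nn_integral_kick_general[OF S]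
  and borel_measurable_kick_measure [measurable] = borel_measurable_superlevel_measure[OF S]

lemma nn_integral_gap_set:
  assumes "0 \<le> \<kappa>"
  shows "(\<integral>\<^sup>+x. ennreal (if 0 < gap \<kappa> x t then 1 else 0) \<partial>lborel) = ennreal (gap_measure \<kappa> t)"
proof -
  have "(\<integral>\<^sup>+x. ennreal (if 0 < gap \<kappa> x t then 1 else 0) \<partial>lborel) = (\<integral>\<^sup>+x. indicator {x. 0 < gap \<kappa> x t} x \<partial>lborel)"
    by (intro nn_integral_cong) auto
  also have "\<dots> = emeasure lborel {x. 0 < gap \<kappa> x t}" using positivity_set_bounded[OF assms] by simp
  finally show ?thesis
    using positivity_set_bounded[OF assms, of t] by (simp add: gap_measure_def emeasure_eq_ennreal_measure)
qed

lemma borel_measurable_gap_measure: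
  assumes "0 \<le> \<kappa>" shows "gap_measure \<kappa> \<in> borel_measurable borel"
proof -
  have "gap_measure \<kappa> = (\<lambda>t. enn2real (\<integral>\<^sup>+x. ennreal (if 0 < gap \<kappa> x t then 1 else 0) \<partial>lborel))"
    unfolding nn_integral_gap_set[OF assms] by (simp add: gap_measure_def fun_eq_iff)
  also have "\<dots> \<in> borel_measurable borel" by measurable
  finally show ?thesis .
qed

lemma gap_measure_bounds:
  assumes "0 \<le> \<kappa>" shows "0 \<le> gap_measure \<kappa> t" "gap_measure \<kappa> t \<le> measure lborel B"
  using positivity_set_bounded[OF assms, of t] emeasure_lborel_cball_finite[of x0 r]
  by (auto simp: gap_measure_def fmeasurable_def intro!: measure_mono_fmeasurable)

lemma continuous_gap_energy:
  assumes "0 \<le> \<kappa>" shows "continuous_on {a..c} (gap_energy \<kappa>)"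
proof -
  have "(\<lambda>n. gap_energy \<kappa> (x n)) \<longlonglongrightarrow> gap_energy \<kappa> t"
    if x: "t \<in> {a..c}" "\<And>n. x n \<in> {a..c}" "x \<longlonglongrightarrow> t" for x t
    unfolding gap_energy_def
  proof (intro tendsto_divide tendsto_const integral_dominated_convergence[where w = "indicator B"])
    show "integrable lborel (indicator B :: 'a \<Rightarrow> real)"
      using emeasure_lborel_cball_finite[of x0 r] by (intro integrable_real_indicator) auto
    have "(\<lambda>n. gap \<kappa> y (x n)) \<longlonglongrightarrow> gap \<kappa> y t" for y
      using x by (intro continuous_on_tendsto_compose[OF continuous_gap[OF assms]]) auto
    then show "AE y in lborel. (\<lambda>n. (gap \<kappa> y (x n))\<^sup>2) \<longlonglongrightarrow> (gap \<kappa> y t)\<^sup>2"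
      by (intro AE_I2 tendsto_power)
    show "AE y in lborel. norm ((gap \<kappa> y (x n))\<^sup>2) \<le> indicator B y" for n
    proof (intro AE_I2)
      fix y show "norm ((gap \<kappa> y (x n))\<^sup>2) \<le> indicator B y"
        using gap_bounds[OF assms, of y "x n"] gap_outside[OF assms, of y "x n"]
        by (cases "y \<in> B") (auto simp: power_le_one)
    qed
  qed auto
  then show ?thesis by (auto simp: continuous_on_sequentially comp_def)
qed

lemma integrable_near_gap:
  assumes "0 \<le> \<kappa>" shows "set_integrable lborel (UNIV \<times> {a..c}) (near_gap \<kappa>)"
proof -
  let ?D = "\<lambda>z. C1 * 2 powr p * (indicator (UNIV \<times> {a..c}) z *\<^sub>R (indicator B2 (fst (fst z)) * \<tau> (fst (fst z) - snd (fst z)))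
    + indicator ((B2 \<times> B2) \<times> {a..c}) z *\<^sub>R (\<bar>u (fst (fst z)) (snd z) - u (snd (fst z)) (snd z)\<bar> powr p / norm (fst (fst z) - snd (fst z)) powr \<alpha>))"
  have "integrable lborel ?D"
  proof (intro integrable_mult_right Bochner_Integration.integrable_add)
    show "integrable lborel (\<lambda>z. indicat_real (UNIV \<times> {a..c}) z *\<^sub>R (indicator B2 (fst (fst z)) * \<tau> (fst (fst z) - snd (fst z))))"
      using integrable_indicator_ball_kernel(1)[of a c "2 * r"] by (simp add: set_integrable_def)
    show "integrable lborel (\<lambda>z. indicator ((B2 \<times> B2) \<times> {a..c}) z *\<^sub>R
        (\<bar>u (fst (fst z)) (snd z) - u (snd (fst z)) (snd z)\<bar> powr p / norm (fst (fst z) - snd (fst z)) powr \<alpha>))"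
      using u_gagliardo[OF times] unfolding set_integrable_def split_beta' .
  qed
  then show ?thesis
    unfolding set_integrable_def
  proof (rule Bochner_Integration.integrable_bound)
    show "AE z in lborel. norm (indicator (UNIV \<times> {a..c}) z *\<^sub>R near_gap \<kappa> z) \<le> norm (?D z)"
    proof (intro AE_I2)
      fix z :: "('a \<times> 'a) \<times> real"
      obtain x y t where z: "z = ((x, y), t)" by (metis surj_pair)
      show "norm (indicator (UNIV \<times> {a..c}) z *\<^sub>R near_gap \<kappa> z) \<le> norm (?D z)"
      proof (cases "t \<in> {a..c} \<and> x \<in> B2 \<and> y \<in> B2")
        case True
        have "C1 * gagliardo (\<lambda>x. gap \<kappa> x t) (x, y) \<le> C1 * (2 powr p * (\<tau> (x - y) + gagliardo (\<lambda>x. u x t) (x, y)))"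
          using C1 by (intro mult_left_mono gagliardo_gap_le[OF assms]) auto
        also have "\<dots> = ?D z" using True by (simp add: z gagliardo_def mult.assoc)
        finally have "C1 * gagliardo (\<lambda>x. gap \<kappa> x t) (x, y) \<le> ?D z" .
        moreover have "norm (indicator (UNIV \<times> {a..c}) z *\<^sub>R near_gap \<kappa> z) = C1 * gagliardo (\<lambda>x. gap \<kappa> x t) (x, y)"
          using True C1 by (simp add: z near_gap_def gagliardo_nonneg)
        ultimately show ?thesis by simp
      next
        case False
        then have 0: "indicator (UNIV \<times> {a..c}) z *\<^sub>R near_gap \<kappa> z = 0" by (auto simp: z near_gap_def)
        show ?thesis unfolding 0 by simp
      qed
    qed
  qed measurable
qed

text \<open>
  Links \<open>rate\<close> to the increments of \<open>h\<close>: the double integral over \<open>(x, y)\<close> factorises.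
\<close>
lemma kick_integral:
  assumes \<kappa>: "0 \<le> \<kappa>" and t: "a1 \<le> b1"
  shows "set_integrable lborel (UNIV \<times> {a1..b1}) (\<lambda>z. kick S l (snd (fst z)) (snd z) * gap \<kappa> (fst (fst z)) t)"
    and "(LINT z:UNIV \<times> {a1..b1}|lborel. kick S l (snd (fst z)) (snd z) * gap \<kappa> (fst (fst z)) t) =
      (LINT x|lborel. gap \<kappa> x t) * (LINT \<tau>:{a1..b1}|lborel. measure lborel {y \<in> S. l \<le> u y \<tau>})"
proof -
  let ?m = "\<lambda>\<tau>. measure lborel {y \<in> S. l \<le> u y \<tau>}"
  let ?f = "\<lambda>z :: ('a \<times> 'a) \<times> real. indicator {a1..b1} (snd z) * (kick S l (snd (fst z)) (snd z) * gap \<kappa> (fst (fst z)) t)"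
  note g0 = gap_bounds(1)[OF \<kappa>]
  have f0: "0 \<le> ?f z" for z using g0 by (auto simp: kick_def)
  have mi: "integrable lborel (\<lambda>\<tau>. indicator {a1..b1} \<tau> * ?m \<tau>)"
  proof (rule Bochner_Integration.integrable_bound)
    show "integrable lborel (\<lambda>\<tau>. indicator {a1..b1} \<tau> * measure lborel (cball x0 \<rho>))"
      using t by (intro integrable_mult_left integrable_real_indicator) (simp_all add: less_top[symmetric])
    show "AE \<tau> in lborel. norm (indicator {a1..b1} \<tau> * ?m \<tau>) \<le> norm (indicator {a1..b1} \<tau> * measure lborel (cball x0 \<rho>))"
      using kick_set(3) by (intro AE_I2) (auto simp: indicator_def)
  qed measurable
  have "(\<integral>\<^sup>+z. ennreal (?f z) \<partial>lborel) = (\<integral>\<^sup>+\<tau>. \<integral>\<^sup>+x. \<integral>\<^sup>+y. ennreal (indicator {a1..b1} \<tau> * gap \<kappa> x t) * ennreal (kick S l y \<tau>) \<partial>lborel \<partial>lborel \<partial>lborel)"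
    using g0 by (subst nn_integral_lborel_triple(1)) (auto simp: ennreal_mult[symmetric] kick_def mult_ac intro!: nn_integral_cong)
  also have "\<dots> = (\<integral>\<^sup>+\<tau>. \<integral>\<^sup>+x. ennreal (gap \<kappa> x t) * ennreal (indicator {a1..b1} \<tau> * ?m \<tau>) \<partial>lborel \<partial>lborel)"
  proof (intro nn_integral_cong)
    fix \<tau> x
    have "(\<integral>\<^sup>+y. ennreal (indicator {a1..b1} \<tau> * gap \<kappa> x t) * ennreal (kick S l y \<tau>) \<partial>lborel) = ennreal (indicator {a1..b1} \<tau> * gap \<kappa> x t) * ennreal (?m \<tau>)"
      by (subst nn_integral_cmult) (simp_all add: nn_integral_kick)
    then show "(\<integral>\<^sup>+y. ennreal (indicator {a1..b1} \<tau> * gap \<kappa> x t) * ennreal (kick S l y \<tau>) \<partial>lborel) = ennreal (gap \<kappa> x t) * ennreal (indicator {a1..b1} \<tau> * ?m \<tau>)"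
      using g0 by (simp add: ennreal_mult[symmetric] mult_ac)
  qed
  also have "\<dots> = (\<integral>\<^sup>+\<tau>. ennreal (LINT x|lborel. gap \<kappa> x t) * ennreal (indicator {a1..b1} \<tau> * ?m \<tau>) \<partial>lborel)"
    using g0 by (simp add: nn_integral_multc nn_integral_eq_integral[OF integrable_gap(1)[OF \<kappa>]])
  also have "\<dots> = ennreal (LINT x|lborel. gap \<kappa> x t) * ennreal (\<integral>\<tau>. indicator {a1..b1} \<tau> * ?m \<tau> \<partial>lborel)"
    by (subst nn_integral_cmult) (simp_all add: nn_integral_eq_integral[OF mi])
  also have "\<dots> = ennreal ((LINT x|lborel. gap \<kappa> x t) * (\<integral>\<tau>. indicator {a1..b1} \<tau> * ?m \<tau> \<partial>lborel))"
    using g0 by (simp add: ennreal_mult integral_nonneg)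
  finally have nn: "(\<integral>\<^sup>+z. ennreal (?f z) \<partial>lborel) = \<dots>" .
  have [measurable]: "?f \<in> borel_measurable lborel" by measurable
  have "integrable lborel ?f" using nn f0 by (intro integrableI_nonneg) auto
  then show "set_integrable lborel (UNIV \<times> {a1..b1}) (\<lambda>z. kick S l (snd (fst z)) (snd z) * gap \<kappa> (fst (fst z)) t)"
    unfolding set_integrable_def by (simp add: indicator_times)
  have "integral\<^sup>L lborel ?f = (LINT x|lborel. gap \<kappa> x t) * (\<integral>\<tau>. indicator {a1..b1} \<tau> * ?m \<tau> \<partial>lborel)"
    using nn f0 g0 by (subst integral_eq_nn_integral) (auto intro!: mult_nonneg_nonneg integral_nonneg)
  then show "(LINT z:UNIV \<times> {a1..b1}|lborel. kick S l (snd (fst z)) (snd z) * gap \<kappa> (fst (fst z)) t) =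
      (LINT x|lborel. gap \<kappa> x t) * (LINT \<tau>:{a1..b1}|lborel. ?m \<tau>)"
    unfolding set_lebesgue_integral_def by (simp add: indicator_times)
qed

text \<open>
  Convexity of \<open>z \<mapsto> (max 0 z)\<^sup>2 / 2\<close> bounds the increment of the energy over \<open>[t, t']\<close> by the gap at time \<open>t'\<close>
  times the increments of the barrier and of \<open>- u\<close>, and the latter is estimated by the weak inequality
  with test function \<open>gap (\<cdot>, t')\<close>. That function belongs to the fractional Sobolev space only for
  almost every \<open>t'\<close>.
\<close>
lemma energy_step:
  assumes \<kappa>: "0 \<le> \<kappa>"
  shows "AE t' in lborel. \<forall>t. a \<le> t \<and> t < t' \<and> t' \<le> c \<longrightarrow>
    gap_energy \<kappa> t' - gap_energy \<kappa> t \<le> (LINT z:UNIV \<times> {t..t'}|lborel. rate \<kappa> z t')"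
proof -
  have "integrable (lborel \<Otimes>\<^sub>M lborel) (\<lambda>(z, t). indicator {a..c} t * near_gap \<kappa> (z, t))"
    using integrable_near_gap[OF \<kappa>] unfolding set_integrable_def lborel_prod split_beta'
    by (simp add: indicator_times)
  from lborel_pair.AE_integrable_snd[OF this]
  show ?thesis
  proof eventually_elim
    case (elim t')
    show ?case
    proof (intro allI impI)
      fix t assume t: "a \<le> t \<and> t < t' \<and> t' \<le> c"
      let ?w = "\<lambda>x. gap \<kappa> x t'"
      have g: "set_integrable lborel (B2 \<times> B2) (gagliardo ?w)"
      proof -
        have "integrable lborel (\<lambda>z. near_gap \<kappa> (z, t') / C1)" using elim t by simp
        then show ?thesis using C1 by (simp add: near_gap_def set_integrable_def)
      qed
      have tt: "0 < t" "t < t'" "t' < T" using t times by auto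
      note wb = gap_bounds[OF \<kappa>, of _ t'] and wo = gap_outside[OF \<kappa>, of _ t']
      have fl: "set_integrable lborel (UNIV \<times> {t..t'}) (flux ?w)"
        by (rule integrable_flux[OF tt _ _ _ g]) (use wb wo in auto)
      have wk: "0 \<le> (LINT x|lborel. ?w x * (u x t' - u x t)) + (LINT z:UNIV \<times> {t..t'}|lborel. flux ?w z)"
        by (rule weak[OF tt _ _ _ g]) (use wb wo in auto)
      obtain M where M: "0 \<le> M" "\<And>x s. x \<in> B2 \<Longrightarrow> s \<in> {t..t'} \<Longrightarrow> u x s \<le> M"
        using u_bounded[OF tt(1,3)] by blast
      have BB: "B \<subseteq> B2" using r by auto
      have iu: "integrable lborel (\<lambda>x. ?w x * (u x t' - u x t))"
      proof (rule integrable_bounded_support[where M = M and y = x0 and r = r])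
        show "(\<lambda>x. ?w x * (u x t' - u x t)) \<in> borel_measurable borel" by measurable
        show "\<bar>?w x * (u x t' - u x t)\<bar> \<le> M" for x
        proof (cases "x \<in> B")
          case True
          have "\<bar>?w x\<bar> \<le> 1" using wb[of x] by simp
          then have "\<bar>?w x\<bar> * \<bar>u x t' - u x t\<bar> \<le> 1 * M"
            using M(2)[of x t'] M(2)[of x t] u_nonneg[of x t] u_nonneg[of x t'] True BB t M(1)
            by (intro mult_mono) (auto simp: abs_if)
          then show ?thesis by (simp add: abs_mult)
        qed (use wo M(1) in simp)
      qed (use wo in auto)
      have "gap_energy \<kappa> t' - gap_energy \<kappa> t = (LINT x|lborel. (?w x)\<^sup>2 / 2 - (gap \<kappa> x t)\<^sup>2 / 2)"
        unfolding gap_energy_def using integrable_gap(2)[OF \<kappa>]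
        by (subst Bochner_Integration.integral_diff) auto
      also have "\<dots> \<le> (LINT x|lborel. (h t' - h t) * ?w x - ?w x * (u x t' - u x t))"
      proof (rule integral_mono)
        fix x
        let ?z' = "h t' * (tent x - \<kappa>) - u x t'" and ?z = "h t * (tent x - \<kappa>) - u x t"
        have hh: "0 \<le> h t' - h t"
          using h_increment[of t t'] t \<epsilon>(1) by (auto intro!: mult_nonneg_nonneg simp: set_lebesgue_integral_def)
        have "(?w x)\<^sup>2 / 2 - (gap \<kappa> x t)\<^sup>2 / 2 \<le> ?w x * (?z' - ?z)"
        proof -
          have "(max 0 y)\<^sup>2 / 2 - (max 0 z)\<^sup>2 / 2 \<le> max 0 y * (y - z)" for y z :: real
          proof -
            have "0 \<le> (max 0 y - max 0 z)\<^sup>2" by simp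
            then have "2 * (max 0 y * max 0 z) \<le> (max 0 y)\<^sup>2 + (max 0 z)\<^sup>2" by (simp add: power2_diff)
            moreover have "max 0 y * z \<le> max 0 y * max 0 z" by (intro mult_left_mono) auto
            moreover have "max 0 y * y = (max 0 y)\<^sup>2" by (simp add: max_def power2_eq_square)
            ultimately show ?thesis unfolding right_diff_distrib by linarith
          qed
          then show ?thesis by (simp add: gap_def)
        qed
        also have "\<dots> = ?w x * ((h t' - h t) * (tent x - \<kappa>)) - ?w x * (u x t' - u x t)"
          by (simp add: algebra_simps)
        also have "\<dots> \<le> ?w x * ((h t' - h t) * 1) - ?w x * (u x t' - u x t)"
          using hh wb[of x] tent_bounds[of x] \<kappa> by (intro diff_right_mono mult_left_mono) auto
        finally show "(?w x)\<^sup>2 / 2 - (gap \<kappa> x t)\<^sup>2 / 2 \<le> (h t' - h t) * ?w x - ?w x * (u x t' - u x t)"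
          by (simp add: mult.commute)
      qed (use integrable_gap[OF \<kappa>] iu in auto)
      also have "\<dots> = (h t' - h t) * (LINT x|lborel. ?w x) - (LINT x|lborel. ?w x * (u x t' - u x t))"
        using integrable_gap(1)[OF \<kappa>] iu by (subst Bochner_Integration.integral_diff) auto
      also have "\<dots> \<le> (h t' - h t) * (LINT x|lborel. ?w x) + (LINT z:UNIV \<times> {t..t'}|lborel. flux ?w z)"
        using wk by simp
      also have "(h t' - h t) * (LINT x|lborel. ?w x) =
          \<epsilon> * (LINT z:UNIV \<times> {t..t'}|lborel. kick S l (snd (fst z)) (snd z) * gap \<kappa> (fst (fst z)) t')"
        using h_increment[of t t'] kick_integral(2)[OF \<kappa>, of t t' t'] t by simp
      also have "\<epsilon> * (LINT z:UNIV \<times> {t..t'}|lborel. kick S l (snd (fst z)) (snd z) * gap \<kappa> (fst (fst z)) t') + (LINT z:UNIV \<times> {t..t'}|lborel. flux ?w z)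
          = (LINT z:UNIV \<times> {t..t'}|lborel. rate \<kappa> z t')"
        using fl kick_integral(1)[OF \<kappa>, of t t' t'] t unfolding rate_def
        by (subst set_integral_add) (auto intro: set_integrable_mult_right)
      finally show "gap_energy \<kappa> t' - gap_energy \<kappa> t \<le> (LINT z:UNIV \<times> {t..t'}|lborel. rate \<kappa> z t')" .
    qed
  qed
qed

abbreviation gap_gagliardo :: "real \<Rightarrow> ('a \<times> 'a) \<times> real \<Rightarrow> real" where
  "gap_gagliardo \<kappa> z \<equiv> gagliardo (\<lambda>x. gap \<kappa> x (snd z)) (fst z)"

lemma continuous_near_gap:
  assumes "0 \<le> \<kappa>" shows "continuous_on {a..c} (\<lambda>t. near_gap \<kappa> (z, t))"
proof -
  have "continuous_on {a..c} (\<lambda>t. C1 * indicator (B2 \<times> B2) z *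
      (\<bar>gap \<kappa> (fst z) t - gap \<kappa> (snd z) t\<bar> powr p * inverse (norm (fst z - snd z) powr \<alpha>)))"
    using p by (intro continuous_intros continuous_gap[OF assms] continuous_on_powr') auto
  then show ?thesis by (simp add: near_gap_def gagliardo_def split_beta' divide_inverse)
qed

lemma continuous_rate:
  assumes "0 \<le> \<kappa>" shows "continuous_on {a..c} (rate \<kappa> z)"
  unfolding rate_def[abs_def] flux_def split_beta'
  by (intro continuous_intros continuous_gap[OF assms])

lemma gap_weight_integral:
  assumes \<kappa>: "0 \<le> \<kappa>" and ab: "a1 \<le> b1"
  defines "m \<equiv> (\<lambda>x :: 'a \<times> real. indicator {a1..b1} (snd x) * (h (snd x) powr p * (if 0 < gap \<kappa> (fst x) (snd x) then 1 else 0)))"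
  shows "m \<in> borel_measurable borel" "integrable lborel m"
    "integral\<^sup>L lborel m = (LINT t:{a1..b1}|lborel. h t powr p * gap_measure \<kappa> t)"
    "set_integrable lborel {a1..b1} (\<lambda>t. h t powr p * gap_measure \<kappa> t)"
proof -
  note [measurable] = borel_measurable_gap_measure[OF \<kappa>]
  have hp: "h t powr p \<le> 1" for t using h[of t] p by (intro powr_le1) auto
  show [measurable]: "m \<in> borel_measurable borel" unfolding m_def by measurable
  have [measurable]: "B \<times> {a1..b1} \<in> sets borel" by (intro borel_closed closed_Times) auto
  have "integrable lborel (\<lambda>x :: 'a \<times> real. indicator (B \<times> {a1..b1}) x :: real)"
    by (rule integrable_indicator_cylinder)
  then show im: "integrable lborel m"
  proof (rule Bochner_Integration.integrable_bound)
    show "AE x in lborel. norm (m x) \<le> norm (indicator (B \<times> {a1..b1}) x :: real)"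
    proof (intro AE_I2)
      fix x :: "'a \<times> real"
      show "norm (m x) \<le> norm (indicator (B \<times> {a1..b1}) x :: real)"
        using hp[of "snd x"] gap_outside[OF \<kappa>, of "fst x" "snd x"]
        by (cases x; cases "fst x \<in> B") (auto simp: m_def indicator_def)
    qed
  qed simp
  have i: "integrable lborel (\<lambda>t. indicator {a1..b1} t * (h t powr p * gap_measure \<kappa> t))"
  proof (rule Bochner_Integration.integrable_bound)
    show "integrable lborel (\<lambda>t. indicator {a1..b1} t * measure lborel B)"
      using ab by (intro integrable_mult_left integrable_real_indicator) (simp_all add: less_top[symmetric])
    show "AE t in lborel. norm (indicator {a1..b1} t * (h t powr p * gap_measure \<kappa> t)) \<le> norm (indicator {a1..b1} t * measure lborel B)"
    proof (intro AE_I2)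
      fix t :: real
      have "h t powr p * gap_measure \<kappa> t \<le> 1 * measure lborel B"
        using hp gap_measure_bounds[OF \<kappa>] by (intro mult_mono) auto
      then show "norm (indicator {a1..b1} t * (h t powr p * gap_measure \<kappa> t)) \<le> norm (indicator {a1..b1} t * measure lborel B)"
        using gap_measure_bounds(1)[OF \<kappa>, of t] by (auto simp: indicator_def)
    qed
  qed measurable
  then show "set_integrable lborel {a1..b1} (\<lambda>t. h t powr p * gap_measure \<kappa> t)"
    by (simp add: set_integrable_def)
  have "(\<integral>\<^sup>+x. ennreal (m x) \<partial>lborel) = (\<integral>\<^sup>+t. \<integral>\<^sup>+x. ennreal (m (x, t)) \<partial>lborel \<partial>lborel)"
    by (subst lborel_prod[symmetric], subst lborel_pair.nn_integral_snd[symmetric]) simp_all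
  also have "\<dots> = (\<integral>\<^sup>+t. ennreal (indicator {a1..b1} t * (h t powr p * gap_measure \<kappa> t)) \<partial>lborel)"
  proof (intro nn_integral_cong)
    fix t :: real
    have "(\<integral>\<^sup>+x. ennreal (m (x, t)) \<partial>lborel) = (\<integral>\<^sup>+x. ennreal (indicator {a1..b1} t * h t powr p) * ennreal (if 0 < gap \<kappa> x t then 1 else 0) \<partial>lborel)"
      by (intro nn_integral_cong) (simp add: m_def)
    also have "\<dots> = ennreal (indicator {a1..b1} t * h t powr p) * ennreal (gap_measure \<kappa> t)"
      by (subst nn_integral_cmult) (simp_all add: nn_integral_gap_set[OF \<kappa>])
    also have "\<dots> = ennreal (indicator {a1..b1} t * (h t powr p * gap_measure \<kappa> t))"
      using gap_measure_bounds(1)[OF \<kappa>] by (simp add: ennreal_mult[symmetric] mult.assoc)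
    finally show "(\<integral>\<^sup>+x. ennreal (m (x, t)) \<partial>lborel) = \<dots>" .
  qed
  finally have "ennreal (integral\<^sup>L lborel m) = ennreal (\<integral>t. indicator {a1..b1} t * (h t powr p * gap_measure \<kappa> t) \<partial>lborel)"
    using im i gap_measure_bounds(1)[OF \<kappa>] by (simp add: nn_integral_eq_integral m_def)
  then show "integral\<^sup>L lborel m = (LINT t:{a1..b1}|lborel. h t powr p * gap_measure \<kappa> t)"
    using gap_measure_bounds(1)[OF \<kappa>]
    by (simp add: set_lebesgue_integral_def m_def integral_nonneg)
qed

text \<open>
  Integrate \<open>flux_gap_bound\<close>. The kernel \<open>\<tau>\<close> has finite integral, so integrating it over pairs with one point
  in \<open>{gap > 0}\<close> leaves the measure of this set.
\<close>
lemma energy_inequality: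
  assumes \<kappa>: "0 \<le> \<kappa>" and b: "a < b" "b < c"
  shows "set_integrable lborel (UNIV \<times> {a..b}) (gap_gagliardo \<kappa>)"
    and "gap_energy \<kappa> b + Co * 2 powr (1 - p) * (LINT z:UNIV \<times> {a..b}|lborel. gap_gagliardo \<kappa> z) \<le>
      2 * C1 * young_const p * integral\<^sup>L lborel \<tau> * (LINT t:{a..b}|lborel. h t powr p * gap_measure \<kappa> t)"
proof -
  obtain G where [measurable]: "G \<in> borel_measurable borel" and G: "set_integrable lborel (UNIV \<times> {a..c}) G"
    "\<And>\<phi> z t. (\<And>x. 0 \<le> \<phi> x \<and> \<phi> x \<le> 1) \<Longrightarrow> (\<And>x. x \<notin> B \<Longrightarrow> \<phi> x = 0) \<Longrightarrow> t \<in> {a..c} \<Longrightarrow>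
      \<bar>flux \<phi> (z, t)\<bar> \<le> G (z, t) + C1 * indicator (B2 \<times> B2) z * gagliardo \<phi> z"
    using flux_dominated[OF times] by metis
  have [measurable]: "B \<times> cball x0 \<rho> \<in> sets borel" by (intro borel_closed closed_Times) auto
  have [measurable]: "(B \<times> cball x0 \<rho>) \<times> {a..c} \<in> sets borel" by (intro borel_closed closed_Times) auto
  define g1 where "g1 z = G z + \<epsilon> * indicator (B \<times> cball x0 \<rho>) (fst z)" for z :: "('a \<times> 'a) \<times> real"
  have ig1: "set_integrable lborel (UNIV \<times> {a..c}) g1"
    unfolding g1_def
  proof (intro set_integral_add(1) G set_integrable_mult_right)
    have "integrable lborel (\<lambda>z :: ('a \<times> 'a) \<times> real. indicator ((B \<times> cball x0 \<rho>) \<times> {a..c}) z :: real)"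
      using times emeasure_lborel_cball_finite[of x0 r] emeasure_lborel_cball_finite[of x0 \<rho>]
      by (intro integrable_real_indicator)
        (auto simp: lborel_prod[symmetric] lborel.emeasure_pair_measure_Times ennreal_mult_less_top)
    then show "set_integrable lborel (UNIV \<times> {a..c}) (\<lambda>z :: ('a \<times> 'a) \<times> real. indicator (B \<times> cball x0 \<rho>) (fst z) :: real)"
      unfolding set_integrable_def by (simp add: indicator_times mult_ac)
  qed
  have bound: "\<bar>rate \<kappa> x t\<bar> \<le> g1 x + near_gap \<kappa> (fst x, t)" if "snd x \<in> {a..c}" "t \<in> {a..c}" for x t
  proof -
    have "\<bar>flux (\<lambda>x. gap \<kappa> x t) (fst x, snd x)\<bar> \<le>
        G (fst x, snd x) + C1 * indicator (B2 \<times> B2) (fst x) * gagliardo (\<lambda>x. gap \<kappa> x t) (fst x)"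
      by (rule G(2)) (use that gap_bounds[OF \<kappa>] gap_outside[OF \<kappa>] in auto)
    moreover have "\<bar>\<epsilon> * (kick S l (snd (fst x)) (snd x) * gap \<kappa> (fst (fst x)) t)\<bar> \<le> \<epsilon> * indicator (B \<times> cball x0 \<rho>) (fst x)"
      using \<epsilon>(1) S(2) gap_bounds[OF \<kappa>, of "fst (fst x)" t] gap_outside[OF \<kappa>, of "fst (fst x)" t]
      by (cases x; cases "fst (fst x) \<in> B") (auto simp: kick_def abs_mult indicator_def)
    ultimately show ?thesis by (simp add: rate_def g1_def near_gap_def)
  qed
  note diag = diagonal_limit[OF b borel_measurable_rate ig1 integrable_near_gap[OF \<kappa>] _ _
      continuous_gap_energy[OF \<kappa>] continuous_rate[OF \<kappa>] continuous_near_gap[OF \<kappa>] bound energy_step[OF \<kappa>]]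
  have g1m: "g1 \<in> borel_measurable borel" unfolding g1_def by measurable
  have drate: "set_integrable lborel (UNIV \<times> {a..b}) (\<lambda>z. rate \<kappa> z (snd z))"
    and le: "gap_energy \<kappa> b - gap_energy \<kappa> a \<le> (LINT z:UNIV \<times> {a..b}|lborel. rate \<kappa> z (snd z))"
    using diag g1m by auto
  have "gap_energy \<kappa> a = 0" using u_nonneg by (simp add: gap_energy_def gap_def h_start)
  define m where "m x = indicator {a..b} (snd x) * (h (snd x) powr p * (if 0 < gap \<kappa> (fst x) (snd x) then 1 else 0))"
    for x :: "'a \<times> real"
  have ab: "a \<le> b" using b by simp
  note m = gap_weight_integral[OF \<kappa> ab, folded m_def[abs_def]]
  have m0: "0 \<le> m x" for x by (simp add: m_def)
  note mk = integrable_indicator_translated_kernel[OF integrable_kernel _ _ _ m(1) m0 m(2)]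
  have mk: "integrable lborel (\<lambda>z. m (fst (fst z), snd z) * \<tau> (fst (fst z) - snd (fst z)))"
    "integrable lborel (\<lambda>z. m (snd (fst z), snd z) * \<tau> (fst (fst z) - snd (fst z)))"
    "(\<integral>z. m (fst (fst z), snd z) * \<tau> (fst (fst z) - snd (fst z)) \<partial>lborel) = integral\<^sup>L lborel m * integral\<^sup>L lborel \<tau>"
    "(\<integral>z. m (snd (fst z), snd z) * \<tau> (fst (fst z) - snd (fst z)) \<partial>lborel) = integral\<^sup>L lborel m * integral\<^sup>L lborel \<tau>"
    by (rule mk; simp add: truncated_kernel_nonneg truncated_kernel_uminus)+
  show gain: "set_integrable lborel (UNIV \<times> {a..b}) (gap_gagliardo \<kappa>)"
  proof -
    let ?D = "\<lambda>z. indicator (UNIV \<times> {a..c}) z *\<^sub>R near_gap \<kappa> z / C1 +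
      (indicator (UNIV \<times> {a..b}) z *\<^sub>R (indicator B (fst (fst z)) * \<tau> (fst (fst z) - snd (fst z)))
       + indicator (UNIV \<times> {a..b}) z *\<^sub>R (indicator B (snd (fst z)) * \<tau> (fst (fst z) - snd (fst z))))"
    have "integrable lborel ?D"
      using integrable_near_gap[OF \<kappa>] integrable_indicator_ball_kernel[of a b r]
      unfolding set_integrable_def by (intro Bochner_Integration.integrable_add integrable_divide) auto
    then show ?thesis
      unfolding set_integrable_def
    proof (rule Bochner_Integration.integrable_bound)
      show "AE z in lborel. norm (indicator (UNIV \<times> {a..b}) z *\<^sub>R gap_gagliardo \<kappa> z) \<le> norm (?D z)"
      proof (intro AE_I2)
        fix z :: "('a \<times> 'a) \<times> real"
        obtain x y t where z: "z = ((x, y), t)" by (metis surj_pair)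
        have D0: "0 \<le> near_gap \<kappa> z / C1" using C1 by (simp add: near_gap_def gagliardo_nonneg)
        have D1: "0 \<le> indicator B x * \<tau> (x - y) + indicator B y * \<tau> (x - y)"
          using truncated_kernel_nonneg[of p \<alpha> r "x - y"] by simp
        have "gap_gagliardo \<kappa> z \<le> near_gap \<kappa> z / C1 + (indicator B x * \<tau> (x - y) + indicator B y * \<tau> (x - y))"
        proof (cases "x \<in> B2 \<and> y \<in> B2")
          case True
          then have "near_gap \<kappa> z / C1 = gap_gagliardo \<kappa> z" using C1 by (simp add: near_gap_def z)
          then show ?thesis using D1 by linarith
        next
          case False
          have "gagliardo (\<lambda>x. gap \<kappa> x t) (x, y) \<le> indicator B x * \<tau> (x - y) + indicator B y * \<tau> (x - y)"
            by (rule gagliardo_far[OF _ _ False]) (use gap_bounds[OF \<kappa>] gap_outside[OF \<kappa>] in auto)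
          then show ?thesis using D0 by (simp add: z)
        qed
        then show "norm (indicator (UNIV \<times> {a..b}) z *\<^sub>R gap_gagliardo \<kappa> z) \<le> norm (?D z)"
          using b D0 D1 by (cases "t \<in> {a..b}") (auto simp: z gagliardo_nonneg)
      qed
    qed measurable
  qed
  have "(LINT z:UNIV \<times> {a..b}|lborel. rate \<kappa> z (snd z)) \<le>
      (LINT z|lborel. C1 * young_const p * (m (fst (fst z), snd z) * \<tau> (fst (fst z) - snd (fst z)) + m (snd (fst z), snd z) * \<tau> (fst (fst z) - snd (fst z)))
      - Co * 2 powr (1 - p) * (indicator (UNIV \<times> {a..b}) z *\<^sub>R gap_gagliardo \<kappa> z))"
    unfolding set_lebesgue_integral_def
  proof (rule integral_mono)
    show "integrable lborel (\<lambda>z. indicator (UNIV \<times> {a..b}) z *\<^sub>R rate \<kappa> z (snd z))"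
      using drate by (simp add: set_integrable_def)
    show "integrable lborel (\<lambda>z. C1 * young_const p * (m (fst (fst z), snd z) * \<tau> (fst (fst z) - snd (fst z)) + m (snd (fst z), snd z) * \<tau> (fst (fst z) - snd (fst z)))
      - Co * 2 powr (1 - p) * (indicator (UNIV \<times> {a..b}) z *\<^sub>R gap_gagliardo \<kappa> z))"
      using gain unfolding set_integrable_def
      by (intro Bochner_Integration.integrable_diff integrable_mult_right Bochner_Integration.integrable_add mk)
    fix z :: "('a \<times> 'a) \<times> real"
    obtain x y t where z: "z = ((x, y), t)" by (metis surj_pair)
    show "indicator (UNIV \<times> {a..b}) z *\<^sub>R rate \<kappa> z (snd z) \<le> C1 * young_const p * (m (fst (fst z), snd z) * \<tau> (fst (fst z) - snd (fst z)) + m (snd (fst z), snd z) * \<tau> (fst (fst z) - snd (fst z)))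
      - Co * 2 powr (1 - p) * (indicator (UNIV \<times> {a..b}) z *\<^sub>R gap_gagliardo \<kappa> z)"
    proof (cases "t \<in> {a..b}")
      case True
      have "rate \<kappa> z (snd z) = flux (\<lambda>x. gap \<kappa> x t) ((x, y), t) + \<epsilon> * (indicator {y \<in> S. l \<le> u y t} y * gap \<kappa> x t)"
        by (simp add: rate_def z kick_def indicator_def)
      also have "\<dots> \<le> C1 * young_const p * (h t powr p * \<tau> (x - y) * (indicator {x. 0 < gap \<kappa> x t} x + indicator {x. 0 < gap \<kappa> x t} y))
        - Co * 2 powr (1 - p) * gagliardo (\<lambda>x. gap \<kappa> x t) (x, y)"
        by (rule flux_gap_bound[OF \<kappa>])
      finally have "rate \<kappa> z (snd z) \<le> \<dots>" .
      moreover have "m (x, t) = h t powr p * indicator {x. 0 < gap \<kappa> x t} x" "m (y, t) = h t powr p * indicator {x. 0 < gap \<kappa> x t} y"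
        using True by (auto simp: m_def indicator_def)
      ultimately show ?thesis using True by (simp add: z algebra_simps)
    qed (simp add: z m_def)
  qed
  also have "\<dots> = C1 * young_const p * (integral\<^sup>L lborel m * integral\<^sup>L lborel \<tau> + integral\<^sup>L lborel m * integral\<^sup>L lborel \<tau>)
      - Co * 2 powr (1 - p) * (LINT z:UNIV \<times> {a..b}|lborel. gap_gagliardo \<kappa> z)"
    using mk gain unfolding set_integrable_def set_lebesgue_integral_def
    by (simp add: Bochner_Integration.integral_add Bochner_Integration.integral_diff)
  finally have "(LINT z:UNIV \<times> {a..b}|lborel. rate \<kappa> z (snd z)) \<le>
      2 * C1 * young_const p * integral\<^sup>L lborel \<tau> * integral\<^sup>L lborel m - Co * 2 powr (1 - p) * (LINT z:UNIV \<times> {a..b}|lborel. gap_gagliardo \<kappa> z)"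
    by (simp add: algebra_simps)
  then show "gap_energy \<kappa> b + Co * 2 powr (1 - p) * (LINT z:UNIV \<times> {a..b}|lborel. gap_gagliardo \<kappa> z) \<le>
      2 * C1 * young_const p * integral\<^sup>L lborel \<tau> * (LINT t:{a..b}|lborel. h t powr p * gap_measure \<kappa> t)"
    using le \<open>gap_energy \<kappa> a = 0\<close> unfolding m(3) by linarith
qed

end

section \<open>De Giorgi iteration\<close>

text \<open>
  Here \<open>M j t\<close> is the measure of \<open>{gap > 0}\<close> at time \<open>t\<close> and level \<open>j\<close>, and \<open>Y j t\<close> is its weighted
  integral up to time \<open>t\<close>. Chebyshev's inequality bounds \<open>M (j + 1)\<close> by \<open>4\<^sup>j Y j / h\<^sup>2\<close>, at every time; the
  Gagliardo seminorm yields \<open>Y (j + 1) \<le> C\<^sup>j (sup M j) powr \<sigma> Y j\<close>. Together they give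
  \<open>Y j \<le> const q\<^sup>j h\<^sup>2\<close>, for \<open>q\<close> so small that \<open>(4 q) powr \<sigma>\<close> compensates the factor \<open>2\<^sup>p\<close>. The bounds
  are relative to \<open>h\<^sup>2\<close>, because \<open>h\<close> starts from 0.
\<close>
lemma fast_geometric_convergence:
  fixes E F p \<sigma> :: real
  assumes pos: "0 < E" "0 < F" "0 < p" "0 < \<sigma>"
  obtains \<nu> where "0 < \<nu>"
    "\<And>(M :: nat \<Rightarrow> real \<Rightarrow> real) Y h I t.
      (\<And>j t. t \<in> I \<Longrightarrow> 0 \<le> M j t) \<Longrightarrow> (\<And>j t. t \<in> I \<Longrightarrow> 0 \<le> Y j t) \<Longrightarrow>
      (\<And>j t. t \<in> I \<Longrightarrow> (h t)\<^sup>2 * M (Suc j) t \<le> E * 4 ^ j * Y j t) \<Longrightarrow>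
      (\<And>j t. t \<in> I \<Longrightarrow> h t = 0 \<Longrightarrow> M j t = 0) \<Longrightarrow>
      (\<And>j b \<mu>. b \<in> I \<Longrightarrow> 0 \<le> \<mu> \<Longrightarrow> (\<And>t. t \<in> I \<Longrightarrow> t \<le> b \<Longrightarrow> M j t \<le> \<mu>) \<Longrightarrow>
        Y (Suc j) b \<le> F * (2 powr p) ^ j * \<mu> powr \<sigma> * Y j b) \<Longrightarrow>
      (\<And>t. t \<in> I \<Longrightarrow> Y 1 t \<le> Y 0 t) \<Longrightarrow> (\<And>t. t \<in> I \<Longrightarrow> Y 0 t \<le> \<nu> * (h t)\<^sup>2) \<Longrightarrow>
      t \<in> I \<Longrightarrow> (\<lambda>j. M j t) \<longlonglongrightarrow> 0"
proof -
  \<comment> \<open>With this \<open>q\<close> the powers of \<open>j\<close> in the recursion cancel: \<open>(4 q) powr \<sigma> * 2 powr p = 1\<close>.\<close>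
  define q :: real where "q = 2 powr (- p / \<sigma>) / 4"
  have q: "0 < q" "4 * q < 1" "q \<le> 1"
  proof -
    show "0 < q" by (simp add: q_def)
    have "2 powr (- p / \<sigma>) < (2::real) powr 0" using pos by (intro powr_less_mono) auto
    then show "4 * q < 1" "q \<le> 1" by (auto simp: q_def)
  qed
  have q4: "(4 * q) powr \<sigma> * 2 powr p = 1"
    using pos by (simp add: q_def powr_powr powr_add[symmetric])
  \<comment> \<open>With this \<open>\<nu>\<close> the remaining constant of the recursion is exactly \<open>q\<close>.\<close>
  define \<nu> where "\<nu> = q / E * (q / (F * 2 powr p)) powr (1 / \<sigma>)"
  have \<nu>: "0 < \<nu>" using q pos by (simp add: \<nu>_def)
  have \<nu>\<sigma>: "F * 2 powr p * (E * \<nu> / q) powr \<sigma> = q"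
  proof -
    have "E * \<nu> / q = (q / (F * 2 powr p)) powr (1 / \<sigma>)" using q pos by (simp add: \<nu>_def)
    then have "(E * \<nu> / q) powr \<sigma> = q / (F * 2 powr p)" using q pos by (simp add: powr_powr)
    then show ?thesis using pos by simp
  qed
  show ?thesis
  proof (rule that[OF \<nu>])
    fix M :: "nat \<Rightarrow> real \<Rightarrow> real" and Y :: "nat \<Rightarrow> real \<Rightarrow> real" and h :: "real \<Rightarrow> real" and I t0
    assume M0: "\<And>j t. t \<in> I \<Longrightarrow> 0 \<le> M j t" and Y0: "\<And>j t. t \<in> I \<Longrightarrow> 0 \<le> Y j t"
      and cheb: "\<And>j t. t \<in> I \<Longrightarrow> (h t)\<^sup>2 * M (Suc j) t \<le> E * 4 ^ j * Y j t"
      and hz: "\<And>j t. t \<in> I \<Longrightarrow> h t = 0 \<Longrightarrow> M j t = 0"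
      and rec: "\<And>j b \<mu>. b \<in> I \<Longrightarrow> 0 \<le> \<mu> \<Longrightarrow> (\<And>t. t \<in> I \<Longrightarrow> t \<le> b \<Longrightarrow> M j t \<le> \<mu>) \<Longrightarrow>
        Y (Suc j) b \<le> F * (2 powr p) ^ j * \<mu> powr \<sigma> * Y j b"
      and Y1: "\<And>t. t \<in> I \<Longrightarrow> Y 1 t \<le> Y 0 t" and start: "\<And>t. t \<in> I \<Longrightarrow> Y 0 t \<le> \<nu> * (h t)\<^sup>2" and t0: "t0 \<in> I"
    have Mb: "M (Suc j) t \<le> E * \<nu> / q * (4 * q) ^ j" if t: "t \<in> I" and Yj: "Y j t \<le> \<nu> / q * q ^ j * (h t)\<^sup>2" for j t
    proof (cases "h t = 0")
      case True
      then show ?thesis using hz[OF t True] q pos \<nu> by simp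
    next
      case False
      have "(h t)\<^sup>2 * M (Suc j) t \<le> E * 4 ^ j * (\<nu> / q * q ^ j * (h t)\<^sup>2)"
        using cheb[OF t, of j] Yj pos by (smt (verit) mult_left_mono mult_nonneg_nonneg zero_le_power)
      also have "\<dots> = (h t)\<^sup>2 * (E * \<nu> / q * (4 * q) ^ j)" by (simp add: power_mult_distrib)
      finally show ?thesis by (rule mult_left_le_imp_le) (use False in simp)
    qed
    have main: "\<forall>t\<in>I. Y j t \<le> \<nu> / q * q ^ j * (h t)\<^sup>2 \<and> Y (Suc j) t \<le> \<nu> * q ^ j * (h t)\<^sup>2" for j
    proof (induction j)
      case 0
      have "\<nu> \<le> \<nu> / q" using q \<nu> by (simp add: field_simps)
      then have "\<nu> * (h t)\<^sup>2 \<le> \<nu> / q * (h t)\<^sup>2" for t by (intro mult_right_mono) auto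
      then show ?case using start Y1 by (auto intro: order_trans)
    next
      case (Suc j)
      show ?case
      proof (intro ballI conjI)
        fix t assume t: "t \<in> I"
        show "Y (Suc j) t \<le> \<nu> / q * q ^ Suc j * (h t)\<^sup>2" using Suc t q by simp
        have "Y (Suc (Suc j)) t \<le> F * (2 powr p) ^ Suc j * (E * \<nu> / q * (4 * q) ^ j) powr \<sigma> * Y (Suc j) t"
          using Suc Mb q pos \<nu> by (intro rec t) auto
        also have "(E * \<nu> / q * (4 * q) ^ j) powr \<sigma> = (E * \<nu> / q) powr \<sigma> * ((4 * q) powr \<sigma>) ^ j"
        proof -
          have "((4 * q) ^ j) powr \<sigma> = ((4 * q) powr \<sigma>) ^ j"
            using q by (induction j) (simp_all add: powr_mult)
          then show ?thesis using q pos \<nu> by (subst powr_mult) auto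
        qed
        also have "F * (2 powr p) ^ Suc j * ((E * \<nu> / q) powr \<sigma> * ((4 * q) powr \<sigma>) ^ j) * Y (Suc j) t
            = (F * 2 powr p * (E * \<nu> / q) powr \<sigma>) * ((4 * q) powr \<sigma> * 2 powr p) ^ j * Y (Suc j) t"
          by (simp add: power_mult_distrib mult_ac)
        also have "\<dots> = q * Y (Suc j) t" by (simp only: \<nu>\<sigma> q4) simp
        also have "\<dots> \<le> q * (\<nu> * q ^ j * (h t)\<^sup>2)" using Suc t q by (intro mult_left_mono) auto
        finally show "Y (Suc (Suc j)) t \<le> \<nu> * q ^ Suc j * (h t)\<^sup>2" by (simp add: mult_ac)
      qed
    qed
    have "(\<lambda>j. E * \<nu> / q * (4 * q) ^ j) \<longlonglongrightarrow> E * \<nu> / q * 0"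
      using q by (intro tendsto_mult tendsto_const LIMSEQ_power_zero) auto
    then have lim: "(\<lambda>j. E * \<nu> / q * (4 * q) ^ j) \<longlonglongrightarrow> 0" by simp
    have "(\<lambda>j. M (Suc j) t0) \<longlonglongrightarrow> 0"
    proof (rule tendsto_sandwich[OF _ _ tendsto_const lim]; intro always_eventually allI)
      fix j
      show "0 \<le> M (Suc j) t0" by (rule M0[OF t0])
      show "M (Suc j) t0 \<le> E * \<nu> / q * (4 * q) ^ j" using main[of j] t0 by (intro Mb) auto
    qed
    then show "(\<lambda>j. M j t0) \<longlonglongrightarrow> 0" by (rule LIMSEQ_imp_Suc)
  qed
qed

context barrier
begin

lemma gap_level_step:
  assumes "\<kappa> \<le> \<kappa>'" "0 < gap \<kappa>' x t" shows "h t * (\<kappa>' - \<kappa>) \<le> gap \<kappa> x t"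
  using assms u_nonneg[of x t] unfolding gap_def by (auto simp: max_def algebra_simps split: if_splits)

lemma gap_measure_antimono:
  assumes "0 \<le> \<kappa>" "\<kappa> \<le> \<kappa>'" shows "gap_measure \<kappa>' t \<le> gap_measure \<kappa> t"
proof -
  have "gap \<kappa>' x t \<le> gap \<kappa> x t" for x
    using assms h(1)[of t] mult_left_mono[of \<kappa> \<kappa>' "h t"] by (auto simp: gap_def algebra_simps)
  then have "{x. 0 < gap \<kappa>' x t} \<subseteq> {x. 0 < gap \<kappa> x t}" by (auto intro: less_le_trans)
  then show ?thesis
    using assms positivity_set_bounded(2)[of \<kappa>' t] positivity_set_bounded(2,3)[of \<kappa> t]
    unfolding gap_measure_def by (intro measure_mono_fmeasurable) (auto simp: fmeasurable_def)
qed

lemma gap_energy_chebyshev: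
  assumes "0 \<le> \<kappa>" "\<kappa> \<le> \<kappa>'"
  shows "(h t * (\<kappa>' - \<kappa>))\<^sup>2 * gap_measure \<kappa>' t \<le> 2 * gap_energy \<kappa> t"
proof -
  have \<kappa>': "0 \<le> \<kappa>'" using assms by simp
  note P = positivity_set_bounded[OF \<kappa>', of t]
  have "(h t * (\<kappa>' - \<kappa>))\<^sup>2 * gap_measure \<kappa>' t = (LINT x|lborel. (h t * (\<kappa>' - \<kappa>))\<^sup>2 * indicator {x. 0 < gap \<kappa>' x t} x)"
    using P by (simp add: gap_measure_def)
  also have "\<dots> \<le> (LINT x|lborel. (gap \<kappa> x t)\<^sup>2)"
  proof (rule integral_mono)
    show "integrable lborel (\<lambda>x. (h t * (\<kappa>' - \<kappa>))\<^sup>2 * indicator {x. 0 < gap \<kappa>' x t} x)"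
      using P by (intro integrable_mult_right integrable_real_indicator) auto
    show "(h t * (\<kappa>' - \<kappa>))\<^sup>2 * indicator {x. 0 < gap \<kappa>' x t} x \<le> (gap \<kappa> x t)\<^sup>2" for x
      using gap_level_step[OF assms(2), of x t] assms h(1)[of t]
      by (auto simp: indicator_def intro!: power_mono)
  qed (rule integrable_gap[OF assms(1)])
  finally show ?thesis by (simp add: gap_energy_def)
qed

text \<open>
  On \<open>{gap > 0}\<close> at level \<open>\<kappa>'\<close> the gap at the lower level \<open>\<kappa>\<close> is at least \<open>h (\<kappa>' - \<kappa>)\<close>, so
  \<open>superlevel_measure_le_gagliardo\<close> applies at almost every time.
\<close>
lemma gap_gagliardo_lower:
  assumes \<kappa>: "0 \<le> \<kappa>" "\<kappa> \<le> \<kappa>'" and b: "a < b" "b < c"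
    and \<mu>: "\<And>t. t \<in> {a<..b} \<Longrightarrow> gap_measure \<kappa> t \<le> \<mu>" "0 \<le> \<mu>"
  shows "(\<kappa>' - \<kappa>) powr p * (LINT t:{a..b}|lborel. h t powr p * gap_measure \<kappa>' t) \<le>
    (2 / unit_ball_vol (real DIM('a))) powr (\<alpha> / DIM('a)) * \<mu> powr (\<alpha> / DIM('a) - 1) *
    (LINT z:UNIV \<times> {a..b}|lborel. gap_gagliardo \<kappa> z)"
proof -
  let ?V = "(2 / unit_ball_vol (real DIM('a))) powr (\<alpha> / DIM('a))"
  let ?\<sigma> = "\<alpha> / DIM('a) - 1"
  have \<kappa>': "0 \<le> \<kappa>'" using \<kappa> by simp
  have ab: "a \<le> b" using b by simp
  have \<sigma>: "0 \<le> ?\<sigma>" using alpha(2) by (simp add: field_simps)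
  have "integrable (lborel \<Otimes>\<^sub>M lborel) (\<lambda>(z, t). indicator {a..b} t * gap_gagliardo \<kappa> (z, t))"
    using energy_inequality(1)[OF \<kappa>(1) b] unfolding set_integrable_def lborel_prod split_beta'
    by (simp add: indicator_times)
  note int = lborel_pair.AE_integrable_snd[OF this] lborel_pair.integrable_snd[OF this] lborel_pair.integral_snd[OF this]
  have D: "(LINT z:UNIV \<times> {a..b}|lborel. gap_gagliardo \<kappa> z) =
      (LINT t|lborel. LINT z|lborel. indicator {a..b} t * gap_gagliardo \<kappa> (z, t))"
    using int(3) by (simp add: set_lebesgue_integral_def lborel_prod split_beta' indicator_times)
  have "(\<kappa>' - \<kappa>) powr p * (LINT t:{a..b}|lborel. h t powr p * gap_measure \<kappa>' t) =
      (LINT t|lborel. (\<kappa>' - \<kappa>) powr p * (indicator {a..b} t *\<^sub>R (h t powr p * gap_measure \<kappa>' t)))"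
    by (simp add: set_lebesgue_integral_def)
  also have "\<dots> \<le> (LINT t|lborel. ?V * \<mu> powr ?\<sigma> * (LINT z|lborel. indicator {a..b} t * gap_gagliardo \<kappa> (z, t)))"
  proof (rule integral_mono_AE)
    show "integrable lborel (\<lambda>t. (\<kappa>' - \<kappa>) powr p * (indicator {a..b} t *\<^sub>R (h t powr p * gap_measure \<kappa>' t)))"
      using gap_weight_integral(4)[OF \<kappa>' ab] unfolding set_integrable_def by (rule integrable_mult_right)
    show "integrable lborel (\<lambda>t. ?V * \<mu> powr ?\<sigma> * (LINT z|lborel. indicator {a..b} t * gap_gagliardo \<kappa> (z, t)))"
      using int(2) by (rule integrable_mult_right)
    show "AE t in lborel. (\<kappa>' - \<kappa>) powr p * (indicator {a..b} t *\<^sub>R (h t powr p * gap_measure \<kappa>' t)) \<le>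
        ?V * \<mu> powr ?\<sigma> * (LINT z|lborel. indicator {a..b} t * gap_gagliardo \<kappa> (z, t))"
      using int(1)
    proof eventually_elim
      case (elim t)
      have rhs0: "0 \<le> ?V * \<mu> powr ?\<sigma> * (LINT z|lborel. indicator {a..b} t * gap_gagliardo \<kappa> (z, t))"
        by (intro mult_nonneg_nonneg integral_nonneg) (auto simp: gagliardo_nonneg)
      show ?case
      proof (cases "t \<in> {a..b} \<and> 0 < h t \<and> \<kappa> < \<kappa>'")
        case False
        then have 0: "(\<kappa>' - \<kappa>) powr p * (indicator {a..b} t *\<^sub>R (h t powr p * gap_measure \<kappa>' t)) = 0"
          using h(1)[of t] \<kappa> by (auto simp: indicator_def)
        show ?thesis unfolding 0 by (rule rhs0)
      next
        case True
        then have ta: "t \<in> {a<..b}" using h_start by (cases "t = a") auto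
        let ?w = "\<lambda>x. gap \<kappa> x t" and ?l = "h t * (\<kappa>' - \<kappa>)"
        have l: "0 < ?l" using True by simp
        have gi: "integrable lborel (gagliardo ?w)" using elim True by simp
        have A: "emeasure lborel {x. 0 < ?w x} = ennreal (gap_measure \<kappa> t)"
          using positivity_set_bounded(3)[OF \<kappa>(1), of t] by (simp add: gap_measure_def emeasure_eq_ennreal_measure)
        have sub: "{x. 0 < gap \<kappa>' x t} \<subseteq> {x. ?l \<le> ?w x}" using gap_level_step[OF \<kappa>(2)] by auto
        have "ennreal (?l powr p * gap_measure \<kappa>' t) = ennreal (?l powr p) * emeasure lborel {x. 0 < gap \<kappa>' x t}"
          using positivity_set_bounded(3)[OF \<kappa>', of t]
          by (simp add: gap_measure_def emeasure_eq_ennreal_measure ennreal_mult)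
        also have "\<dots> \<le> ennreal (?l powr p) * emeasure lborel {x. ?l \<le> ?w x}"
          using sub by (intro mult_left_mono emeasure_mono) auto
        also have "\<dots> \<le> ennreal (?V * gap_measure \<kappa> t powr ?\<sigma>) *
            (\<integral>\<^sup>+x. (\<integral>\<^sup>+y. ennreal (\<bar>?w x - ?w y\<bar> powr p / norm (x - y) powr \<alpha>) \<partial>lborel) \<partial>lborel)"
          using alpha p l A gap_measure_bounds[OF \<kappa>(1)] gap_bounds[OF \<kappa>(1)]
          by (intro superlevel_measure_le_gagliardo) auto
        also have "(\<integral>\<^sup>+x. (\<integral>\<^sup>+y. ennreal (\<bar>?w x - ?w y\<bar> powr p / norm (x - y) powr \<alpha>) \<partial>lborel) \<partial>lborel) = (\<integral>\<^sup>+z. ennreal (gagliardo ?w z) \<partial>lborel)"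
          by (subst lborel_prod[symmetric], subst lborel.nn_integral_fst[symmetric]) (simp_all add: gagliardo_def)
        also have "\<dots> = ennreal (integral\<^sup>L lborel (gagliardo ?w))"
          using gi gagliardo_nonneg by (intro nn_integral_eq_integral) auto
        finally have "ennreal (?l powr p * gap_measure \<kappa>' t) \<le> ennreal (?V * gap_measure \<kappa> t powr ?\<sigma> * integral\<^sup>L lborel (gagliardo ?w))"
          by (simp add: ennreal_mult[symmetric] integral_nonneg gagliardo_nonneg)
        then have "?l powr p * gap_measure \<kappa>' t \<le> ?V * gap_measure \<kappa> t powr ?\<sigma> * integral\<^sup>L lborel (gagliardo ?w)"
          by (subst (asm) ennreal_le_iff) (auto intro!: mult_nonneg_nonneg integral_nonneg simp: gagliardo_nonneg)
        also have "\<dots> \<le> ?V * \<mu> powr ?\<sigma> * integral\<^sup>L lborel (gagliardo ?w)"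
          using \<mu>(1)[OF ta] \<sigma> gap_measure_bounds[OF \<kappa>(1)]
          by (intro mult_right_mono mult_left_mono powr_mono2 integral_nonneg) (auto simp: gagliardo_nonneg)
        finally show ?thesis using True h(1)[of t] \<kappa> by (simp add: powr_mult mult_ac)
      qed
    qed
  qed
  also have "\<dots> = ?V * \<mu> powr ?\<sigma> * (LINT z:UNIV \<times> {a..b}|lborel. gap_gagliardo \<kappa> z)"
    unfolding D by simp
  finally show ?thesis .
qed

lemma h_mono:
  assumes "a \<le> t" "t \<le> t'" "t' \<le> c" shows "h t \<le> h t'"
proof -
  have "0 \<le> h t' - h t" unfolding h_increment[OF assms] using \<epsilon>(1)
    by (intro mult_nonneg_nonneg) (auto simp: set_lebesgue_integral_def intro!: integral_nonneg)
  then show ?thesis by simp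
qed

text \<open>
  Because \<open>h\<close> increases, \<open>h \<le> 1\<close> and \<open>p > 2\<close>, the starting value of the iteration is small relative to
  \<open>h\<^sup>2\<close> as soon as the time interval is short, whatever the size of \<open>h\<close>.
\<close>
lemma gap_weight_start:
  assumes "0 \<le> \<kappa>" "t \<in> {a<..<c}"
  shows "(LINT s:{a..t}|lborel. h s powr p * gap_measure \<kappa> s) \<le> measure lborel B * (c - a) * (h t)\<^sup>2"
proof -
  have at: "a \<le> t" using assms by simp
  have "(LINT s:{a..t}|lborel. h s powr p * gap_measure \<kappa> s) \<le> (LINT s:{a..t}|lborel. (h t)\<^sup>2 * measure lborel B)"
  proof (rule set_integral_mono)
    show "set_integrable lborel {a..t} (\<lambda>s. (h t)\<^sup>2 * measure lborel B)"
      unfolding set_integrable_def using at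
      by (intro integrable_scaleR_left integrable_real_indicator) (simp_all add: less_top[symmetric])
    fix s assume s: "s \<in> {a..t}"
    have "h s powr p \<le> h t powr p" using h_mono[of s t] h(1)[of s] s assms p by (intro powr_mono2) auto
    also have "\<dots> \<le> h t powr 2" using h[of t] p by (intro powr_mono') auto
    also have "\<dots> = (h t)\<^sup>2" using h(1)[of t] by (simp add: powr_numeral)
    finally show "h s powr p * gap_measure \<kappa> s \<le> (h t)\<^sup>2 * measure lborel B"
      using gap_measure_bounds[OF assms(1), of s] by (intro mult_mono) auto
  qed (rule gap_weight_integral(4)[OF assms(1) at])
  also have "\<dots> = (t - a) * ((h t)\<^sup>2 * measure lborel B)"
    using at by (simp add: set_lebesgue_integral_def)
  also have "\<dots> \<le> (c - a) * ((h t)\<^sup>2 * measure lborel B)"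
    using assms(2) by (intro mult_right_mono) auto
  finally show ?thesis by (simp add: mult_ac)
qed

lemma gap_weight_nonneg:
  assumes "0 \<le> \<kappa>" shows "0 \<le> (LINT s:{a..t}|lborel. h s powr p * gap_measure \<kappa> s)"
  using gap_measure_bounds(1)[OF assms] by (auto simp: set_lebesgue_integral_def intro!: integral_nonneg)

text \<open>
  Turns measures back into values: if the solution were smaller than \<open>h / 2\<close> at the centre, then by
  continuity it would lie below the barrier of level \<open>1 / 2\<close> in a whole ball.
\<close>
lemma gap_measure_positive_below:
  assumes t: "t \<in> {a<..<c}" and lt: "u x0 t < h t / 2"
  shows "\<exists>m>0. \<forall>\<kappa>. 0 \<le> \<kappa> \<and> \<kappa> \<le> 1 / 2 \<longrightarrow> m \<le> gap_measure \<kappa> t"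
proof -
  let ?f = "\<lambda>x. h t * (tent x - 1 / 2) - u x t"
  have "continuous_on (ball x0 (2 * r)) (\<lambda>x. u x t)"
    using times t r
    by (intro continuous_on_compose2[OF u_continuous, of "ball x0 (2 * r)" "\<lambda>x. (x, t)", simplified] continuous_intros) auto
  then have "continuous_on (ball x0 (2 * r)) ?f"
    unfolding tent_def using r by (intro continuous_intros) auto
  then have "open (ball x0 (2 * r) \<inter> ?f -` {0<..})" by (rule continuous_open_preimage) auto
  also have "ball x0 (2 * r) \<inter> ?f -` {0<..} = {x \<in> ball x0 (2 * r). 0 < ?f x}" by auto
  finally have "open {x \<in> ball x0 (2 * r). 0 < ?f x}" .
  moreover have "x0 \<in> {x \<in> ball x0 (2 * r). 0 < ?f x}" using lt r by (simp add: tent_def)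
  ultimately obtain e where e: "0 < e" "ball x0 e \<subseteq> {x \<in> ball x0 (2 * r). 0 < ?f x}"
    by (meson openE)
  show ?thesis
  proof (intro exI[of _ "measure lborel (ball x0 e)"] conjI allI impI)
    show "0 < measure lborel (ball x0 e)" using e(1) by (simp add: content_ball)
    fix \<kappa> :: real assume \<kappa>: "0 \<le> \<kappa> \<and> \<kappa> \<le> 1 / 2"
    have "0 < gap \<kappa> x t" if "x \<in> ball x0 e" for x
    proof -
      have "0 < ?f x" using that e(2) by auto
      moreover have "h t * (tent x - 1 / 2) \<le> h t * (tent x - \<kappa>)" using h(1)[of t] \<kappa> by (intro mult_left_mono) auto
      ultimately show ?thesis by (simp add: gap_def)
    qed
    then have "ball x0 e \<subseteq> {x. 0 < gap \<kappa> x t}" by auto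
    then show "measure lborel (ball x0 e) \<le> gap_measure \<kappa> t"
      unfolding gap_measure_def using positivity_set_bounded(2,3)[OF conjunct1[OF \<kappa>], of t]
      by (intro measure_mono_fmeasurable) (auto simp: fmeasurable_def)
  qed
qed

end

context fractional_supersolution
begin

text \<open>
  The length of the time interval is chosen before \<open>S\<close>, \<open>l\<close> and \<open>h\<close>.
\<close>
lemma barrier_lower_bound:
  shows "\<exists>\<nu>>0. \<forall>S l \<epsilon> \<rho> a c h. barrier s p \<alpha> Co C1 T r x0 K u S l \<epsilon> \<rho> a c h \<longrightarrow>
      measure lborel B * (c - a) \<le> \<nu> \<longrightarrow> (\<forall>t\<in>{a<..<c}. h t / 2 \<le> u x0 t)"
proof -
  \<comment> \<open>The summand 1 only makes the constant of the energy inequality visibly positive.\<close>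
  define \<Lambda> where "\<Lambda> = 2 * C1 * young_const p * integral\<^sup>L lborel \<tau> + 1"
  have \<Lambda>0: "0 \<le> 2 * C1 * young_const p * integral\<^sup>L lborel \<tau>"
    using C1 young_const_pos[of p] by (intro mult_nonneg_nonneg integral_nonneg) (auto simp: truncated_kernel_nonneg)
  then have \<Lambda>: "0 < \<Lambda>" by (simp add: \<Lambda>_def)
  define V where "V = (2 / unit_ball_vol (real DIM('a))) powr (\<alpha> / DIM('a))"
  have V: "0 < V"
  proof -
    have "0 < 2 / unit_ball_vol (real DIM('a))" by (intro divide_pos_pos unit_ball_vol_pos) auto
    then show ?thesis unfolding V_def by (simp only: powr_gt_zero)
  qed
  define \<sigma> where "\<sigma> = \<alpha> / DIM('a) - 1"
  have \<sigma>: "0 < \<sigma>" using alpha(2) by (simp add: \<sigma>_def field_simps)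
  have gain: "0 < Co * 2 powr (1 - p)" using Co by simp
  define F where "F = 4 powr p * (V * (\<Lambda> / (Co * 2 powr (1 - p))))"
  have E: "0 < 32 * \<Lambda>" and F: "0 < F" and p0: "0 < p" using \<Lambda> V gain p by (auto simp: F_def)
  show ?thesis
  proof (rule fast_geometric_convergence[OF E F p0 \<sigma>], goal_cases)
    case (1 \<nu>)
    note \<nu> = 1(1) and conv = 1(2)
    show ?case
    proof (intro exI[of _ \<nu>] conjI allI impI ballI)
      show "0 < \<nu>" by (rule \<nu>)
      fix S l \<epsilon> \<rho> a c h t
      assume bar: "barrier s p \<alpha> Co C1 T r x0 K u S l \<epsilon> \<rho> a c h"
        and small: "measure lborel B * (c - a) \<le> \<nu>" and t: "t \<in> {a<..<c}"
      interpret barrier s p \<alpha> Co C1 T r x0 K u S l \<epsilon> \<rho> a c h by (rule bar)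
      define \<kappa> :: "nat \<Rightarrow> real" where "\<kappa> j = (1 - (1 / 2) ^ j) / 2" for j
      have \<kappa>: "0 \<le> \<kappa> j" "\<kappa> j \<le> 1 / 2" "\<kappa> j \<le> \<kappa> (Suc j)" "\<kappa> (Suc j) - \<kappa> j = (1 / 4) * (1 / 2) ^ j" for j
        by (simp_all add: \<kappa>_def power_le_one field_simps)
      define M where "M j s = gap_measure (\<kappa> j) s" for j s
      define Y where "Y j s = (LINT \<tau>:{a..s}|lborel. h \<tau> powr p * gap_measure (\<kappa> j) \<tau>)" for j s
      have energy: "gap_energy (\<kappa> j) b \<le> \<Lambda> * Y j b"
        "(LINT z:UNIV \<times> {a..b}|lborel. gap_gagliardo (\<kappa> j) z) \<le> \<Lambda> / (Co * 2 powr (1 - p)) * Y j b"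
        if b: "b \<in> {a<..<c}" for j b
      proof -
        have Y0: "0 \<le> Y j b" unfolding Y_def by (rule gap_weight_nonneg[OF \<kappa>(1)])
        have g0: "0 \<le> (LINT z:UNIV \<times> {a..b}|lborel. gap_gagliardo (\<kappa> j) z)"
          by (auto simp: set_lebesgue_integral_def gagliardo_nonneg intro!: integral_nonneg)
        have e0: "0 \<le> gap_energy (\<kappa> j) b" by (auto simp: gap_energy_def intro!: integral_nonneg)
        have "gap_energy (\<kappa> j) b + Co * 2 powr (1 - p) * (LINT z:UNIV \<times> {a..b}|lborel. gap_gagliardo (\<kappa> j) z) \<le>
            2 * C1 * young_const p * integral\<^sup>L lborel \<tau> * Y j b"
          unfolding Y_def using b by (intro energy_inequality(2)[OF \<kappa>(1)]) auto
        also have "\<dots> \<le> \<Lambda> * Y j b" using Y0 by (intro mult_right_mono) (simp_all add: \<Lambda>_def)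
        finally have "gap_energy (\<kappa> j) b + Co * 2 powr (1 - p) * (LINT z:UNIV \<times> {a..b}|lborel. gap_gagliardo (\<kappa> j) z) \<le> \<Lambda> * Y j b" .
        moreover have "0 \<le> Co * 2 powr (1 - p) * (LINT z:UNIV \<times> {a..b}|lborel. gap_gagliardo (\<kappa> j) z)"
          using gain g0 by simp
        ultimately have 1: "gap_energy (\<kappa> j) b \<le> \<Lambda> * Y j b"
          and 2: "Co * 2 powr (1 - p) * (LINT z:UNIV \<times> {a..b}|lborel. gap_gagliardo (\<kappa> j) z) \<le> \<Lambda> * Y j b"
          using e0 by linarith+
        show "gap_energy (\<kappa> j) b \<le> \<Lambda> * Y j b" by (rule 1)
        show "(LINT z:UNIV \<times> {a..b}|lborel. gap_gagliardo (\<kappa> j) z) \<le> \<Lambda> / (Co * 2 powr (1 - p)) * Y j b"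
          using 2 gain by (simp add: pos_le_divide_eq mult.commute)
      qed
      have lim: "(\<lambda>j. M j t) \<longlonglongrightarrow> 0"
      proof (rule conv[where Y = Y and h = h and I = "{a<..<c}"])
        show "0 \<le> M j s" for j s unfolding M_def by (rule gap_measure_bounds(1)[OF \<kappa>(1)])
        show "0 \<le> Y j s" for j s unfolding Y_def by (rule gap_weight_nonneg[OF \<kappa>(1)])
        show "(h s)\<^sup>2 * M (Suc j) s \<le> 32 * \<Lambda> * 4 ^ j * Y j s" if s: "s \<in> {a<..<c}" for j s
        proof -
          have "(h s * ((1 / 4) * (1 / 2) ^ j))\<^sup>2 * M (Suc j) s \<le> 2 * gap_energy (\<kappa> j) s"
            using gap_energy_chebyshev[OF \<kappa>(1,3)[of j], of s] by (simp only: M_def \<kappa>(4))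
          also have "\<dots> \<le> 2 * (\<Lambda> * Y j s)" using energy(1)[OF s] by simp
          finally have le: "(h s * ((1 / 4) * (1 / 2) ^ j))\<^sup>2 * M (Suc j) s \<le> 2 * (\<Lambda> * Y j s)" .
          have four: "((1 / 4) * (1 / 2) ^ j)\<^sup>2 * (16 * 4 ^ j) = (1 :: real)"
          proof -
            have "(16 * 4 ^ j :: real) = (4 * 2 ^ j)\<^sup>2"
              by (simp add: power2_eq_square power_mult_distrib[symmetric])
            then have "((1 / 4) * (1 / 2) ^ j)\<^sup>2 * (16 * 4 ^ j) = (((1 / 4) * (1 / 2) ^ j) * (4 * 2 ^ j) :: real)\<^sup>2"
              by (simp only: power_mult_distrib)
            also have "((1 / 4) * (1 / 2) ^ j) * (4 * 2 ^ j) = (1 :: real)" by (simp add: power_divide)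
            finally show ?thesis by simp
          qed
          have "(h s)\<^sup>2 * M (Suc j) s = ((h s)\<^sup>2 * M (Suc j) s) * (((1 / 4) * (1 / 2) ^ j)\<^sup>2 * (16 * 4 ^ j))"
            by (simp only: four mult_1_right)
          also have "\<dots> = (h s * ((1 / 4) * (1 / 2) ^ j))\<^sup>2 * M (Suc j) s * (16 * 4 ^ j)"
            by (simp only: power_mult_distrib mult_ac)
          also have "\<dots> \<le> 2 * (\<Lambda> * Y j s) * (16 * 4 ^ j)" using le by (intro mult_right_mono) auto
          finally show ?thesis by (simp add: mult_ac)
        qed
        show "M j s = 0" if "h s = 0" for j s
        proof -
          have "\<not> 0 < gap (\<kappa> j) x s" for x using that gap_bounds(2)[OF \<kappa>(1)[of j], of x s] by simp
          then have "{x. 0 < gap (\<kappa> j) x s} = {}" by blast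
          then show ?thesis by (simp add: M_def gap_measure_def)
        qed
        show "Y (Suc j) b \<le> F * (2 powr p) ^ j * \<mu> powr \<sigma> * Y j b"
          if b: "b \<in> {a<..<c}" and \<mu>: "0 \<le> \<mu>" "\<And>s. s \<in> {a<..<c} \<Longrightarrow> s \<le> b \<Longrightarrow> M j s \<le> \<mu>" for j b \<mu>
        proof -
          have "(\<kappa> (Suc j) - \<kappa> j) powr p * Y (Suc j) b \<le> V * \<mu> powr \<sigma> * (LINT z:UNIV \<times> {a..b}|lborel. gap_gagliardo (\<kappa> j) z)"
            unfolding V_def \<sigma>_def Y_def
            by (rule gap_gagliardo_lower[OF \<kappa>(1,3)]) (use b \<mu> in \<open>auto simp: M_def\<close>)
          also have "\<dots> \<le> V * \<mu> powr \<sigma> * (\<Lambda> / (Co * 2 powr (1 - p)) * Y j b)"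
            using V by (intro mult_left_mono energy(2)[OF b]) auto
          finally have le: "((1 / 4) * (1 / 2) ^ j) powr p * Y (Suc j) b \<le> V * \<mu> powr \<sigma> * (\<Lambda> / (Co * 2 powr (1 - p)) * Y j b)"
            by (simp only: \<kappa>(4))
          have one: "(4 powr p * (2 powr p) ^ j) * ((1 / 4) * (1 / 2) ^ j) powr p = (1 :: real)"
          proof -
            have "(2 powr p) ^ j = (2 ^ j) powr p" for j :: nat by (induction j) (simp_all add: powr_mult)
            then have "4 powr p * (2 powr p) ^ j = (4 * 2 ^ j) powr p" by (simp add: powr_mult)
            then have "(4 powr p * (2 powr p) ^ j) * ((1 / 4) * (1 / 2) ^ j) powr p = ((4 * 2 ^ j) * ((1 / 4) * (1 / 2) ^ j)) powr p"
              by (simp only: powr_mult)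
            also have "(4 * 2 ^ j) * ((1 / 4) * (1 / 2) ^ j) = (1 :: real)" by (simp add: power_divide)
            finally show ?thesis by simp
          qed
          have "Y (Suc j) b = ((4 powr p * (2 powr p) ^ j) * ((1 / 4) * (1 / 2) ^ j) powr p) * Y (Suc j) b"
            by (simp only: one mult_1_left)
          also have "\<dots> = (4 powr p * (2 powr p) ^ j) * (((1 / 4) * (1 / 2) ^ j) powr p * Y (Suc j) b)"
            by (simp only: mult.assoc)
          also have "\<dots> \<le> (4 powr p * (2 powr p) ^ j) * (V * \<mu> powr \<sigma> * (\<Lambda> / (Co * 2 powr (1 - p)) * Y j b))"
            by (intro mult_left_mono le) auto
          finally show ?thesis by (simp add: F_def mult_ac)
        qed
        show "Y 1 s \<le> Y 0 s" if s: "s \<in> {a<..<c}" for s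
          unfolding Y_def
        proof (rule set_integral_mono)
          show "h \<tau> powr p * gap_measure (\<kappa> 1) \<tau> \<le> h \<tau> powr p * gap_measure (\<kappa> 0) \<tau>" for \<tau>
            using \<kappa>(1,3)[of 0] by (intro mult_left_mono gap_measure_antimono) auto
        qed (use s gap_weight_integral(4)[OF \<kappa>(1), of a s] in auto)
        show "Y 0 s \<le> \<nu> * (h s)\<^sup>2" if s: "s \<in> {a<..<c}" for s
          using gap_weight_start[OF \<kappa>(1) s, of 0] mult_right_mono[OF small, of "(h s)\<^sup>2"] by (simp add: Y_def)
        show "t \<in> {a<..<c}" by (rule t)
      qed
      \<comment> \<open>All levels \<open>\<kappa> j\<close> are at most \<open>1 / 2\<close>, so a ball below the barrier of level \<open>1 / 2\<close> would lie in every \<open>{gap > 0}\<close>.\<close>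
      show "h t / 2 \<le> u x0 t"
      proof (rule ccontr)
        assume "\<not> ?thesis"
        then have "u x0 t < h t / 2" by simp
        then obtain m where m: "0 < m" "\<forall>\<kappa>. 0 \<le> \<kappa> \<and> \<kappa> \<le> 1 / 2 \<longrightarrow> m \<le> gap_measure \<kappa> t"
          using gap_measure_positive_below[OF t] by blast
        then have "m \<le> M j t" for j using \<kappa> by (simp add: M_def)
        then have "m \<le> 0" using lim by (intro LIMSEQ_le_const[OF lim]) auto
        then show False using m(1) by simp
      qed
    qed
  qed
qed

end

section \<open>Vanishing propagates backwards in time\<close>

lemma continuous_AE_zero:
  fixes f :: "'b::euclidean_space \<Rightarrow> real"
  assumes U: "open U" and f: "continuous_on U f" and ae: "AE z in lborel. z \<in> U \<longrightarrow> f z = 0" and z: "z \<in> U"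
  shows "f z = 0"
proof (rule ccontr)
  assume "f z \<noteq> 0"
  have "open (U \<inter> f -` (- {0}))" by (rule continuous_open_preimage[OF f U]) auto
  then obtain e where e: "0 < e" "ball z e \<subseteq> U \<inter> f -` (- {0})"
    using \<open>f z \<noteq> 0\<close> z openE[of "U \<inter> f -` (- {0})" z] by auto
  have "AE y in lborel. y \<notin> ball z e" using ae by eventually_elim (use e in auto)
  then have "emeasure lborel (ball z e) = 0" by (subst (asm) AE_iff_null_sets[symmetric]) (auto simp: null_sets_def)
  moreover have "0 < measure lborel (ball z e)" using e(1) by (simp add: content_ball)
  ultimately show False by (simp add: measure_def)
qed

context fractional_supersolution
begin

text \<open>
  If \<open>u \<ge> l\<close> held on a set of positive measure, the height of the barrier would be positive at time \<open>t0\<close>,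
  and \<open>barrier_lower_bound\<close> would contradict \<open>u x0 t0 = 0\<close>. The interval extends slightly beyond \<open>t0\<close>, to
  \<open>c\<close>, because the energy inequality holds at interior times.
\<close>
lemma vanishing_backwards_level:
  assumes \<nu>: "\<forall>S l \<epsilon> \<rho> a c h. barrier s p \<alpha> Co C1 T r x0 K u S l \<epsilon> \<rho> a c h \<longrightarrow>
      measure lborel B * (c - a) \<le> \<nu> \<longrightarrow> (\<forall>t\<in>{a<..<c}. h t / 2 \<le> u x0 t)"
    and a: "0 < a" "a < t0" and c: "t0 < c" "c < T" and small: "measure lborel B * (c - a) \<le> \<nu>"
    and zero: "u x0 t0 = 0" and \<rho>: "0 < \<rho>" and l: "0 < l"
  shows "AE z in lborel. snd z \<in> {a..t0} \<longrightarrow> fst z \<in> cball x0 \<rho> \<longrightarrow> u (fst z) (snd z) < l"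
proof -
  define S where "S = cball x0 \<rho>"
  have S: "S \<in> sets borel" "S \<subseteq> cball x0 \<rho>" by (auto simp: S_def)
  define m where "m t = measure lborel {y \<in> S. l \<le> u y t}" for t
  define mS where "mS = measure lborel (cball x0 \<rho>)"
  have m: "0 \<le> m t" "m t \<le> mS" for t using superlevel_set(3)[OF S] by (auto simp: m_def mS_def)
  have mm[measurable]: "m \<in> borel_measurable borel"
    using borel_measurable_superlevel_measure[OF S] by (simp add: m_def[abs_def])
  have mS: "0 \<le> mS" by (simp add: mS_def)
  have im: "set_integrable lborel {x..y} m" for x y
    unfolding set_integrable_def
  proof (rule Bochner_Integration.integrable_bound)
    show "integrable lborel (\<lambda>t. indicator {x..y} t *\<^sub>R mS)"
      by (cases "x \<le> y") (auto intro!: integrable_scaleR_left integrable_real_indicator simp: less_top[symmetric])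
    show "AE t in lborel. norm (indicator {x..y} t *\<^sub>R m t) \<le> norm (indicator {x..y} t *\<^sub>R mS)"
      using m mS by (intro AE_I2) (auto simp: indicator_def)
  qed simp
  note hk = set_borel_integral_eq_integral[OF im]
  define F where "F t = integral {a..t} m" for t
  have F: "F t' - F t = (LINT \<tau>:{t..t'}|lborel. m \<tau>)" if "a \<le> t" "t \<le> t'" for t t'
    using Henstock_Kurzweil_Integration.integral_combine[OF that hk(1)] by (simp add: F_def hk(2))
  have Fa: "F a = 0" by (simp add: F_def)
  have LI: "0 \<le> (LINT \<tau>:{t..t'}|lborel. m \<tau>)" "(LINT \<tau>:{t..t'}|lborel. m \<tau>) \<le> mS * (t' - t)" if "t \<le> t'" for t t'
  proof -
    show "0 \<le> (LINT \<tau>:{t..t'}|lborel. m \<tau>)"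
      using m by (auto simp: set_lebesgue_integral_def intro!: integral_nonneg)
    have "(LINT \<tau>:{t..t'}|lborel. m \<tau>) \<le> (LINT \<tau>:{t..t'}|lborel. mS)"
    proof (rule set_integral_mono[OF im])
      show "set_integrable lborel {t..t'} (\<lambda>\<tau>. mS)"
        unfolding set_integrable_def using that
        by (intro integrable_scaleR_left integrable_real_indicator) (simp_all add: less_top[symmetric])
    qed (rule m)
    also have "\<dots> = mS * (t' - t)" using that by (simp add: set_lebesgue_integral_def mult.commute)
    finally show "(LINT \<tau>:{t..t'}|lborel. m \<tau>) \<le> mS * (t' - t)" .
  qed
  define b0 where "b0 = (3 * l / 4) powr (p - 1) / 2 * (Co / (\<rho> + r) powr \<alpha>)"
  have b0: "0 < b0" using l \<rho> r Co by (simp add: b0_def)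
  have den: "0 < (mS + 1) * (c - a)" using mS a c by simp
  \<comment> \<open>Besides the bound required of a barrier, \<open>\<epsilon>\<close> has to keep the total rise below \<open>min (l / 4) 1\<close>.\<close>
  define \<epsilon> where "\<epsilon> = min b0 (min (l / 4) 1 / ((mS + 1) * (c - a)))"
  have cancel: "x / D * D = x" if "0 < D" for x D :: real using that by simp
  have \<epsilon>: "0 < \<epsilon>" "\<epsilon> \<le> b0" "\<epsilon> * ((mS + 1) * (c - a)) \<le> min (l / 4) 1"
  proof -
    show "0 < \<epsilon>" "\<epsilon> \<le> b0" using b0 l den by (auto simp: \<epsilon>_def)
    have "\<epsilon> * ((mS + 1) * (c - a)) \<le> min (l / 4) 1 / ((mS + 1) * (c - a)) * ((mS + 1) * (c - a))"
      using den by (intro mult_right_mono) (auto simp: \<epsilon>_def)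
    then show "\<epsilon> * ((mS + 1) * (c - a)) \<le> min (l / 4) 1" by (simp only: cancel[OF den])
  qed
  \<comment> \<open>Constant continuation outside \<open>[a, c]\<close> makes the bounds hold at all times.\<close>
  define h where "h t = \<epsilon> * F (max a (min t c))" for t
  have h: "0 \<le> h t" "h t \<le> min (l / 4) 1" for t
  proof -
    let ?t = "max a (min t c)"
    have t: "a \<le> ?t" "?t \<le> c" using a c by auto
    have F0: "0 \<le> F ?t" "F ?t \<le> mS * (?t - a)" using F[OF order_refl t(1)] LI[OF t(1)] Fa by linarith+
    show "0 \<le> h t" using F0 \<epsilon> by (simp add: h_def)
    have "mS * (?t - a) \<le> (mS + 1) * (c - a)" using t mS by (intro mult_mono) auto
    then have "h t \<le> \<epsilon> * ((mS + 1) * (c - a))" unfolding h_def using F0 \<epsilon> by (intro mult_left_mono) auto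
    then show "h t \<le> min (l / 4) 1" using \<epsilon>(3) by simp
  qed
  have bar: "barrier s p \<alpha> Co C1 T r x0 K u S l \<epsilon> \<rho> a c h"
  proof (unfold_locales, goal_cases)
    case 1 then show ?case by (rule a)
  next case 2 then show ?case using a c by simp
  next case 3 then show ?case by (rule c)
  next case 4 then show ?case by (rule S)
  next case 5 then show ?case by (rule S)
  next case 6 then show ?case by (rule l)
  next case 7 then show ?case by (rule \<rho>)
  next case 8 then show ?case by (rule \<epsilon>)
  next case 9 then show ?case using \<epsilon>(2) by (simp add: b0_def)
  next
    case 10
    have "continuous_on {a..c} F" unfolding F_def by (intro indefinite_integral_continuous_1 hk)
    then have "continuous_on UNIV (\<lambda>t. F (max a (min t c)))"
      by (rule continuous_on_compose2) (use a c in \<open>auto intro!: continuous_intros\<close>)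
    then show ?case unfolding h_def[abs_def] by (rule continuous_on_mult_left)
  next case 11 then show ?case by (rule h)
  next case 12 then show ?case using h(2) by (meson min.bounded_iff)
  next case 13 then show ?case using h(2) by (meson min.bounded_iff)
  next case (14 t t') then show ?case
      using F[of t t'] by (simp add: h_def m_def right_diff_distrib[symmetric])
  next case 15 then show ?case using a c by (simp add: h_def Fa)
  qed
  have "\<forall>t\<in>{a<..<c}. h t / 2 \<le> u x0 t" using \<nu> bar small by blast
  moreover have "t0 \<in> {a<..<c}" using a c by simp
  ultimately have "h t0 / 2 \<le> u x0 t0" by (rule bspec)
  then have "h t0 / 2 \<le> 0" by (simp only: zero)
  then have "F t0 \<le> 0" using a c \<epsilon>(1) by (simp add: h_def mult_le_0_iff)
  then have z: "(LINT \<tau>:{a..t0}|lborel. m \<tau>) = 0" using F[of a t0] Fa LI(1)[of a t0] a by simp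
  note [measurable (raw)] = borel_measurable_kick'[OF S(1)]
  have "(\<integral>\<^sup>+z. ennreal (indicator {a..t0} (snd z) * kick S l (fst z) (snd z)) \<partial>lborel) =
      (\<integral>\<^sup>+t. \<integral>\<^sup>+y. ennreal (indicator {a..t0} t) * ennreal (kick S l y t) \<partial>lborel \<partial>lborel)"
    by (subst lborel_prod[symmetric], subst lborel_pair.nn_integral_snd[symmetric]) (simp_all add: ennreal_mult')
  also have "\<dots> = (\<integral>\<^sup>+t. ennreal (indicator {a..t0} t *\<^sub>R m t) \<partial>lborel)"
    using S(1) m by (simp add: nn_integral_cmult nn_integral_kick_general[OF S] m_def[symmetric] ennreal_mult)
  also have "\<dots> = ennreal (LINT \<tau>:{a..t0}|lborel. m \<tau>)"
    using im[of a t0] m unfolding set_integrable_def set_lebesgue_integral_def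
    by (intro nn_integral_eq_integral) auto
  finally have "(\<integral>\<^sup>+z. ennreal (indicator {a..t0} (snd z) * kick S l (fst z) (snd z)) \<partial>lborel) = 0" using z by simp
  then have "AE z in lborel. ennreal (indicator {a..t0} (snd z) * kick S l (fst z) (snd z)) = 0"
    by (subst (asm) nn_integral_0_iff_AE) simp_all
  then show ?thesis by eventually_elim (auto simp: kick_def S_def indicator_def not_le split: if_splits)
qed

text \<open>
  The sets \<open>cball x0 (n + 1)\<close>, the levels \<open>1 / (n + 1)\<close> and the starting times \<open>a' + 1 / (n + 1)\<close> exhaust
  all points where \<open>u\<close> is positive.
\<close>
lemma vanishing_backwards_uniform:
  obtains \<delta> where "0 < \<delta>"
    "\<And>t0. 0 < t0 \<Longrightarrow> t0 < T \<Longrightarrow> u x0 t0 = 0 \<Longrightarrow>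
      AE z in lborel. max 0 (t0 - \<delta>) < snd z \<longrightarrow> snd z \<le> t0 \<longrightarrow> u (fst z) (snd z) = 0"
proof -
  show ?thesis
  proof -
    obtain \<nu> where \<nu>: "0 < \<nu>"
      and lower: "\<forall>S l \<epsilon> \<rho> a c h. barrier s p \<alpha> Co C1 T r x0 K u S l \<epsilon> \<rho> a c h \<longrightarrow>
        measure lborel B * (c - a) \<le> \<nu> \<longrightarrow> (\<forall>t\<in>{a<..<c}. h t / 2 \<le> u x0 t)"
      using barrier_lower_bound by blast
    define mB where "mB = measure lborel B"
    have mB: "0 \<le> mB" by (simp add: mB_def)
    define e where "e = \<nu> / (mB + 1)"
    define \<delta> where "\<delta> = e / 2"
    have \<delta>: "0 < \<delta>" "mB * (2 * \<delta>) \<le> \<nu>"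
    proof -
      show "0 < \<delta>" using \<nu> mB by (simp add: \<delta>_def e_def)
      have "2 * \<delta> = e" by (simp add: \<delta>_def)
      then have "2 * \<delta> = \<nu> / (mB + 1)" unfolding e_def .
      then have "mB * (2 * \<delta>) = mB / (mB + 1) * \<nu>" by simp
      also have "\<dots> \<le> 1 * \<nu>" using mB \<nu> by (intro mult_right_mono) auto
      finally show "mB * (2 * \<delta>) \<le> \<nu>" by simp
    qed
    show ?thesis
    proof (rule that[OF \<delta>(1)])
      fix t0 assume t0: "0 < t0" "t0 < T" "u x0 t0 = 0"
      define a' where "a' = max 0 (t0 - \<delta>)"
      obtain e where e: "0 < e" "e < T - t0" "e \<le> \<delta>"
        using t0 \<delta> by (intro that[of "min \<delta> ((T - t0) / 2)"]) (auto simp: min_less_iff_disj)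
      define c where "c = t0 + e"
      have c: "t0 < c" "c < T" "c \<le> t0 + \<delta>" using e by (auto simp: c_def)
      have "AE z in lborel. snd z \<in> {a' + 1 / Suc n..t0} \<longrightarrow> fst z \<in> cball x0 (Suc n) \<longrightarrow> u (fst z) (snd z) < 1 / Suc n" for n
      proof (cases "a' + 1 / Suc n < t0")
        case True
        have "mB * (c - (a' + 1 / Suc n)) \<le> mB * (2 * \<delta>)"
        proof (intro mult_left_mono mB)
          have "t0 - \<delta> \<le> a'" "0 \<le> 1 / real (Suc n)" by (simp_all add: a'_def)
          then show "c - (a' + 1 / Suc n) \<le> 2 * \<delta>" using c(3) by linarith
        qed
        then have "mB * (c - (a' + 1 / Suc n)) \<le> \<nu>" using \<delta>(2) by linarith
        moreover have "0 < a' + 1 / Suc n" by (auto simp: a'_def intro: add_nonneg_pos)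
        ultimately show ?thesis
          using True c t0 vanishing_backwards_level[of \<nu> "a' + 1 / Suc n" t0 c "Suc n" "1 / Suc n", OF lower]
          by (simp add: mB_def)
      next
        case False
        have "AE z in (lborel :: ('a \<times> real) measure). snd z \<noteq> t0" by (rule AE_lborel_snd_neq)
        then show ?thesis by eventually_elim (use False in auto)
      qed
      then have "AE z in lborel. \<forall>n. snd z \<in> {a' + 1 / Suc n..t0} \<longrightarrow> fst z \<in> cball x0 (Suc n) \<longrightarrow> u (fst z) (snd z) < 1 / Suc n"
        by (simp only: AE_all_countable) blast
      then show "AE z in lborel. max 0 (t0 - \<delta>) < snd z \<longrightarrow> snd z \<le> t0 \<longrightarrow> u (fst z) (snd z) = 0"
      proof eventually_elim
        case (elim z)
        show ?case
        proof (intro impI, rule ccontr)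
          assume z: "max 0 (t0 - \<delta>) < snd z" "snd z \<le> t0" and "u (fst z) (snd z) \<noteq> 0"
          then have up: "0 < u (fst z) (snd z)" using u_nonneg[of "fst z" "snd z"] by simp
          have ev: "\<forall>\<^sub>F n in sequentially. 1 / real (Suc n) < e" if "0 < e" for e
            using order_tendstoD(2)[OF LIMSEQ_inverse_real_of_nat that] by (simp add: inverse_eq_divide)
          have "\<forall>\<^sub>F n in sequentially. dist x0 (fst z) \<le> real (Suc n)"
            using eventually_ge_at_top[of "nat \<lceil>dist x0 (fst z)\<rceil>"] by eventually_elim linarith
          moreover have "\<forall>\<^sub>F n in sequentially. 1 / real (Suc n) < u (fst z) (snd z)" by (rule ev[OF up])
          moreover have "\<forall>\<^sub>F n in sequentially. 1 / real (Suc n) < snd z - a'" using z by (intro ev) (simp add: a'_def)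
          ultimately have "\<forall>\<^sub>F n in sequentially. dist x0 (fst z) \<le> real (Suc n) \<and>
              1 / real (Suc n) < u (fst z) (snd z) \<and> 1 / real (Suc n) < snd z - a'"
            by eventually_elim blast
          then obtain n :: nat where "dist x0 (fst z) \<le> real (Suc n)" "1 / real (Suc n) < u (fst z) (snd z)" "1 / real (Suc n) < snd z - a'"
            using eventually_happens'[OF sequentially_bot] by blast
          then show False using elim[rule_format, of n] z(2) by (simp add: mem_cball)
        qed
      qed
    qed
  qed
qed

text \<open>
  Steps of length \<open>\<delta> / 2\<close> stay inside the window on which \<open>u\<close> is already known to vanish, so
  that continuity gives \<open>u x0 = 0\<close> at the next starting time.
\<close>
theorem vanishing_backwards:
  assumes t0: "0 < t0" "t0 < T" and zero: "u x0 t0 = 0"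
  shows "AE z in lborel. 0 < snd z \<longrightarrow> snd z \<le> t0 \<longrightarrow> u (fst z) (snd z) = 0"
proof (rule vanishing_backwards_uniform, goal_cases)
  case (1 \<delta>)
  note \<delta> = 1(1) and window = 1(2)
  have cont: "continuous_on (ball x0 (2 * r) \<times> {0<..<T}) (\<lambda>z. u (fst z) (snd z))"
    by (rule continuous_on_subset[OF u_continuous[unfolded split_beta']]) auto
  have "(AE z in lborel. max 0 (t0 - n * (\<delta> / 2)) < snd z \<longrightarrow> snd z \<le> t0 \<longrightarrow> u (fst z) (snd z) = 0)
      \<and> (0 < t0 - n * (\<delta> / 2) \<longrightarrow> u x0 (t0 - n * (\<delta> / 2)) = 0)" for n :: nat
  proof (induction n)
    case 0
    then show ?case using zero by auto
  next
    case (Suc n)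
    let ?t = "t0 - n * (\<delta> / 2)"
    have eq: "t0 - Suc n * (\<delta> / 2) = ?t - \<delta> / 2" by (simp add: field_simps)
    show ?case
    proof (cases "0 < ?t")
      case False
      then have "max 0 (t0 - Suc n * (\<delta> / 2)) = max 0 ?t" "\<not> 0 < t0 - Suc n * (\<delta> / 2)"
        using \<delta> unfolding eq by auto
      then show ?thesis using Suc by simp
    next
      case True
      have tT: "?t \<le> t0" "?t < T" using t0 \<delta> by (auto intro: le_less_trans[rotated])
      have b: "AE z in lborel. max 0 (?t - \<delta>) < snd z \<longrightarrow> snd z \<le> ?t \<longrightarrow> u (fst z) (snd z) = 0"
        using window[OF True tT(2)] Suc True by simp
      have 1: "AE z in lborel. max 0 (t0 - Suc n * (\<delta> / 2)) < snd z \<longrightarrow> snd z \<le> t0 \<longrightarrow> u (fst z) (snd z) = 0"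
        using b conjunct1[OF Suc]
      proof eventually_elim
        case (elim z)
        show ?case
        proof (intro impI)
          assume z: "max 0 (t0 - Suc n * (\<delta> / 2)) < snd z" "snd z \<le> t0"
          show "u (fst z) (snd z) = 0"
          proof (cases "snd z \<le> ?t")
            case True
            then show ?thesis using elim(1) z \<delta> unfolding eq by auto
          next
            case F: False
            then show ?thesis using elim(2) z True by auto
          qed
        qed
      qed
      have 2: "u x0 (?t - \<delta> / 2) = 0" if "0 < ?t - \<delta> / 2"
      proof -
        let ?U = "ball x0 (2 * r) \<times> {max 0 (?t - \<delta>)<..<?t}"
        have "(\<lambda>z. u (fst z) (snd z)) (x0, ?t - \<delta> / 2) = 0"
        proof (rule continuous_AE_zero[of ?U])
          show "open ?U" by (intro open_Times) auto
          show "continuous_on ?U (\<lambda>z. u (fst z) (snd z))" by (rule continuous_on_subset[OF cont]) (use tT in auto)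
          show "AE z in lborel. z \<in> ?U \<longrightarrow> u (fst z) (snd z) = 0" using b by eventually_elim auto
          show "(x0, ?t - \<delta> / 2) \<in> ?U" using that \<delta> r by auto
        qed
        then show ?thesis by simp
      qed
      show ?thesis using 1 2 unfolding eq by blast
    qed
  qed
  moreover obtain n :: nat where "t0 < n * (\<delta> / 2)"
    using reals_Archimedean3[of "\<delta> / 2"] \<delta> by auto
  ultimately have "AE z in lborel. max 0 (t0 - n * (\<delta> / 2)) < snd z \<longrightarrow> snd z \<le> t0 \<longrightarrow> u (fst z) (snd z) = 0" by blast
  then show ?case by eventually_elim (use \<open>t0 < n * (\<delta> / 2)\<close> in auto)
qed

end

section \<open>Lebesgue and Borel measurability on products\<close>

lemma AE_lebesgue_iff: "(AE x in lebesgue. P x) \<longleftrightarrow> (AE x in lborel. P x)"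
  by (rule AE_completion_iff)

text \<open>
  If the functions are not integrable, both sides are 0. Hence iterated integrals can be transferred one
  variable at a time, before the integrability of the sections is known.
\<close>
lemma integral_lebesgue_eq_lborel:
  fixes f g :: "'a::euclidean_space \<Rightarrow> real"
  assumes g: "g \<in> borel_measurable borel" and ae: "AE x in lborel. f x = g x"
  shows "integral\<^sup>L lebesgue f = integral\<^sup>L lborel g"
    and "integrable lborel g \<Longrightarrow> integrable lebesgue f"
proof -
  have gl: "g \<in> borel_measurable lebesgue" using g by (intro measurable_completion) simp
  have ae': "AE x in lebesgue. g x = f x" unfolding AE_lebesgue_iff using ae by eventually_elim simp
  then have fl: "f \<in> borel_measurable lebesgue" by (rule borel_measurable_AE[OF gl])
  have "integral\<^sup>L lebesgue f = integral\<^sup>L lebesgue g"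
    by (rule integral_cong_AE[OF fl gl]) (use ae' in \<open>auto elim: eventually_mono\<close>)
  then show "integral\<^sup>L lebesgue f = integral\<^sup>L lborel g" using g by (simp add: integral_completion)
  assume "integrable lborel g"
  then have "integrable lebesgue g" using g by (simp add: integrable_completion)
  moreover have "AE x in lebesgue. f x = g x" using ae' by eventually_elim simp
  ultimately show "integrable lebesgue f" using integrable_cong_AE[OF fl gl] by simp
qed

lemma integral_lborel_triple:
  fixes g :: "('a::euclidean_space \<times> 'b::euclidean_space) \<times> real \<Rightarrow> real"
  assumes "integrable lborel g"
  shows "integral\<^sup>L lborel g = (\<integral>t. \<integral>x. \<integral>y. g ((x, y), t) \<partial>lborel \<partial>lborel \<partial>lborel)"
proof -
  have gm[measurable]: "g \<in> borel_measurable borel" using borel_measurable_integrable[OF assms] by simp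
  have i: "integrable (lborel \<Otimes>\<^sub>M lborel) (\<lambda>(z, t). g (z, t))"
    using assms by (simp add: lborel_prod split_beta')
  have "integral\<^sup>L lborel g = (\<integral>t. \<integral>z. g (z, t) \<partial>lborel \<partial>lborel)"
    using lborel_pair.integral_snd[OF i] by (simp add: lborel_prod split_beta')
  also have "\<dots> = (\<integral>t. \<integral>x. \<integral>y. g ((x, y), t) \<partial>lborel \<partial>lborel \<partial>lborel)"
  proof (rule integral_cong_AE)
    show "AE t in lborel. (\<integral>z. g (z, t) \<partial>lborel) = (\<integral>x. \<integral>y. g ((x, y), t) \<partial>lborel \<partial>lborel)"
      using lborel_pair.AE_integrable_snd[OF i]
    proof eventually_elim
      case (elim t)
      then have "integrable (lborel \<Otimes>\<^sub>M lborel) (\<lambda>(x, y). g ((x, y), t))"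
        by (simp add: lborel_prod split_beta')
      from lborel_pair.integral_fst[OF this] show ?case by (simp add: lborel_prod split_beta')
    qed
  qed measurable
  finally show ?thesis .
qed

lemma nn_integral_lborel_assoc:
  fixes f :: "'a::euclidean_space \<times> 'b::euclidean_space \<times> real \<Rightarrow> ennreal"
  assumes [measurable]: "f \<in> borel_measurable borel"
  shows "integral\<^sup>N lborel f = (\<integral>\<^sup>+z. f (fst (fst z), snd (fst z), snd z) \<partial>lborel)"
proof -
  have "integral\<^sup>N lborel f = (\<integral>\<^sup>+x. \<integral>\<^sup>+w. f (x, w) \<partial>lborel \<partial>lborel)"
    by (subst lborel_prod[symmetric], subst lborel.nn_integral_fst[symmetric]) simp_all
  also have "\<dots> = (\<integral>\<^sup>+x. \<integral>\<^sup>+y. \<integral>\<^sup>+t. f (x, y, t) \<partial>lborel \<partial>lborel \<partial>lborel)"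
    by (intro nn_integral_cong, subst lborel_prod[symmetric], subst lborel.nn_integral_fst[symmetric]) simp_all
  also have "\<dots> = (\<integral>\<^sup>+z. \<integral>\<^sup>+t. f (fst z, snd z, t) \<partial>lborel \<partial>lborel)"
    by (subst lborel_prod[where 'a = 'a and 'b = 'b, symmetric], subst lborel.nn_integral_fst[symmetric]) simp_all
  also have "\<dots> = (\<integral>\<^sup>+z. f (fst (fst z), snd (fst z), snd z) \<partial>lborel)"
    by (subst lborel_prod[where 'a = "'a \<times> 'b" and 'b = real, symmetric], subst lborel.nn_integral_fst[symmetric]) simp_all
  finally show ?thesis .
qed

lemma AE_lborel_null_set:
  assumes "AE z in lborel. P z"
  obtains N where "N \<in> sets borel" "AE z in lborel. z \<notin> N" "\<And>z. z \<notin> N \<Longrightarrow> P z"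
proof -
  obtain N where N: "{z \<in> space lborel. \<not> P z} \<subseteq> N" "emeasure lborel N = 0" "N \<in> sets lborel"
    using assms by (rule AE_E)
  then have "AE z in lborel. z \<notin> N" by (intro AE_not_in) (auto simp: null_sets_def)
  with N show ?thesis by (intro that[of N]) auto
qed

lemma AE_lborel_pair_iff:
  fixes N :: "('a::euclidean_space \<times> 'b::euclidean_space) set"
  assumes [measurable]: "N \<in> sets borel"
  shows "(AE z in lborel. z \<notin> N) \<longleftrightarrow> (AE x in lborel. AE y in lborel. (x, y) \<notin> N)"
    and "(AE z in lborel. z \<notin> N) \<longleftrightarrow> (AE y in lborel. AE x in lborel. (x, y) \<notin> N)"
proof -
  have "{z \<in> space (lborel \<Otimes>\<^sub>M lborel). (fst z, snd z) \<notin> N} \<in> sets (lborel \<Otimes>\<^sub>M lborel)" by measurable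
  note iff = lborel_pair.AE_pair_iff[OF this] lborel_pair.AE_commute[OF this]
  show "(AE z in lborel. z \<notin> N) \<longleftrightarrow> (AE x in lborel. AE y in lborel. (x, y) \<notin> N)"
    unfolding lborel_prod[symmetric] using iff(1) by simp
  then show "(AE z in lborel. z \<notin> N) \<longleftrightarrow> (AE y in lborel. AE x in lborel. (x, y) \<notin> N)"
    using iff(2) by simp
qed

lemma AE_lborel_triple_iff:
  fixes N :: "(('a::euclidean_space \<times> 'b::euclidean_space) \<times> real) set"
  assumes [measurable]: "N \<in> sets borel"
  shows "(AE z in lborel. z \<notin> N) \<longleftrightarrow> (AE t in lborel. AE x in lborel. AE y in lborel. ((x, y), t) \<notin> N)"
    and "(AE z in lborel. z \<notin> N) \<longleftrightarrow> (AE t in lborel. AE y in lborel. AE x in lborel. ((x, y), t) \<notin> N)"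
proof -
  have m: "{w. (w, t) \<in> N} \<in> sets borel" for t by measurable
  show "(AE z in lborel. z \<notin> N) \<longleftrightarrow> (AE t in lborel. AE x in lborel. AE y in lborel. ((x, y), t) \<notin> N)"
    "(AE z in lborel. z \<notin> N) \<longleftrightarrow> (AE t in lborel. AE y in lborel. AE x in lborel. ((x, y), t) \<notin> N)"
    unfolding AE_lborel_pair_iff(2)[OF assms] using AE_lborel_pair_iff[OF m] by simp_all
qed

lemma AE_lborel_sections:
  fixes P :: "('a::euclidean_space \<times> 'b::euclidean_space) \<times> real \<Rightarrow> bool"
  assumes "AE z in lborel. P z"
  shows "AE t in lborel. AE x in lborel. AE y in lborel. P ((x, y), t)"
proof -
  obtain N where N: "N \<in> sets borel" "AE z in lborel. z \<notin> N" "\<And>z. z \<notin> N \<Longrightarrow> P z"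
    using AE_lborel_null_set[OF assms] by blast
  from N(2)[unfolded AE_lborel_triple_iff(1)[OF N(1)]] show ?thesis
  proof eventually_elim
    case (elim t)
    then show ?case
    proof eventually_elim
      case (elim x)
      then show ?case by eventually_elim (rule N(3))
    qed
  qed
qed

lemma AE_lborel_time_sections:
  fixes P :: "'a::euclidean_space \<times> real \<Rightarrow> bool"
  assumes "AE z in lborel. P z"
  shows "AE t in lborel. AE x in lborel. P (x, t)"
proof -
  obtain N where N: "N \<in> sets borel" "AE z in lborel. z \<notin> N" "\<And>z. z \<notin> N \<Longrightarrow> P z"
    using AE_lborel_null_set[OF assms] by blast
  from N(2)[unfolded AE_lborel_pair_iff(2)[OF N(1)]] show ?thesis
  proof eventually_elim
    case (elim t)
    then show ?case by eventually_elim (rule N(3))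
  qed
qed

lemma AE_lborel_pair_times:
  fixes P :: "'a::euclidean_space \<times> real \<Rightarrow> bool"
  assumes "AE z in lborel. P z"
  shows "AE z in (lborel :: (('a \<times> 'b::euclidean_space) \<times> real) measure). P (fst (fst z), snd z)"
    and "AE z in (lborel :: (('b \<times> 'a) \<times> real) measure). P (snd (fst z), snd z)"
proof -
  obtain N where N[measurable]: "N \<in> sets borel" and ae: "AE z in lborel. z \<notin> N" and P: "\<And>z. z \<notin> N \<Longrightarrow> P z"
    using AE_lborel_null_set[OF assms] by blast
  note sec = ae[unfolded AE_lborel_pair_iff(2)[OF N]]
  have m: "{z :: ('a \<times> 'b) \<times> real. (fst (fst z), snd z) \<in> N} \<in> sets borel"
    "{z :: ('b \<times> 'a) \<times> real. (snd (fst z), snd z) \<in> N} \<in> sets borel" by measurable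
  have "AE z in lborel. z \<notin> {z :: ('a \<times> 'b) \<times> real. (fst (fst z), snd z) \<in> N}"
    unfolding AE_lborel_triple_iff(2)[OF m(1)] using sec by eventually_elim simp
  then show "AE z in (lborel :: (('a \<times> 'b) \<times> real) measure). P (fst (fst z), snd z)"
    by eventually_elim (use P in auto)
  have "AE z in lborel. z \<notin> {z :: ('b \<times> 'a) \<times> real. (snd (fst z), snd z) \<in> N}"
    unfolding AE_lborel_triple_iff(1)[OF m(2)] using sec by eventually_elim simp
  then show "AE z in (lborel :: (('b \<times> 'a) \<times> real) measure). P (snd (fst z), snd z)"
    by eventually_elim (use P in auto)
qed

lemma AE_lborel_assoc:
  fixes P :: "'a::euclidean_space \<times> 'b::euclidean_space \<times> real \<Rightarrow> bool"
  shows "(AE w in lborel. P w) \<longleftrightarrow> (AE z in lborel. P (fst (fst z), snd (fst z), snd z))"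
proof -
  let ?f = "\<lambda>z :: ('a \<times> 'b) \<times> real. (fst (fst z), snd (fst z), snd z)"
  let ?g = "\<lambda>w :: 'a \<times> 'b \<times> real. ((fst w, fst (snd w)), snd (snd w))"
  have iff: "(AE w in lborel. w \<notin> N) \<longleftrightarrow> (AE z in lborel. ?f z \<notin> N)" if [measurable]: "N \<in> sets borel" for N
    using nn_integral_lborel_assoc[of "indicator N :: _ \<Rightarrow> ennreal"]
      nn_integral_0_iff_AE[of "indicator N :: _ \<Rightarrow> ennreal" lborel] nn_integral_0_iff_AE[of "\<lambda>z. indicator N (?f z) :: ennreal" lborel]
    by (simp add: indicator_eq_0_iff)
  show ?thesis
  proof
    assume "AE w in lborel. P w"
    then obtain N where N: "N \<in> sets borel" "AE w in lborel. w \<notin> N" "\<And>w. w \<notin> N \<Longrightarrow> P w"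
      using AE_lborel_null_set by blast
    from N(2)[unfolded iff[OF N(1)]] show "AE z in lborel. P (?f z)" by eventually_elim (rule N(3))
  next
    assume "AE z in lborel. P (?f z)"
    then obtain N where N[measurable]: "N \<in> sets borel" and ae: "AE z in lborel. z \<notin> N" and P: "\<And>z. z \<notin> N \<Longrightarrow> P (?f z)"
      using AE_lborel_null_set[of "\<lambda>z. P (?f z)"] by blast
    have m: "{w. ?g w \<in> N} \<in> sets borel" by measurable
    have "AE w in lborel. w \<notin> {w. ?g w \<in> N}" unfolding iff[OF m] using ae by simp
    then show "AE w in lborel. P w" by eventually_elim (use P[of "?g _"] in force)
  qed
qed

text \<open>
  This is the defining identity of the weak time derivative for functions that are constant in time.
\<close>
lemma integral_deriv_time_test_function:
  assumes "time_test_function T \<eta>"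
  shows "(LINT t:{0<..<T}|lebesgue. deriv \<eta> t) = 0"
proof (cases "0 < T")
  case True
  have d: "\<eta> differentiable_on UNIV" "deriv \<eta> differentiable_on UNIV"
    using assms unfolding time_test_function_def by (metis funpow_0, metis funpow_0 funpow_simps_right(2) comp_apply id_apply funpow.simps(2) One_nat_def)
  have D: "(\<eta> has_real_derivative deriv \<eta> x) (at x)" for x
    using d(1) by (auto simp: differentiable_on_def field_differentiable_def real_differentiable_def DERIV_deriv_iff_real_differentiable)
  have cont: "continuous_on A (deriv \<eta>)" for A
    using differentiable_imp_continuous_on[OF d(2)] continuous_on_subset by blast
  have z: "\<eta> t = 0" if "t \<notin> {0<..<T}" for t
    using assms that closure_subset[of "{t. \<eta> t \<noteq> 0}"] unfolding time_test_function_def by blast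
  have "(deriv \<eta> has_integral \<eta> T - \<eta> 0) {0..T}"
    using True D by (intro fundamental_theorem_of_calculus)
      (auto simp: has_real_derivative_iff_has_vector_derivative[symmetric] intro: DERIV_subset)
  then have i: "integral {0<..<T} (deriv \<eta>) = 0"
    using z[of 0] z[of T] by (auto simp: integral_open_interval_real[symmetric] dest: integral_unique)
  have "set_integrable lebesgue {0..T} (deriv \<eta>)"
    using absolutely_integrable_continuous_real[OF cont] .
  then have "set_integrable lebesgue {0<..<T} (deriv \<eta>)"
    by (rule set_integrable_subset) auto
  then show ?thesis using i by (simp add: set_lebesgue_integral_eq_integral)
qed (simp add: set_lebesgue_integral_def)

context fractional_data
begin

lemma Wsp_norm_finite:
  assumes [measurable]: "\<phi> \<in> borel_measurable borel"
    and \<phi>: "\<And>x. 0 \<le> \<phi> x \<and> \<phi> x \<le> 1" "\<And>x. x \<notin> B \<Longrightarrow> \<phi> x = 0"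
    and g: "set_integrable lborel (B2 \<times> B2) (gagliardo \<phi>)"
  shows "Wsp_norm_pow s p UNIV \<phi> < \<infinity>"
proof -
  have Bfin: "emeasure lborel B < \<infinity>" by (rule emeasure_lborel_cball_finite)
  have "(\<integral>\<^sup>+x. ennreal (\<bar>\<phi> x\<bar> powr p) \<partial>lborel) \<le> (\<integral>\<^sup>+x. indicator B x \<partial>lborel)"
  proof (intro nn_integral_mono)
    fix x
    have "\<bar>\<phi> x\<bar> powr p \<le> 1" using \<phi>(1)[of x] p by (intro powr_le1) auto
    then show "ennreal (\<bar>\<phi> x\<bar> powr p) \<le> indicator B x"
      using \<phi>(2)[of x] p by (cases "x \<in> B") auto
  qed
  also have "\<dots> < \<infinity>" using Bfin by simp
  finally have 1: "(\<integral>\<^sup>+x. ennreal (\<bar>\<phi> x\<bar> powr p) \<partial>lborel) < \<infinity>" .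
  have \<tau>fin: "(\<integral>\<^sup>+z. ennreal (\<tau> z) \<partial>lborel) < \<infinity>"
    using integrable_kernel by (simp add: integrable_iff_bounded truncated_kernel_nonneg)
  have \<tau>x: "(\<integral>\<^sup>+x. ennreal (\<tau> (x - y)) \<partial>lborel) = (\<integral>\<^sup>+z. ennreal (\<tau> z) \<partial>lborel)" for y
    by (rule nn_integral_translated_kernel) simp
  have far: "(\<integral>\<^sup>+z. ennreal (indicator B (snd z) * \<tau> (fst z - snd z)) \<partial>lborel) < \<infinity>"
    "(\<integral>\<^sup>+z. ennreal (indicator B (fst z) * \<tau> (fst z - snd z)) \<partial>lborel) < \<infinity>"
  proof -
    have e: "(\<integral>\<^sup>+y. \<integral>\<^sup>+x. ennreal (indicator B y * \<tau> (x - y)) \<partial>lborel \<partial>lborel) < \<infinity>"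
    proof -
      have "(\<integral>\<^sup>+y. \<integral>\<^sup>+x. ennreal (indicator B y * \<tau> (x - y)) \<partial>lborel \<partial>lborel) = (\<integral>\<^sup>+y. (\<integral>\<^sup>+z. ennreal (\<tau> z) \<partial>lborel) * indicator B y \<partial>lborel)"
        by (intro nn_integral_cong) (simp add: indicator_def \<tau>x)
      also have "\<dots> < \<infinity>" using \<tau>fin Bfin by (simp add: nn_integral_cmult_indicator ennreal_mult_less_top)
      finally show ?thesis .
    qed
    show "(\<integral>\<^sup>+z. ennreal (indicator B (snd z) * \<tau> (fst z - snd z)) \<partial>lborel) < \<infinity>"
      using e by (subst lborel_prod[symmetric], subst lborel_pair.nn_integral_snd[symmetric]) simp_all
    have "(\<integral>\<^sup>+z. ennreal (indicator B (fst z) * \<tau> (fst z - snd z)) \<partial>lborel) = (\<integral>\<^sup>+y. \<integral>\<^sup>+x. ennreal (indicator B y * \<tau> (y - x)) \<partial>lborel \<partial>lborel)"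
      by (subst lborel_prod[symmetric], subst lborel.nn_integral_fst[symmetric]) simp_all
    then show "(\<integral>\<^sup>+z. ennreal (indicator B (fst z) * \<tau> (fst z - snd z)) \<partial>lborel) < \<infinity>"
      using e by (simp add: truncated_kernel_minus)
  qed
  have "(\<integral>\<^sup>+x. \<integral>\<^sup>+y. ennreal (gagliardo \<phi> (x, y)) \<partial>lborel \<partial>lborel) = (\<integral>\<^sup>+z. ennreal (gagliardo \<phi> z) \<partial>lborel)"
    by (subst lborel_prod[symmetric], subst lborel.nn_integral_fst[symmetric]) simp_all
  also have "\<dots> \<le> (\<integral>\<^sup>+z. ennreal (indicator (B2 \<times> B2) z * gagliardo \<phi> z) + (ennreal (indicator B (fst z) * \<tau> (fst z - snd z)) + ennreal (indicator B (snd z) * \<tau> (fst z - snd z))) \<partial>lborel)"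
  proof (intro nn_integral_mono)
    fix z :: "'a \<times> 'a"
    have n: "0 \<le> indicator B (fst z) * \<tau> (fst z - snd z)" "0 \<le> indicator B (snd z) * \<tau> (fst z - snd z)" "0 \<le> indicator (B2 \<times> B2) z * gagliardo \<phi> z"
      by (auto simp: truncated_kernel_nonneg gagliardo_nonneg)
    have "gagliardo \<phi> z \<le> indicator (B2 \<times> B2) z * gagliardo \<phi> z + (indicator B (fst z) * \<tau> (fst z - snd z) + indicator B (snd z) * \<tau> (fst z - snd z))"
    proof (cases "z \<in> B2 \<times> B2")
      case True
      then show ?thesis using n by simp
    next
      case False
      then have "\<not> (fst z \<in> B2 \<and> snd z \<in> B2)" by (cases z) auto
      then have "gagliardo \<phi> (fst z, snd z) \<le> indicator B (fst z) * \<tau> (fst z - snd z) + indicator B (snd z) * \<tau> (fst z - snd z)"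
        by (intro gagliardo_far) (use \<phi> in auto)
      then show ?thesis using n by simp
    qed
    then show "ennreal (gagliardo \<phi> z) \<le> ennreal (indicator (B2 \<times> B2) z * gagliardo \<phi> z) + (ennreal (indicator B (fst z) * \<tau> (fst z - snd z)) + ennreal (indicator B (snd z) * \<tau> (fst z - snd z)))"
      using n by (simp add: ennreal_plus[symmetric] ennreal_leI del: ennreal_plus)
  qed
  also have "\<dots> = (\<integral>\<^sup>+z. ennreal (indicator (B2 \<times> B2) z * gagliardo \<phi> z) \<partial>lborel) +
      ((\<integral>\<^sup>+z. ennreal (indicator B (fst z) * \<tau> (fst z - snd z)) \<partial>lborel) + (\<integral>\<^sup>+z. ennreal (indicator B (snd z) * \<tau> (fst z - snd z)) \<partial>lborel))"
    by (subst nn_integral_add; (subst nn_integral_add)?; measurable)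
  also have "\<dots> < \<infinity>"
    using far g by (simp add: set_integrable_def integrable_iff_bounded abs_mult gagliardo_nonneg)
  finally have 2: "(\<integral>\<^sup>+x. \<integral>\<^sup>+y. ennreal (gagliardo \<phi> (x, y)) \<partial>lborel \<partial>lborel) < \<infinity>" .
  show ?thesis
    using 1 2 by (simp add: Wsp_norm_pow_def nn_integral_completion gagliardo_def \<alpha>[symmetric])
qed

lemma test_function_constant_in_time:
  assumes \<phi>m: "\<phi> \<in> borel_measurable borel"
    and \<phi>: "\<And>x. 0 \<le> \<phi> x \<and> \<phi> x \<le> 1" "\<And>x. x \<notin> B \<Longrightarrow> \<phi> x = 0"
    and g: "set_integrable lborel (B2 \<times> B2) (gagliardo \<phi>)" and BE: "B \<subseteq> E"
  shows "test_function s p E T (\<lambda>x t. \<phi> x) (\<lambda>x t. 0)"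
proof -
  note \<phi>m[measurable]
  have W: "Wsp_norm_pow s p UNIV \<phi> < \<infinity>" by (rule Wsp_norm_finite[OF \<phi>m \<phi> g])
  have \<phi>l: "\<phi> \<in> borel_measurable lebesgue" using \<phi>m by (intro measurable_completion) simp
  have \<phi>jl: "(\<lambda>(x, t). \<phi> x) \<in> borel_measurable (lebesgue :: ('a \<times> real) measure)"
    by (intro measurable_completion) simp
  have "\<phi> x = 0" if "x \<notin> E" for x using \<phi>(2)[of x] BE that by blast
  then have Wo: "in_Wsp_o s p E \<phi>" using W \<phi>l by (auto simp: in_Wsp_o_def in_Wsp_def intro!: AE_I2)
  have L2: "(\<integral>\<^sup>+x\<in>E. ennreal ((\<phi> x)\<^sup>2) \<partial>lebesgue) < \<infinity>"
  proof -
    have "(\<integral>\<^sup>+x\<in>E. ennreal ((\<phi> x)\<^sup>2) \<partial>lebesgue) \<le> (\<integral>\<^sup>+x. indicator B x \<partial>lebesgue)"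
    proof (intro nn_integral_mono)
      fix x
      have "(\<phi> x)\<^sup>2 \<le> 1" using \<phi>(1)[of x] by (simp add: power_le_one)
      then show "ennreal ((\<phi> x)\<^sup>2) * indicator E x \<le> indicator B x"
        using \<phi>(2)[of x] by (cases "x \<in> B") (auto simp: indicator_def)
    qed
    also have "\<dots> = emeasure lborel B" by (simp add: nn_integral_completion)
    also have "\<dots> < \<infinity>" by (rule emeasure_lborel_cball_finite)
    finally show ?thesis .
  qed
  have const: "(\<integral>\<^sup>+t\<in>{t1..t2}. C \<partial>lebesgue) < \<infinity>" if "C < \<infinity>" for C and t1 t2 :: real
  proof -
    have "(\<integral>\<^sup>+t\<in>{t1..t2}. C \<partial>lebesgue) = C * emeasure lborel {t1..t2}"
      by (simp add: nn_integral_completion nn_integral_cmult_indicator)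
    also have "\<dots> < \<infinity>" using that by (cases "t1 \<le> t2") (auto simp: ennreal_mult_less_top)
    finally show ?thesis .
  qed
  have W12: "W12loc_L2 T E (\<lambda>x t. \<phi> x) (\<lambda>x t. 0)"
    unfolding W12loc_L2_def
  proof (intro conjI allI impI)
    show "(\<lambda>(x, t). \<phi> x) \<in> borel_measurable (lebesgue_on (E \<times> {0<..T}))"
      by (rule measurable_restrict_space1[OF \<phi>jl])
    show "Cloc_L2 T E (\<lambda>x t. \<phi> x)"
      using L2 measurable_restrict_space1[OF \<phi>l] by (auto simp: Cloc_L2_def in_L2_def)
    show "(\<integral>\<^sup>+t\<in>{t1..t2}. (\<integral>\<^sup>+x\<in>E. ennreal ((\<phi> x)\<^sup>2) \<partial>lebesgue) \<partial>lebesgue) < \<infinity>" for t1 t2 :: real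
      using L2 by (rule const)
    fix \<eta> assume \<eta>: "time_test_function T \<eta>"
    have "(LINT t:{0<..<T}|lebesgue. deriv \<eta> t * \<phi> x) = 0" for x
      using integral_deriv_time_test_function[OF \<eta>] by simp
    then show "AE x in lebesgue_on E. (LINT t:{0<..<T}|lebesgue. deriv \<eta> t * \<phi> x) = - (LINT t:{0<..<T}|lebesgue. \<eta> t * 0)"
      by (simp add: set_lebesgue_integral_def)
  qed (auto simp: split_beta')
  show ?thesis
    unfolding test_function_def
  proof (intro conjI)
    show "(\<lambda>(x, t). \<phi> x) \<in> borel_measurable (lebesgue_on (UNIV \<times> {0<..T}))"
      by (rule measurable_restrict_space1[OF \<phi>jl])
    show "Lploc_Wsp s p T UNIV (\<lambda>x t. \<phi> x)"
      using W Wo const by (auto simp: Lploc_Wsp_def in_Wsp_o_def)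
  qed (use \<phi> W12 Wo in auto)
qed

end

section \<open>Borel representatives\<close>

lemma borel_representative_lebesgue_on:
  fixes f :: "'a::euclidean_space \<Rightarrow> real"
  assumes f: "f \<in> borel_measurable (lebesgue_on \<Omega>)" and \<Omega>: "\<Omega> \<in> sets borel"
  obtains g where "g \<in> borel_measurable borel" "AE x in lborel. x \<in> \<Omega> \<longrightarrow> g x = f x"
proof -
  have \<Omega>l: "\<Omega> \<inter> space lebesgue \<in> sets lebesgue" using \<Omega> by (simp add: sets_completionI_sets)
  then have "(\<lambda>x. indicator \<Omega> x *\<^sub>R f x) \<in> borel_measurable lebesgue"
    using f by (simp only: borel_measurable_restrict_space_iff[OF \<Omega>l])
  from completion_ex_borel_measurable_real[OF this]
  obtain g where g: "g \<in> borel_measurable lborel" "AE x in lborel. indicator \<Omega> x *\<^sub>R f x = g x" by blast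
  show ?thesis
  proof (rule that)
    show "g \<in> borel_measurable borel" using g(1) by simp
    show "AE x in lborel. x \<in> \<Omega> \<longrightarrow> g x = f x" using g(2) by eventually_elim auto
  qed
qed

lemma AE_lebesgue_on_iff:
  fixes P :: "'a::euclidean_space \<Rightarrow> bool"
  assumes "\<Omega> \<in> sets borel"
  shows "(AE x in lebesgue_on \<Omega>. P x) \<longleftrightarrow> (AE x in lborel. x \<in> \<Omega> \<longrightarrow> P x)"
proof -
  have "\<Omega> \<inter> space lebesgue \<in> sets lebesgue" using assms by (simp add: sets_completionI_sets)
  then show ?thesis by (simp add: AE_restrict_space_iff AE_lebesgue_iff)
qed

lemma sets_borel_time_slab:
  "(UNIV :: 'a::euclidean_space set) \<times> {0<..T::real} \<in> sets borel"
  "(UNIV :: 'a::euclidean_space set) \<times> {0<..<T::real} \<in> sets borel"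
  "(UNIV :: 'a::euclidean_space set) \<times> (UNIV :: 'b::euclidean_space set) \<times> {0<..T::real} \<in> sets borel"
proof -
  have "{z :: 'a \<times> real. snd z \<in> {0<..T}} \<in> sets borel" by measurable
  also have "{z :: 'a \<times> real. snd z \<in> {0<..T}} = UNIV \<times> {0<..T}" by auto
  finally show "(UNIV :: 'a set) \<times> {0<..T} \<in> sets borel" .
  have "{z :: 'a \<times> real. snd z \<in> {0<..<T}} \<in> sets borel" by measurable
  also have "{z :: 'a \<times> real. snd z \<in> {0<..<T}} = UNIV \<times> {0<..<T}" by auto
  finally show "(UNIV :: 'a set) \<times> {0<..<T} \<in> sets borel" .
  have "{w :: 'a \<times> 'b \<times> real. snd (snd w) \<in> {0<..T}} \<in> sets borel" by measurable
  also have "{w :: 'a \<times> 'b \<times> real. snd (snd w) \<in> {0<..T}} = UNIV \<times> UNIV \<times> {0<..T}" by auto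
  finally show "(UNIV :: 'a set) \<times> (UNIV :: 'b set) \<times> {0<..T} \<in> sets borel" .
qed

lemma nonneg_of_AE_nonneg:
  fixes u :: "'a::euclidean_space \<Rightarrow> real \<Rightarrow> real"
  assumes E: "open E" and cont: "continuous_on (E \<times> {0<..T}) (\<lambda>(x, t). u x t)"
    and nonneg: "AE (x, t) in lebesgue_on (UNIV \<times> {0<..<T}). 0 \<le> u x t"
    and xt: "x \<in> E" "t \<in> {0<..<T}"
  shows "0 \<le> u x t"
proof -
  have "(\<lambda>z. min 0 (u (fst z) (snd z))) (x, t) = 0"
  proof (rule continuous_AE_zero[of "E \<times> {0<..<T}"])
    show "open (E \<times> {0<..<T})" using E by (intro open_Times) auto
    show "continuous_on (E \<times> {0<..<T}) (\<lambda>z. min 0 (u (fst z) (snd z)))"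
      by (intro continuous_intros continuous_on_subset[OF cont[unfolded split_beta']]) auto
    show "AE z in lborel. z \<in> E \<times> {0<..<T} \<longrightarrow> min 0 (u (fst z) (snd z)) = 0"
      using nonneg unfolding AE_lebesgue_on_iff[OF sets_borel_time_slab(2)]
      by eventually_elim auto
  qed (use xt in auto)
  then show ?thesis by simp
qed

text \<open>
  On \<open>E\<close> the representative is \<open>u\<close> itself, so continuity is retained; elsewhere \<open>u\<close> may be changed on a
  null set and replaced by its positive part.
\<close>
lemma borel_representative_nonneg:
  fixes u :: "'a::euclidean_space \<Rightarrow> real \<Rightarrow> real"
  assumes E: "open E" and um: "(\<lambda>(x, t). u x t) \<in> borel_measurable (lebesgue_on (UNIV \<times> {0<..T}))"
    and cont: "continuous_on (E \<times> {0<..T}) (\<lambda>(x, t). u x t)"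
    and nonneg: "AE (x, t) in lebesgue_on (UNIV \<times> {0<..<T}). 0 \<le> u x t"
  obtains v where "(\<lambda>(x, t). v x t) \<in> borel_measurable (borel \<Otimes>\<^sub>M borel)" "\<And>x t. 0 \<le> v x t"
    "\<And>x t. x \<in> E \<Longrightarrow> t \<in> {0<..<T} \<Longrightarrow> v x t = u x t"
    "AE z in lborel. snd z \<in> {0<..<T} \<longrightarrow> v (fst z) (snd z) = u (fst z) (snd z)"
proof -
  obtain g where g[measurable]: "g \<in> borel_measurable borel"
    and ae: "AE z in lborel. z \<in> UNIV \<times> {0<..T} \<longrightarrow> g z = (case z of (x, t) \<Rightarrow> u x t)"
    using borel_representative_lebesgue_on[OF um sets_borel_time_slab(1)] by blast
  let ?Q = "E \<times> {0<..<T}"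
  have [measurable]: "?Q \<in> sets borel" using E by (intro borel_open open_Times) auto
  have [measurable]: "(\<lambda>z. indicator ?Q z *\<^sub>R u (fst z) (snd z)) \<in> borel_measurable borel"
    by (intro borel_measurable_continuous_on_indicator continuous_on_subset[OF cont[unfolded split_beta']]) auto
  define v where "v x t = indicator ?Q (x, t) *\<^sub>R u x t + indicator (- ?Q) (x, t) * max 0 (g (x, t))" for x t
  have nn: "0 \<le> u x t" if "x \<in> E" "t \<in> {0<..<T}" for x t
    by (rule nonneg_of_AE_nonneg[OF E cont nonneg that])
  show ?thesis
  proof (rule that[of v])
    have "(\<lambda>z. indicator ?Q z *\<^sub>R u (fst z) (snd z) + indicator (- ?Q) z * max 0 (g z)) \<in> borel_measurable borel"
      by measurable
    then show "(\<lambda>(x, t). v x t) \<in> borel_measurable (borel \<Otimes>\<^sub>M borel)"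
      by (simp add: v_def split_beta' borel_prod)
    show "0 \<le> v x t" for x t using nn[of x t] by (auto simp: v_def indicator_def)
    show "v x t = u x t" if "x \<in> E" "t \<in> {0<..<T}" for x t using that by (simp add: v_def)
    show "AE z in lborel. snd z \<in> {0<..<T} \<longrightarrow> v (fst z) (snd z) = u (fst z) (snd z)"
      using ae nonneg[unfolded AE_lebesgue_on_iff[OF sets_borel_time_slab(2)]]
      by eventually_elim (auto simp: v_def indicator_def split: prod.splits)
  qed
qed

text \<open>
  A Borel representative is clipped between its two bounds. The clipping changes it on a null set only:
  the bounds hold for almost every pair at each fixed time, and the exceptional set is Borel, hence
  null by Fubini's theorem.
\<close>
lemma borel_representative_kernel:
  fixes K :: "'a::euclidean_space \<Rightarrow> 'a \<Rightarrow> real \<Rightarrow> real"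
  assumes K: "admissible_kernel s p Co C1 T K" and C: "Co \<le> C1"
  obtains k where "(\<lambda>(z, t). k z t) \<in> borel_measurable (borel \<Otimes>\<^sub>M borel)"
    "\<And>x y t. Co / norm (x - y) powr (real DIM('a) + s * p) \<le> k (x, y) t"
    "\<And>x y t. k (x, y) t \<le> C1 / norm (x - y) powr (real DIM('a) + s * p)"
    "AE z in lborel. snd z \<in> {0<..T} \<longrightarrow> k (fst z) (snd z) = K (fst (fst z)) (snd (fst z)) (snd z)"
proof -
  let ?n = "\<lambda>x y :: 'a. norm (x - y) powr (real DIM('a) + s * p)"
  obtain g where g[measurable]: "g \<in> borel_measurable borel"
    and ae: "AE w in lborel. w \<in> UNIV \<times> UNIV \<times> {0<..T} \<longrightarrow> g w = (case w of (x, y, t) \<Rightarrow> K x y t)"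
  proof -
    have "(\<lambda>(x, y, t). K x y t) \<in> borel_measurable (lebesgue_on (UNIV \<times> UNIV \<times> {0<..T}))"
      using K by (simp add: admissible_kernel_def)
    from borel_representative_lebesgue_on[OF this sets_borel_time_slab(3) that] show thesis .
  qed
  define k where "k z t = max (Co / ?n (fst z) (snd z)) (min (C1 / ?n (fst z) (snd z)) (g (fst z, snd z, t)))" for z t
  have gK: "AE z in lborel. snd z \<in> {0<..T} \<longrightarrow> g (fst (fst z), snd (fst z), snd z) = K (fst (fst z)) (snd (fst z)) (snd z)"
    using ae unfolding AE_lborel_assoc by eventually_elim auto
  let ?bad = "{z. snd z \<in> {0<..T} \<and> \<not> (Co / ?n (fst (fst z)) (snd (fst z)) \<le> g (fst (fst z), snd (fst z), snd z) \<and>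
      g (fst (fst z), snd (fst z), snd z) \<le> C1 / ?n (fst (fst z)) (snd (fst z)))}"
  have bm: "?bad \<in> sets borel"
  proof -
    define lo hi G where "lo z = Co / ?n (fst (fst z)) (snd (fst z))" and "hi z = C1 / ?n (fst (fst z)) (snd (fst z))"
      and "G z = g (fst (fst z), snd (fst z), snd z)" for z :: "('a \<times> 'a) \<times> real"
    have [measurable]: "lo \<in> borel_measurable borel" "hi \<in> borel_measurable borel" "G \<in> borel_measurable borel"
      unfolding lo_def hi_def G_def by measurable
    have "{z. snd z \<in> {0<..T} \<and> \<not> (lo z \<le> G z \<and> G z \<le> hi z)} \<in> sets borel" by measurable
    then show ?thesis by (simp only: lo_def hi_def G_def)
  qed
  have "AE t in lborel. AE x in lborel. AE y in lborel. ((x, y), t) \<notin> ?bad"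
    using AE_lborel_sections[OF gK]
  proof eventually_elim
    case (elim t)
    show ?case
    proof (cases "t \<in> {0<..T}")
      case True
      then have "AE z in lborel. Co / ?n (fst z) (snd z) \<le> K (fst z) (snd z) t \<and> K (fst z) (snd z) t \<le> C1 / ?n (fst z) (snd z)"
      proof -
        have "AE (x, y) in lebesgue. Co / ?n x y \<le> K x y t \<and> K x y t = K y x t \<and> K x y t \<le> C1 / ?n x y"
          using K True unfolding admissible_kernel_def by blast
        then show ?thesis unfolding AE_lebesgue_iff by eventually_elim auto
      qed
      from lborel_pair.AE_pair[OF this[folded lborel_prod]] elim
      show ?thesis
      proof eventually_elim
        case (elim x)
        from elim(1,2) show ?case by eventually_elim (use True in auto)
      qed
    qed auto
  qed
  then have good: "AE z in lborel. z \<notin> ?bad" by (simp only: AE_lborel_triple_iff(1)[OF bm])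
  show ?thesis
  proof (rule that[of k])
    show "(\<lambda>(z, t). k z t) \<in> borel_measurable (borel \<Otimes>\<^sub>M borel)" unfolding k_def by measurable
    show "Co / ?n x y \<le> k (x, y) t" for x y t by (simp add: k_def)
    show "k (x, y) t \<le> C1 / ?n x y" for x y t using C by (auto simp: k_def intro: divide_right_mono)
    show "AE z in lborel. snd z \<in> {0<..T} \<longrightarrow> k (fst z) (snd z) = K (fst (fst z)) (snd (fst z)) (snd z)"
      using good gK by eventually_elim (auto simp: k_def indicator_def split: if_splits)
  qed
qed

section \<open>The dichotomy\<close>

lemma set_integrable_gagliardo_of_Lploc:
  fixes u v :: "'a::euclidean_space \<Rightarrow> real \<Rightarrow> real"
  assumes u: "Lploc_Wsp s p T A u" and ab: "0 < a" "a < b" "b < T" and A[measurable]: "A \<in> sets borel"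
    and vm: "(\<lambda>(x, t). v x t) \<in> borel_measurable (borel \<Otimes>\<^sub>M borel)"
    and vu: "\<And>x t. x \<in> A \<Longrightarrow> t \<in> {0<..<T} \<Longrightarrow> v x t = u x t"
  shows "set_integrable lborel ((A \<times> A) \<times> {a..b})
    (\<lambda>((x, y), t). \<bar>v x t - v y t\<bar> powr p / norm (x - y) powr (real DIM('a) + s * p))"
proof -
  note [measurable (raw)] = measurable_Pair_compose_split[OF vm]
  let ?\<alpha> = "real DIM('a) + s * p"
  define g where "g z = indicator A (fst (fst z)) * indicator A (snd (fst z)) * indicator {a..b} (snd z) *
    (\<bar>v (fst (fst z)) (snd z) - v (snd (fst z)) (snd z)\<bar> powr p / norm (fst (fst z) - snd (fst z)) powr ?\<alpha>)" for z
  have gm[measurable]: "g \<in> borel_measurable borel" unfolding g_def by measurable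
  have "(\<integral>\<^sup>+z. ennreal (g z) \<partial>lborel) = (\<integral>\<^sup>+t. \<integral>\<^sup>+x. \<integral>\<^sup>+y. ennreal (g ((x, y), t)) \<partial>lborel \<partial>lborel \<partial>lborel)"
    by (rule nn_integral_lborel_triple(1)) simp
  also have "\<dots> \<le> (\<integral>\<^sup>+t\<in>{a..b}. Wsp_norm_pow s p A (\<lambda>x. u x t) \<partial>lborel)"
  proof (intro nn_integral_mono)
    fix t :: real
    show "(\<integral>\<^sup>+x. \<integral>\<^sup>+y. ennreal (g ((x, y), t)) \<partial>lborel \<partial>lborel) \<le> Wsp_norm_pow s p A (\<lambda>x. u x t) * indicator {a..b} t"
    proof (cases "t \<in> {a..b}")
      case True
      then have t: "t \<in> {0<..<T}" using ab by auto
      have "(\<integral>\<^sup>+y. ennreal (g ((x, y), t)) \<partial>lborel) =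
          (\<integral>\<^sup>+y\<in>A. ennreal (\<bar>u x t - u y t\<bar> powr p / norm (x - y) powr ?\<alpha>) \<partial>lborel) * indicator A x" for x
        by (cases "x \<in> A") (use True t in \<open>auto simp: g_def vu indicator_def intro!: nn_integral_cong\<close>)
      then show ?thesis using True by (simp add: Wsp_norm_pow_def nn_integral_completion)
    qed (simp add: g_def)
  qed
  also have "\<dots> < \<infinity>" using u ab unfolding Lploc_Wsp_def by (simp add: nn_integral_completion)
  finally have "integrable lborel g" by (intro integrableI_nonneg) (auto simp: g_def)
  then show ?thesis
    unfolding set_integrable_def
    by (rule Bochner_Integration.integrable_cong[THEN iffD1, rotated -1]) (auto simp: g_def indicator_def split: prod.splits)
qed

lemma set_integrable_tail:
  fixes u v :: "'a::euclidean_space \<Rightarrow> real \<Rightarrow> real"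
  assumes tail: "(\<integral>\<^sup>+t\<in>{a..b}. (\<integral>\<^sup>+x. ennreal (\<bar>u x t\<bar> powr (p - 1) / (1 + norm x powr \<alpha>)) \<partial>lebesgue) \<partial>lebesgue) < \<infinity>"
    and ab: "0 < a" "b < T"
    and vm: "(\<lambda>(x, t). v x t) \<in> borel_measurable (borel \<Otimes>\<^sub>M borel)" and v0: "\<And>x t. 0 \<le> v x t"
    and vu: "AE z in lborel. snd z \<in> {0<..<T} \<longrightarrow> v (fst z) (snd z) = u (fst z) (snd z)"
  shows "set_integrable lborel (UNIV \<times> {a..b}) (\<lambda>(y, t). v y t powr (p - 1) / (1 + norm y powr \<alpha>))"
proof -
  note [measurable (raw)] = measurable_Pair_compose_split[OF vm]
  define g where "g z = indicator {a..b} (snd z) * (v (fst z) (snd z) powr (p - 1) / (1 + norm (fst z) powr \<alpha>))" for z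
  have gm[measurable]: "g \<in> borel_measurable borel" unfolding g_def by measurable
  have g0: "0 \<le> g z" for z by (auto simp: g_def intro!: mult_nonneg_nonneg divide_nonneg_nonneg add_nonneg_nonneg)
  have "(\<integral>\<^sup>+z. ennreal (g z) \<partial>lborel) = (\<integral>\<^sup>+t. \<integral>\<^sup>+y. ennreal (g (y, t)) \<partial>lborel \<partial>lborel)"
    by (subst lborel_prod[symmetric], subst lborel_pair.nn_integral_snd[symmetric]) simp_all
  also have "\<dots> = (\<integral>\<^sup>+t\<in>{a..b}. (\<integral>\<^sup>+x. ennreal (\<bar>u x t\<bar> powr (p - 1) / (1 + norm x powr \<alpha>)) \<partial>lborel) \<partial>lborel)"
  proof (intro nn_integral_cong_AE)
    show "AE t in lborel. (\<integral>\<^sup>+y. ennreal (g (y, t)) \<partial>lborel) =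
        (\<integral>\<^sup>+x. ennreal (\<bar>u x t\<bar> powr (p - 1) / (1 + norm x powr \<alpha>)) \<partial>lborel) * indicator {a..b} t"
      using AE_lborel_time_sections[OF vu]
    proof eventually_elim
      case (elim t)
      show ?case
      proof (cases "t \<in> {a..b}")
        case True
        then have t: "t \<in> {0<..<T}" using ab by auto
        have "AE y in lborel. ennreal (g (y, t)) = ennreal (\<bar>u y t\<bar> powr (p - 1) / (1 + norm y powr \<alpha>))"
          using elim
        proof eventually_elim
          case (elim y)
          then have "v y t = u y t" using t by simp
          then show ?case using v0[of y t] True by (simp add: g_def)
        qed
        then have "(\<integral>\<^sup>+y. ennreal (g (y, t)) \<partial>lborel) = (\<integral>\<^sup>+x. ennreal (\<bar>u x t\<bar> powr (p - 1) / (1 + norm x powr \<alpha>)) \<partial>lborel)"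
          by (rule nn_integral_cong_AE)
        then show ?thesis using True by simp
      qed (simp add: g_def)
    qed
  qed
  also have "\<dots> < \<infinity>" using tail by (simp add: nn_integral_completion)
  finally have "integrable lborel g" using g0 by (intro integrableI_nonneg) auto
  then show ?thesis unfolding set_integrable_def by (simp add: g_def[abs_def] split_beta' indicator_times)
qed

text \<open>
  The iterated Lebesgue integrals of the weak formulation agree with one integral of a Borel
  function over \<open>((x, y), t)\<close>, because the two integrands have the same sections almost everywhere.
\<close>
lemma (in fractional_data) weak_form_constant_in_time:
  assumes ab: "0 < a" "a < b" "b < T" and \<phi>m: "\<phi> \<in> borel_measurable borel"
    and \<phi>: "\<And>x. 0 \<le> \<phi> x \<and> \<phi> x \<le> 1" "\<And>x. x \<notin> B \<Longrightarrow> \<phi> x = 0"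
    and g: "set_integrable lborel (B2 \<times> B2) (gagliardo \<phi>)"
    and E: "B2 \<subseteq> E" and uv: "\<And>x t. x \<in> E \<Longrightarrow> t \<in> {0<..<T} \<Longrightarrow> u x t = v x t"
    and uv_ae: "AE z in lborel. snd z \<in> {0<..<T} \<longrightarrow> u (fst z) (snd z) = v (fst z) (snd z)"
    and KL: "AE z in lborel. snd z \<in> {0<..T} \<longrightarrow> K (fst z) (snd z) = L (fst (fst z)) (snd (fst z)) (snd z)"
  shows "weak_form_converges p L E v (\<lambda>x t. \<phi> x) (\<lambda>x t. 0) a b"
    and "weak_form p L E v (\<lambda>x t. \<phi> x) (\<lambda>x t. 0) a b =
      (LINT x|lborel. \<phi> x * (u x b - u x a)) + (LINT z:UNIV \<times> {a..b}|lborel. flux \<phi> z)"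
proof -
  note \<phi>m[measurable]
  have BE: "x \<in> B \<Longrightarrow> x \<in> E" for x using E r by auto
  obtain M where M: "0 \<le> M" "\<And>x s. x \<in> B2 \<Longrightarrow> s \<in> {a..b} \<Longrightarrow> u x s \<le> M"
    using u_bounded[OF ab(1,3)] by blast
  have BB: "B \<subseteq> B2" using r by auto
  have iu: "integrable lborel (\<lambda>x. \<phi> x * u x t)" if t: "t \<in> {a..b}" for t
  proof (rule integrable_bounded_support[where M = M and y = x0 and r = r])
    show "\<bar>\<phi> x * u x t\<bar> \<le> M" for x
    proof (cases "x \<in> B")
      case True
      then have "x \<in> B2" using BB by blast
      then have "\<phi> x * u x t \<le> 1 * M" using \<phi>(1)[of x] M(2)[OF _ t] M(1) u_nonneg[of x t] by (intro mult_mono) auto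
      then show ?thesis using \<phi>(1)[of x] u_nonneg[of x t] by simp
    qed (use \<phi>(2) M(1) in simp)
  qed (use \<phi> in auto)
  have slice: "indicator E x *\<^sub>R (\<phi> x * v x t) = \<phi> x * u x t" if "t \<in> {a..b}" for x t
    using BE[of x] \<phi>(2)[of x] uv[of x t] that ab by (cases "x \<in> B") auto
  have slice_int: "set_integrable lebesgue E (\<lambda>x. \<phi> x * v x t)" "(LINT x:E|lebesgue. \<phi> x * v x t) = (LINT x|lborel. \<phi> x * u x t)"
    if t: "t \<in> {a..b}" for t
    unfolding set_integrable_def set_lebesgue_integral_def slice[OF t]
    by (rule integral_lebesgue_eq_lborel; use iu[OF t] in simp)+
  define G where "G z = indicator (UNIV \<times> {a..b}) z *\<^sub>R flux \<phi> z" for z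
  have Gi: "integrable lborel G"
    using integrable_flux[OF ab \<phi>m \<phi> g] by (simp add: set_integrable_def G_def[abs_def])
  have Gm[measurable]: "G \<in> borel_measurable borel" using borel_measurable_integrable[OF Gi] by simp
  define H where "H z = indicator {a..b} (snd z) * (L (fst (fst z)) (snd (fst z)) (snd z) *
      Phi p (v (fst (fst z)) (snd z) - v (snd (fst z)) (snd z)) * (\<phi> (fst (fst z)) - \<phi> (snd (fst z))))" for z
  have HG: "AE z in lborel. H z = G z"
    using AE_lborel_pair_times[OF uv_ae] KL
  proof eventually_elim
    case (elim z)
    then show ?case using ab
      by (cases z) (auto simp: H_def G_def flux_def indicator_def)
  qed
  have "set_integrable lebesgue (UNIV \<times> UNIV \<times> {a..b})
       (\<lambda>(x, y, t). L x y t * Phi p (v x t - v y t) * (\<phi> x - \<phi> y))"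
  proof -
    let ?G = "\<lambda>w. G ((fst w, fst (snd w)), snd (snd w))"
    have "(\<integral>\<^sup>+w. ennreal (norm (?G w)) \<partial>lborel) = (\<integral>\<^sup>+z. ennreal (norm (G z)) \<partial>lborel)"
      by (subst nn_integral_lborel_assoc) simp_all
    also have "\<dots> < \<infinity>" using Gi by (simp add: integrable_iff_bounded)
    finally have "integrable lborel ?G" by (intro integrableI_bounded) simp_all
    moreover have "AE w in lborel. H ((fst w, fst (snd w)), snd (snd w)) = ?G w"
      unfolding AE_lborel_assoc using HG by simp
    ultimately have "integrable lebesgue (\<lambda>w. H ((fst w, fst (snd w)), snd (snd w)))"
      by (intro integral_lebesgue_eq_lborel(2)) simp_all
    then show ?thesis unfolding set_integrable_def by (simp add: H_def split_beta' indicator_times)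
  qed
  then show "weak_form_converges p L E v (\<lambda>x t. \<phi> x) (\<lambda>x t. 0) a b"
    using slice_int(1)[of a] slice_int(1)[of b] ab
    by (auto simp: weak_form_converges_def set_integrable_def split_beta')
  have "(LINT t:{a..b}|lebesgue. energy_form p (\<lambda>x y. L x y t) (\<lambda>x. v x t) \<phi>) =
      (LINT t|lborel. LINT x|lborel. LINT y|lborel. G ((x, y), t))"
    unfolding set_lebesgue_integral_def
  proof (rule integral_lebesgue_eq_lborel(1))
    show "(\<lambda>t. LINT x|lborel. LINT y|lborel. G ((x, y), t)) \<in> borel_measurable borel" by measurable
    show "AE t in lborel. indicator {a..b} t *\<^sub>R energy_form p (\<lambda>x y. L x y t) (\<lambda>x. v x t) \<phi> =
        (LINT x|lborel. LINT y|lborel. G ((x, y), t))"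
      using AE_lborel_sections[OF HG]
    proof eventually_elim
      case (elim t)
      have "(LINT x|lebesgue. LINT y|lebesgue. H ((x, y), t)) = (LINT x|lborel. LINT y|lborel. G ((x, y), t))"
      proof (rule integral_lebesgue_eq_lborel(1))
        show "AE x in lborel. (LINT y|lebesgue. H ((x, y), t)) = (LINT y|lborel. G ((x, y), t))"
          using elim by eventually_elim (rule integral_lebesgue_eq_lborel(1); simp)
      qed measurable
      moreover have "(LINT x|lebesgue. LINT y|lebesgue. H ((x, y), t)) =
          indicator {a..b} t *\<^sub>R energy_form p (\<lambda>x y. L x y t) (\<lambda>x. v x t) \<phi>"
        by (simp add: energy_form_def H_def)
      ultimately show ?case by simp
    qed
  qed
  also have "\<dots> = integral\<^sup>L lborel G" by (rule integral_lborel_triple[OF Gi, symmetric])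
  finally have energy: "(LINT t:{a..b}|lebesgue. energy_form p (\<lambda>x y. L x y t) (\<lambda>x. v x t) \<phi>) =
      (LINT z:UNIV \<times> {a..b}|lborel. flux \<phi> z)"
    by (simp add: G_def[abs_def] set_lebesgue_integral_def)
  have "(LINT x|lborel. \<phi> x * (u x b - u x a)) = (LINT x|lborel. \<phi> x * u x b) - (LINT x|lborel. \<phi> x * u x a)"
    using iu[of a] iu[of b] ab by (simp add: right_diff_distrib)
  then show "weak_form p L E v (\<lambda>x t. \<phi> x) (\<lambda>x t. 0) a b =
      (LINT x|lborel. \<phi> x * (u x b - u x a)) + (LINT z:UNIV \<times> {a..b}|lborel. flux \<phi> z)"
    using slice_int(2)[of a] slice_int(2)[of b] ab
    by (simp add: weak_form_def energy)
qed

theorem theorem1p2: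
  fixes s p Co C1 T to :: real
    and E :: "'a::euclidean_space set"
    and K :: "'a \<Rightarrow> 'a \<Rightarrow> real \<Rightarrow> real"
    and u :: "'a \<Rightarrow> real \<Rightarrow> real"
    and xo :: 'a
  assumes "0 < s" "s < 1" "2 < p" "0 < Co" "Co \<le> C1"
    and "open E" "0 < T"
    and "admissible_kernel s p Co C1 T K"
    and "local_weak_solution s p K E T u"
    and "continuous_on (E \<times> {0<..T}) (\<lambda>(x, t). u x t)"
    and "AE (x, t) in lebesgue_on (UNIV \<times> {0<..<T}). 0 \<le> u x t"
    and "xo \<in> E" "0 < to" "to < T"
  shows "(0 < u xo to \<longrightarrow> (\<forall>x\<in>E. \<forall>t\<in>{to..<T}. 0 < u x t)) \<and>
    (u xo to = 0 \<longrightarrow> (AE (x, t) in lebesgue_on (UNIV \<times> {0<..to}). u x t = 0))"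
proof -
  let ?\<alpha> = "real DIM('a) + s * p"
  have super: "local_weak_supersolution s p K E T u" using assms(9) by (simp add: local_weak_solution_def)
  have sol: "solution_class s p E T u" using super by (simp add: local_weak_supersolution_def)
  have um: "(\<lambda>(x, t). u x t) \<in> borel_measurable (lebesgue_on (UNIV \<times> {0<..T}))"
    using sol by (simp add: solution_class_def)
  obtain v where v: "(\<lambda>(x, t). v x t) \<in> borel_measurable (borel \<Otimes>\<^sub>M borel)" "\<And>x t. 0 \<le> v x t"
    "\<And>x t. x \<in> E \<Longrightarrow> t \<in> {0<..<T} \<Longrightarrow> v x t = u x t"
    "AE z in lborel. snd z \<in> {0<..<T} \<longrightarrow> v (fst z) (snd z) = u (fst z) (snd z)"
  proof -
    from borel_representative_nonneg[OF assms(6) um assms(10,11) that] show thesis .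
  qed
  obtain k where k: "(\<lambda>(z, t). k z t) \<in> borel_measurable (borel \<Otimes>\<^sub>M borel)"
    "\<And>x y t. Co / norm (x - y) powr ?\<alpha> \<le> k (x, y) t"
    "\<And>x y t. k (x, y) t \<le> C1 / norm (x - y) powr ?\<alpha>"
    "AE z in lborel. snd z \<in> {0<..T} \<longrightarrow> k (fst z) (snd z) = K (fst (fst z)) (snd (fst z)) (snd z)"
  proof -
    from borel_representative_kernel[OF assms(8,5) that] show thesis .
  qed
  have vanish: "AE z in lborel. 0 < snd z \<longrightarrow> snd z \<le> t \<longrightarrow> u (fst z) (snd z) = 0"
    if x: "x \<in> E" and t: "0 < t" "t < T" and zero: "u x t = 0" for x t
  proof -
    obtain R where R: "0 < R" "cball x R \<subseteq> E" using assms(6) x by (meson open_contains_cball)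
    define r where "r = R / 2"
    have rE: "0 < r" "cball x (2 * r) \<subseteq> E" using R by (auto simp: r_def)
    have B2: "compact (cball x (2 * r))" "cball x (2 * r) \<in> sets borel" by auto
    interpret fractional_data s p ?\<alpha> Co C1 T r x k v
    proof
      show "continuous_on (cball x (2 * r) \<times> {0<..<T}) (\<lambda>(x, t). v x t)"
      proof (rule continuous_on_cong[THEN iffD1, OF refl])
        show "continuous_on (cball x (2 * r) \<times> {0<..<T}) (\<lambda>(x, t). u x t)"
          using rE(2) by (intro continuous_on_subset[OF assms(10)]) auto
      qed (use rE(2) v(3) in auto)
      fix a b :: real assume ab: "0 < a" "a < b" "b < T"
      show "set_integrable lborel ((cball x (2 * r) \<times> cball x (2 * r)) \<times> {a..b})
          (\<lambda>((x, y), t). \<bar>v x t - v y t\<bar> powr p / norm (x - y) powr ?\<alpha>)"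
        using sol B2 rE(2) v(1,3) ab
        by (intro set_integrable_gagliardo_of_Lploc[of s p T _ u]) (auto simp: solution_class_def)
      have "(\<integral>\<^sup>+t\<in>{a..b}. (\<integral>\<^sup>+x. ennreal (\<bar>u x t\<bar> powr (p - 1) / (1 + norm x powr ?\<alpha>)) \<partial>lebesgue) \<partial>lebesgue) < \<infinity>"
        using sol ab by (simp add: solution_class_def)
      then show "set_integrable lborel (UNIV \<times> {a..b}) (\<lambda>(y, t). v y t powr (p - 1) / (1 + norm y powr ?\<alpha>))"
        by (rule set_integrable_tail[OF _ ab(1,3) v(1,2,4)])
    qed (use assms rE v k in auto)
    interpret fractional_supersolution s p ?\<alpha> Co C1 T r x k v
    proof
      fix a b \<phi>
      assume ab: "0 < a" "a < b" "b < T" and \<phi>m: "\<phi> \<in> borel_measurable borel"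
        and \<phi>: "\<And>y. 0 \<le> \<phi> y \<and> \<phi> y \<le> 1" "\<And>y. y \<notin> cball x r \<Longrightarrow> \<phi> y = 0"
        and g: "set_integrable lborel (cball x (2 * r) \<times> cball x (2 * r)) (gagliardo \<phi>)"
      have BE: "cball x r \<subseteq> E" using rE by (intro subset_trans[OF _ rE(2)]) auto
      note W = weak_form_constant_in_time[OF ab \<phi>m \<phi> g rE(2) v(3,4) k(4)]
      have "test_function s p E T (\<lambda>x t. \<phi> x) (\<lambda>x t. 0)"
        by (rule test_function_constant_in_time[OF \<phi>m \<phi> g BE])
      then have "0 \<le> weak_form p K E u (\<lambda>x t. \<phi> x) (\<lambda>x t. 0) a b"
        using super W(1) ab unfolding local_weak_supersolution_def by auto
      then show "0 \<le> (LINT x|lborel. \<phi> x * (v x b - v x a)) + (LINT z:UNIV \<times> {a..b}|lborel. flux \<phi> z)"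
        using W(2) by simp
    qed
    have "AE z in lborel. 0 < snd z \<longrightarrow> snd z \<le> t \<longrightarrow> v (fst z) (snd z) = 0"
      using vanishing_backwards[OF t] v(3)[OF x] t zero by simp
    then show ?thesis using v(4) by eventually_elim (use t in auto)
  qed
  show ?thesis
  proof (intro conjI impI ballI)
    assume "u xo to = 0"
    from vanish[OF assms(12,13,14) this]
    show "AE (x, t) in lebesgue_on (UNIV \<times> {0<..to}). u x t = 0"
      unfolding AE_lebesgue_on_iff[OF sets_borel_time_slab(1)] by eventually_elim auto
  next
    fix x t assume pos: "0 < u xo to" and x: "x \<in> E" and t: "t \<in> {to..<T}"
    have "0 \<le> u x t"
      by (rule nonneg_of_AE_nonneg[OF assms(6,10,11) x]) (use t assms(13) in auto)
    moreover have "u x t \<noteq> 0"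
    proof
      assume "u x t = 0"
      then have ae: "AE z in lborel. 0 < snd z \<longrightarrow> snd z \<le> t \<longrightarrow> u (fst z) (snd z) = 0"
        using vanish[OF x] t assms(13) by simp
      have zero: "u xo \<tau> = 0" if "\<tau> \<in> {0<..<t}" for \<tau>
      proof -
        have "(\<lambda>z. u (fst z) (snd z)) (xo, \<tau>) = 0"
        proof (rule continuous_AE_zero[of "E \<times> {0<..<t}"])
          show "continuous_on (E \<times> {0<..<t}) (\<lambda>z. u (fst z) (snd z))"
            by (rule continuous_on_subset[OF assms(10)[unfolded split_beta']]) (use t in auto)
          show "AE z in lborel. z \<in> E \<times> {0<..<t} \<longrightarrow> u (fst z) (snd z) = 0"
            using ae by eventually_elim auto
        qed (use assms(6,12) that in \<open>auto intro: open_Times\<close>)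
        then show ?thesis by simp
      qed
      \<comment> \<open>For \<open>t = to\<close> the value at \<open>(xo, to)\<close> is the limit of the values at earlier times.\<close>
      show False
      proof (cases "to < t")
        case True
        then show False using zero[of to] pos assms(13) by simp
      next
        case False
        then have to: "to = t" using t by simp
        have cont_xo: "continuous_on {0<..T} (u xo)"
          using assms(12) by (intro continuous_on_compose2[OF assms(10), of "{0<..T}" "\<lambda>t. (xo, t)", simplified] continuous_intros) auto
        define q where "q n = t - t / 2 * inverse (real (Suc n))" for n
        have tp: "0 < t" "t \<le> T" using t assms(13) by auto
        have q: "q n \<in> {0<..<t}" for n
        proof -
          have "0 < inverse (real (Suc n))" "inverse (real (Suc n)) \<le> 1" by (auto simp: inverse_eq_divide divide_le_eq)
          then have "0 < t / 2 * inverse (real (Suc n))" "t / 2 * inverse (real (Suc n)) \<le> t / 2 * 1"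
            using tp by (auto intro!: mult_pos_pos mult_left_mono simp del: of_nat_Suc)
          then show ?thesis using tp by (simp add: q_def del: of_nat_Suc)
        qed
        have "q \<longlonglongrightarrow> t - t / 2 * 0"
          unfolding q_def[abs_def] by (intro tendsto_diff tendsto_mult tendsto_const LIMSEQ_inverse_real_of_nat)
        then have "(\<lambda>n. u xo (q n)) \<longlonglongrightarrow> u xo t"
          by (intro continuous_on_tendsto_compose[OF cont_xo]) (use q tp in \<open>auto intro!: always_eventually less_imp_le less_le_trans[of _ t T]\<close>)
        moreover have "u xo (q n) = 0" for n by (rule zero[OF q])
        ultimately have "u xo t = 0" by (simp add: LIMSEQ_const_iff)
        then show False using pos to by simp
      qed
    qed
    ultimately show "0 < u x t" by simp
  qed
qed

end
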